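(* Let $\mathcal{W}$ be a cocomplete monoidal category, with unit $I$, whose monoidal product preserves colimits in each variable. The essential image of the functor $\Phi:\mathrm{StrMon}(\mathcal{N}ec,\mathcal{W})\to\mathrm{Fun}(\mathbf{\Delta},\mathcal{W}\mathrm{Cat})$ consists of all diagrams $\mathbb{D}:\mathbf{\Delta}\to\mathcal{W}\mathrm{Cat}$ satisfying the following properties. 1. The functor $\mathrm{Ob}\circ\mathbb{D}:\mathbf{\Delta}\to\mathrm{Set}$ is naturally isomorphic to the functor $\mathrm{Ob}:\mathbf{\Delta}\to\mathrm{Set}$ sending $[n]$ to its underlying set. (Via this isomorphism the object set of $\mathbb{D}^n=\mathbb{D}([n])$ is identified with $[n]$.) 2. For any integers $0\le i<j\le n$, $\mathbb{D}^n(j,i)$ is an initial object of $\mathcal{W}$. 3. The unit morphism $I\to\mathbb{D}^0(0,0)$ of $\mathbb{D}^0$ is an isomorphism. 4. For any inert morphism $\delta:[m]\to[n]$ in $\mathbf{\Delta}$, the induced morphism $\mathbb{D}(\delta)_{0,m}:\mathbb{D}^m(0,m)\to\mathbb{D}^n(\delta(0),\delta(m))$ in $\mathcal{W}$ is an isomorphism. Hence, for a diagram $\mathbb{D}:\mathbf{\Delta}\to\mathcal{W}\mathrm{Cat}$, the associated right-adjoint functor $N^{\mathbb{D}}:\mathcal{W}\mathrm{Cat}\to\mathrm{SSet}$ is a necklicial nerve if and only if $\mathbb{D}$ satisfies properties 1-4.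
   Context: Necklaces. $\mathrm{SSet}_{*,*}$ is the category of bipointed simplicial sets; $\Delta^n$ is bipointed by $0$ and $n$; the wedge $K_{a,b}\vee L_{c,d}$ glues $b$ to $c$ and is bipointed by $a,d$. A necklace is $\Delta^{n_1}\vee\dots\vee\Delta^{n_k}$ with $k\ge 0$, $n_i>0$ ($\Delta^0$ if $k=0$). $\mathcal{N}ec\subseteq\mathrm{SSet}_{*,*}$ is the full subcategory of necklaces, monoidal under $\vee$ with unit $\Delta^0$. Let $\mathbf{\Delta}$ be the simplex category. Equivalently, a necklace is a pair $(T,p)$ with $\{0,p\}\subseteq T\subseteq[p]$ (with $\Delta^n=(\{0,n\},n)$), and a morphism $(T,p)\to(U,q)$ is an order-preserving $f:[p]\to[q]$ with $f(0)=0$, $f(p)=q$ and $U\subseteq f(T)$. A morphism $\delta:[m]\to[n]$ of $\mathbf{\Delta}$ is inert if $\delta(i)=\delta(0)+i$ for all $i\in[m]$. Conventions. $\mathcal{W}\mathrm{Cat}$ is the category of small $\mathcal{W}$-enriched categories, with compositions written $\mathcal{C}(A,B)\otimes\mathcal{C}(B,C)\to\mathcal{C}(A,C)$; $\mathrm{Ob}:\mathcal{W}\mathrm{Cat}\to\mathrm{Set}$ takes object sets. $\mathrm{StrMon}(\mathcal{N}ec,\mathcal{W})$ is the category of strong monoidal functors and monoidal natural transformations. The functor $\Phi$. For $D:\mathcal{N}ec\to\mathcal{W}$ strong monoidal, $\Phi(D)^n$ is the $\mathcal{W}$-category with object set $[n]$ and $\Phi(D)^n(i,j)=D(\Delta^{j-i})$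 if $i\le j$, and an initial object $0$ if $i>j$. For $i\le k\le j$ the composition is $D(\Delta^{k-i})\otimes D(\Delta^{j-k})\simeq D(\Delta^{k-i}\vee\Delta^{j-k})\to D(\Delta^{j-i})$ (induced by the necklace map with underlying map $\mathrm{id}_{[j-i]}$), and identities are given by $I\simeq D(\Delta^0)$. For $f:[m]\to[n]$ in $\mathbf{\Delta}$, $\Phi(D)(f)$ is $f$ on objects and $D(f_{i,j}):D(\Delta^{j-i})\to D(\Delta^{f(j)-f(i)})$ on hom-objects ($i\le j$), where $f_{i,j}(k)=f(k+i)-f(i)$. For a monoidal natural transformation $\alpha$, $\Phi(\alpha)^n$ is the identity on objects and $\alpha_{\Delta^{j-i}}$ on hom-objects for $i\le j$. Nerves. For $\mathbb{D}:\mathbf{\Delta}\to\mathcal{W}\mathrm{Cat}$, $N^{\mathbb{D}}(\mathcal{C})_n=\mathcal{W}\mathrm{Cat}(\mathbb{D}^n,\mathcal{C})$. $N^{\mathbb{D}}$ is a necklicial nerve if $\mathbb{D}\simeq\Phi(D)$ for some strong monoidal $D:\mathcal{N}ec\to\mathcal{W}$. *)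

theory Defs
  imports "HOL-Library.FuncSet"
begin

section \<open>Categories, functors, natural transformations\<close>

record ('o, 'a) cat =
  Obj :: "'o set"
  Arr :: "'a set"
  Dom :: "'a \<Rightarrow> 'o"
  Cod :: "'a \<Rightarrow> 'o"
  Idn :: "'o \<Rightarrow> 'a"
  Comp :: "'a \<Rightarrow> 'a \<Rightarrow> 'a"  (infixl \<open>\<cdot>\<index>\<close> 70)

definition hom :: "('o, 'a, 'z) cat_scheme \<Rightarrow> 'o \<Rightarrow> 'o \<Rightarrow> 'a set" where
  "hom C x y = {f \<in> Arr C. Dom C f = x \<and> Cod C f = y}"

locale category =
  fixes C :: "('o, 'a, 'z) cat_scheme" (structure)
  assumes dom_cod: "f \<in> Arr C \<Longrightarrow> Dom C f \<in> Obj C \<and> Cod C f \<in> Obj C"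
    and id_hom: "x \<in> Obj C \<Longrightarrow> Idn C x \<in> hom C x x"
    and comp_hom: "\<lbrakk>f \<in> hom C x y; g \<in> hom C y z\<rbrakk> \<Longrightarrow> g \<cdot> f \<in> hom C x z"
    and comp_id: "f \<in> hom C x y \<Longrightarrow> f \<cdot> Idn C x = f"
    and id_comp: "f \<in> hom C x y \<Longrightarrow> Idn C y \<cdot> f = f"
    and comp_assoc: "\<lbrakk>f \<in> hom C w x; g \<in> hom C x y; h \<in> hom C y z\<rbrakk>
          \<Longrightarrow> (h \<cdot> g) \<cdot> f = h \<cdot> (g \<cdot> f)"

definition is_iso :: "('o, 'a, 'z) cat_scheme \<Rightarrow> 'a \<Rightarrow> bool" where
  "is_iso C f \<longleftrightarrow> f \<in> Arr C \<and>
     (\<exists>g \<in> hom C (Cod C f) (Dom C f).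
        g \<cdot>\<^bsub>C\<^esub> f = Idn C (Dom C f) \<and> f \<cdot>\<^bsub>C\<^esub> g = Idn C (Cod C f))"

definition isomorphic :: "('o, 'a, 'z) cat_scheme \<Rightarrow> 'o \<Rightarrow> 'o \<Rightarrow> bool" where
  "isomorphic C x y \<longleftrightarrow> (\<exists>f \<in> hom C x y. is_iso C f)"

definition is_initial :: "('o, 'a, 'z) cat_scheme \<Rightarrow> 'o \<Rightarrow> bool" where
  "is_initial C x \<longleftrightarrow> x \<in> Obj C \<and> (\<forall>y \<in> Obj C. \<exists>!f. f \<in> hom C x y)"

definition op_cat :: "('o, 'a) cat \<Rightarrow> ('o, 'a) cat" where
  "op_cat C = \<lparr>Obj = Obj C, Arr = Arr C, Dom = Cod C, Cod = Dom C, Idn = Idn C,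
     Comp = (\<lambda>g f. f \<cdot>\<^bsub>C\<^esub> g)\<rparr>"

text \<open>Many categories below have as arrows triples (source, target, underlying datum).
  The datum \<open>c x g f\<close> of a composite may depend on the source \<open>x\<close> of \<open>f\<close>, because the data
  are extensional functions (equal to \<open>undefined\<close> off their domain).\<close>

definition triple_cat ::
  "'o set \<Rightarrow> ('o \<Rightarrow> 'o \<Rightarrow> 'd set) \<Rightarrow> ('o \<Rightarrow> 'd) \<Rightarrow> ('o \<Rightarrow> 'd \<Rightarrow> 'd \<Rightarrow> 'd)
    \<Rightarrow> ('o, 'o \<times> 'o \<times> 'd) cat" where
  "triple_cat A H i c =
     \<lparr>Obj = A,
      Arr = {(x, y, f). x \<in> A \<and> y \<in> A \<and> f \<in> H x y},
      Dom = (\<lambda>(x, y, f). x),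
      Cod = (\<lambda>(x, y, f). y),
      Idn = (\<lambda>x. (x, x, i x)),
      Comp = (\<lambda>(_, z, g) (x, _, f). (x, z, c x g f))\<rparr>"

record ('o, 'a, 'p, 'b) func =
  fobj :: "'o \<Rightarrow> 'p"
  farr :: "'a \<Rightarrow> 'b"

text \<open>The values of a functor outside the objects and arrows of its source are irrelevant
  and left unconstrained.\<close>

locale cat_functor = C: category C + D: category D
  for C :: "('o, 'a, 'y) cat_scheme" and D :: "('p, 'b, 'z) cat_scheme" +
  fixes F :: "('o, 'a, 'p, 'b, 'w) func_scheme"
  assumes fobj_Obj: "x \<in> Obj C \<Longrightarrow> fobj F x \<in> Obj D"
    and farr_hom: "f \<in> hom C x y \<Longrightarrow> farr F f \<in> hom D (fobj F x) (fobj F y)"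
    and farr_id: "x \<in> Obj C \<Longrightarrow> farr F (Idn C x) = Idn D (fobj F x)"
    and farr_comp: "\<lbrakk>f \<in> hom C x y; g \<in> hom C y z\<rbrakk>
          \<Longrightarrow> farr F (g \<cdot>\<^bsub>C\<^esub> f) = farr F g \<cdot>\<^bsub>D\<^esub> farr F f"

definition func_comp ::
  "('p, 'b, 'q, 'c) func \<Rightarrow> ('o, 'a, 'p, 'b) func \<Rightarrow> ('o, 'a, 'q, 'c) func" where
  "func_comp G F = \<lparr>fobj = fobj G \<circ> fobj F, farr = farr G \<circ> farr F\<rparr>"

definition nat_trans ::
  "('o, 'a, 'y) cat_scheme \<Rightarrow> ('p, 'b, 'z) cat_scheme \<Rightarrow> ('o, 'a, 'p, 'b, 'w) func_scheme
    \<Rightarrow> ('o, 'a, 'p, 'b, 'w) func_scheme \<Rightarrow> ('o \<Rightarrow> 'b) \<Rightarrow> bool" where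
  "nat_trans C D F G \<alpha> \<longleftrightarrow>
     \<alpha> \<in> extensional (Obj C) \<and>
     (\<forall>x \<in> Obj C. \<alpha> x \<in> hom D (fobj F x) (fobj G x)) \<and>
     (\<forall>x y. \<forall>f \<in> hom C x y. farr G f \<cdot>\<^bsub>D\<^esub> \<alpha> x = \<alpha> y \<cdot>\<^bsub>D\<^esub> farr F f)"

definition fun_cat ::
  "('o, 'a) cat \<Rightarrow> ('p, 'b) cat \<Rightarrow> (('o, 'a, 'p, 'b) func,
     ('o, 'a, 'p, 'b) func \<times> ('o, 'a, 'p, 'b) func \<times> ('o \<Rightarrow> 'b)) cat" where
  "fun_cat C D = triple_cat
     {F. cat_functor C D F}
     (\<lambda>F G. {\<alpha>. nat_trans C D F G \<alpha>})
     (\<lambda>F. \<lambda>x \<in> Obj C. Idn D (fobj F x))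
     (\<lambda>F \<beta> \<alpha>. \<lambda>x \<in> Obj C. \<beta> x \<cdot>\<^bsub>D\<^esub> \<alpha> x)"

definition essential_image ::
  "('o, 'a) cat \<Rightarrow> ('p, 'b) cat \<Rightarrow> ('o, 'a, 'p, 'b) func \<Rightarrow> 'p set" where
  "essential_image C D F = {y \<in> Obj D. \<exists>x \<in> Obj C. isomorphic D y (fobj F x)}"

text \<open>The category of small sets. Smallness is relative to a type: the type \<open>'s\<close>
  plays the role of the universe, and a small set is a set of elements of \<open>'s\<close>.\<close>

definition set_cat :: "('s set, 's set \<times> 's set \<times> ('s \<Rightarrow> 's)) cat" where
  "set_cat = triple_cat UNIV (\<lambda>A B. A \<rightarrow>\<^sub>E B) (\<lambda>A. \<lambda>x \<in> A. x) (\<lambda>A g f. compose A g f)"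


section \<open>Colimits\<close>

definition is_cocone ::
  "('j, 'k, 'y) cat_scheme \<Rightarrow> ('o, 'a, 'z) cat_scheme \<Rightarrow> ('j, 'k, 'o, 'a) func
    \<Rightarrow> 'o \<Rightarrow> ('j \<Rightarrow> 'a) \<Rightarrow> bool" where
  "is_cocone J C F c l \<longleftrightarrow>
     c \<in> Obj C \<and>
     (\<forall>j \<in> Obj J. l j \<in> hom C (fobj F j) c) \<and>
     (\<forall>i j. \<forall>u \<in> hom J i j. l j \<cdot>\<^bsub>C\<^esub> farr F u = l i)"

definition is_colimit ::
  "('j, 'k, 'y) cat_scheme \<Rightarrow> ('o, 'a, 'z) cat_scheme \<Rightarrow> ('j, 'k, 'o, 'a) func
    \<Rightarrow> 'o \<Rightarrow> ('j \<Rightarrow> 'a) \<Rightarrow> bool" where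
  "is_colimit J C F c l \<longleftrightarrow>
     is_cocone J C F c l \<and>
     (\<forall>c' l'. is_cocone J C F c' l' \<longrightarrow>
        (\<exists>!h. h \<in> hom C c c' \<and> (\<forall>j \<in> Obj J. h \<cdot>\<^bsub>C\<^esub> l j = l' j)))"

definition cocomplete :: "'s itself \<Rightarrow> ('o, 'a, 'z) cat_scheme \<Rightarrow> bool" where
  "cocomplete _ C \<longleftrightarrow>
     (\<forall>(J :: ('s, 's) cat) F. cat_functor J C F \<longrightarrow> (\<exists>c l. is_colimit J C F c l))"


section \<open>Monoidal categories and strong monoidal functors\<close>

record ('o, 'a) mcat = "('o, 'a) cat" +
  tobj :: "'o \<Rightarrow> 'o \<Rightarrow> 'o"  (infixl \<open>\<otimes>\<index>\<close> 75)
  tarr :: "'a \<Rightarrow> 'a \<Rightarrow> 'a"  (infixl \<open>\<boxtimes>\<index>\<close> 75)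
  munit :: "'o"
  assoc :: "'o \<Rightarrow> 'o \<Rightarrow> 'o \<Rightarrow> 'a"
  lunit :: "'o \<Rightarrow> 'a"
  runit :: "'o \<Rightarrow> 'a"

locale monoidal_category = category W for W :: "('o, 'a, 'z) mcat_scheme" (structure) +
  assumes tobj_Obj: "\<lbrakk>x \<in> Obj W; y \<in> Obj W\<rbrakk> \<Longrightarrow> x \<otimes> y \<in> Obj W"
    and tarr_hom: "\<lbrakk>f \<in> hom W x x'; g \<in> hom W y y'\<rbrakk> \<Longrightarrow> f \<boxtimes> g \<in> hom W (x \<otimes> y) (x' \<otimes> y')"
    and tarr_id: "\<lbrakk>x \<in> Obj W; y \<in> Obj W\<rbrakk> \<Longrightarrow> Idn W x \<boxtimes> Idn W y = Idn W (x \<otimes> y)"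
    and tarr_comp: "\<lbrakk>f \<in> hom W x x'; f' \<in> hom W x' x''; g \<in> hom W y y'; g' \<in> hom W y' y''\<rbrakk>
          \<Longrightarrow> (f' \<cdot> f) \<boxtimes> (g' \<cdot> g) = (f' \<boxtimes> g') \<cdot> (f \<boxtimes> g)"
    and munit_Obj: "munit W \<in> Obj W"
    and assoc_hom: "\<lbrakk>x \<in> Obj W; y \<in> Obj W; z \<in> Obj W\<rbrakk>
          \<Longrightarrow> assoc W x y z \<in> hom W ((x \<otimes> y) \<otimes> z) (x \<otimes> (y \<otimes> z))"
    and assoc_iso: "\<lbrakk>x \<in> Obj W; y \<in> Obj W; z \<in> Obj W\<rbrakk> \<Longrightarrow> is_iso W (assoc W x y z)"
    and assoc_nat: "\<lbrakk>f \<in> hom W x x'; g \<in> hom W y y'; h \<in> hom W z z'\<rbrakk>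
          \<Longrightarrow> assoc W x' y' z' \<cdot> ((f \<boxtimes> g) \<boxtimes> h) = (f \<boxtimes> (g \<boxtimes> h)) \<cdot> assoc W x y z"
    and lunit_hom: "x \<in> Obj W \<Longrightarrow> lunit W x \<in> hom W (munit W \<otimes> x) x"
    and lunit_iso: "x \<in> Obj W \<Longrightarrow> is_iso W (lunit W x)"
    and lunit_nat: "f \<in> hom W x x' \<Longrightarrow> lunit W x' \<cdot> (Idn W (munit W) \<boxtimes> f) = f \<cdot> lunit W x"
    and runit_hom: "x \<in> Obj W \<Longrightarrow> runit W x \<in> hom W (x \<otimes> munit W) x"
    and runit_iso: "x \<in> Obj W \<Longrightarrow> is_iso W (runit W x)"
    and runit_nat: "f \<in> hom W x x' \<Longrightarrow> runit W x' \<cdot> (f \<boxtimes> Idn W (munit W)) = f \<cdot> runit W x"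
    and pentagon: "\<lbrakk>w \<in> Obj W; x \<in> Obj W; y \<in> Obj W; z \<in> Obj W\<rbrakk>
          \<Longrightarrow> assoc W w x (y \<otimes> z) \<cdot> assoc W (w \<otimes> x) y z
            = (Idn W w \<boxtimes> assoc W x y z) \<cdot> (assoc W w (x \<otimes> y) z \<cdot> (assoc W w x y \<boxtimes> Idn W z))"
    and triangle: "\<lbrakk>x \<in> Obj W; y \<in> Obj W\<rbrakk>
          \<Longrightarrow> (Idn W x \<boxtimes> lunit W y) \<cdot> assoc W x (munit W) y = runit W x \<boxtimes> Idn W y"

definition tensor_preserves_colimits :: "'s itself \<Rightarrow> ('o, 'a, 'z) mcat_scheme \<Rightarrow> bool" where
  "tensor_preserves_colimits _ W \<longleftrightarrow>
     (\<forall>x \<in> Obj W. \<forall>(J :: ('s, 's) cat) F c l. cat_functor J W F \<and> is_colimit J W F c l \<longrightarrow>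
        is_colimit J W
          \<lparr>fobj = (\<lambda>j. x \<otimes>\<^bsub>W\<^esub> fobj F j), farr = (\<lambda>u. Idn W x \<boxtimes>\<^bsub>W\<^esub> farr F u)\<rparr>
          (x \<otimes>\<^bsub>W\<^esub> c) (\<lambda>j. Idn W x \<boxtimes>\<^bsub>W\<^esub> l j) \<and>
        is_colimit J W
          \<lparr>fobj = (\<lambda>j. fobj F j \<otimes>\<^bsub>W\<^esub> x), farr = (\<lambda>u. farr F u \<boxtimes>\<^bsub>W\<^esub> Idn W x)\<rparr>
          (c \<otimes>\<^bsub>W\<^esub> x) (\<lambda>j. l j \<boxtimes>\<^bsub>W\<^esub> Idn W x))"

record ('o, 'a, 'p, 'b) mfunc = "('o, 'a, 'p, 'b) func" +
  mu :: "'o \<Rightarrow> 'o \<Rightarrow> 'b"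
  eps :: "'b"

locale strong_monoidal_functor =
  V: monoidal_category V + W: monoidal_category W + cat_functor V W F
  for V :: "('o, 'a, 'y) mcat_scheme" and W :: "('p, 'b, 'z) mcat_scheme"
    and F :: "('o, 'a, 'p, 'b, 'w) mfunc_scheme" +
  assumes mu_hom: "\<lbrakk>x \<in> Obj V; y \<in> Obj V\<rbrakk>
          \<Longrightarrow> mu F x y \<in> hom W (fobj F x \<otimes>\<^bsub>W\<^esub> fobj F y) (fobj F (x \<otimes>\<^bsub>V\<^esub> y))"
    and mu_iso: "\<lbrakk>x \<in> Obj V; y \<in> Obj V\<rbrakk> \<Longrightarrow> is_iso W (mu F x y)"
    and mu_nat: "\<lbrakk>f \<in> hom V x x'; g \<in> hom V y y'\<rbrakk>
          \<Longrightarrow> mu F x' y' \<cdot>\<^bsub>W\<^esub> (farr F f \<boxtimes>\<^bsub>W\<^esub> farr F g) = farr F (f \<boxtimes>\<^bsub>V\<^esub> g) \<cdot>\<^bsub>W\<^esub> mu F x y"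
    and eps_hom: "eps F \<in> hom W (munit W) (fobj F (munit V))"
    and eps_iso: "is_iso W (eps F)"
    and mu_assoc: "\<lbrakk>x \<in> Obj V; y \<in> Obj V; z \<in> Obj V\<rbrakk>
          \<Longrightarrow> farr F (assoc V x y z) \<cdot>\<^bsub>W\<^esub>
                (mu F (x \<otimes>\<^bsub>V\<^esub> y) z \<cdot>\<^bsub>W\<^esub> (mu F x y \<boxtimes>\<^bsub>W\<^esub> Idn W (fobj F z)))
            = mu F x (y \<otimes>\<^bsub>V\<^esub> z) \<cdot>\<^bsub>W\<^esub>
                ((Idn W (fobj F x) \<boxtimes>\<^bsub>W\<^esub> mu F y z) \<cdot>\<^bsub>W\<^esub> assoc W (fobj F x) (fobj F y) (fobj F z))"
    and mu_lunit: "x \<in> Obj V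
          \<Longrightarrow> farr F (lunit V x) \<cdot>\<^bsub>W\<^esub> (mu F (munit V) x \<cdot>\<^bsub>W\<^esub> (eps F \<boxtimes>\<^bsub>W\<^esub> Idn W (fobj F x)))
            = lunit W (fobj F x)"
    and mu_runit: "x \<in> Obj V
          \<Longrightarrow> farr F (runit V x) \<cdot>\<^bsub>W\<^esub> (mu F x (munit V) \<cdot>\<^bsub>W\<^esub> (Idn W (fobj F x) \<boxtimes>\<^bsub>W\<^esub> eps F))
            = runit W (fobj F x)"

definition monoidal_nat_trans ::
  "('o, 'a, 'y) mcat_scheme \<Rightarrow> ('p, 'b, 'z) mcat_scheme \<Rightarrow> ('o, 'a, 'p, 'b, 'w) mfunc_scheme
    \<Rightarrow> ('o, 'a, 'p, 'b, 'w) mfunc_scheme \<Rightarrow> ('o \<Rightarrow> 'b) \<Rightarrow> bool" where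
  "monoidal_nat_trans V W F G \<alpha> \<longleftrightarrow>
     nat_trans V W F G \<alpha> \<and>
     (\<forall>x \<in> Obj V. \<forall>y \<in> Obj V.
        \<alpha> (x \<otimes>\<^bsub>V\<^esub> y) \<cdot>\<^bsub>W\<^esub> mu F x y = mu G x y \<cdot>\<^bsub>W\<^esub> (\<alpha> x \<boxtimes>\<^bsub>W\<^esub> \<alpha> y)) \<and>
     \<alpha> (munit V) \<cdot>\<^bsub>W\<^esub> eps F = eps G"

definition strmon_cat ::
  "('o, 'a) mcat \<Rightarrow> ('p, 'b) mcat \<Rightarrow> (('o, 'a, 'p, 'b) mfunc,
     ('o, 'a, 'p, 'b) mfunc \<times> ('o, 'a, 'p, 'b) mfunc \<times> ('o \<Rightarrow> 'b)) cat" where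
  "strmon_cat V W = triple_cat
     {F. strong_monoidal_functor V W F}
     (\<lambda>F G. {\<alpha>. monoidal_nat_trans V W F G \<alpha>})
     (\<lambda>F. \<lambda>x \<in> Obj V. Idn W (fobj F x))
     (\<lambda>F \<beta> \<alpha>. \<lambda>x \<in> Obj V. \<beta> x \<cdot>\<^bsub>W\<^esub> \<alpha> x)"


section \<open>Enriched categories\<close>

text \<open>A \<open>W\<close>-category is small in that its objects form a set of elements of the universe \<open>'s\<close>.\<close>

record ('s, 'o, 'a) wcat =
  wobj :: "'s set"
  whom :: "'s \<Rightarrow> 's \<Rightarrow> 'o"
  wcomp :: "'s \<Rightarrow> 's \<Rightarrow> 's \<Rightarrow> 'a"
  wid :: "'s \<Rightarrow> 'a"

locale wcategory = monoidal_category W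
  for W :: "('o, 'a, 'z) mcat_scheme" (structure) and C :: "('s, 'o, 'a) wcat" +
  assumes whom_Obj: "\<lbrakk>a \<in> wobj C; b \<in> wobj C\<rbrakk> \<Longrightarrow> whom C a b \<in> Obj W"
    and wcomp_hom: "\<lbrakk>a \<in> wobj C; b \<in> wobj C; c \<in> wobj C\<rbrakk>
          \<Longrightarrow> wcomp C a b c \<in> hom W (whom C a b \<otimes> whom C b c) (whom C a c)"
    and wid_hom: "a \<in> wobj C \<Longrightarrow> wid C a \<in> hom W (munit W) (whom C a a)"
    and wcomp_assoc: "\<lbrakk>a \<in> wobj C; b \<in> wobj C; c \<in> wobj C; d \<in> wobj C\<rbrakk>
          \<Longrightarrow> wcomp C a c d \<cdot> (wcomp C a b c \<boxtimes> Idn W (whom C c d))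
            = wcomp C a b d \<cdot> ((Idn W (whom C a b) \<boxtimes> wcomp C b c d)
                \<cdot> assoc W (whom C a b) (whom C b c) (whom C c d))"
    and wid_left: "\<lbrakk>a \<in> wobj C; b \<in> wobj C\<rbrakk>
          \<Longrightarrow> wcomp C a a b \<cdot> (wid C a \<boxtimes> Idn W (whom C a b)) = lunit W (whom C a b)"
    and wid_right: "\<lbrakk>a \<in> wobj C; b \<in> wobj C\<rbrakk>
          \<Longrightarrow> wcomp C a b b \<cdot> (Idn W (whom C a b) \<boxtimes> wid C b) = runit W (whom C a b)"

record ('s, 'a) wfun =
  wfobj :: "'s \<Rightarrow> 's"
  wfhom :: "'s \<Rightarrow> 's \<Rightarrow> 'a"

locale wfunctor = A: wcategory W A + B: wcategory W B
  for W :: "('o, 'a, 'z) mcat_scheme" (structure)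
    and A :: "('s, 'o, 'a) wcat" and B :: "('s, 'o, 'a) wcat" +
  fixes F :: "('s, 'a) wfun"
  assumes wfobj_ext: "wfobj F \<in> wobj A \<rightarrow>\<^sub>E wobj B"
    and wfhom_ext: "wfhom F \<in> extensional (wobj A)"
      "a \<in> wobj A \<Longrightarrow> wfhom F a \<in> extensional (wobj A)"
    and wfhom_hom: "\<lbrakk>a \<in> wobj A; b \<in> wobj A\<rbrakk>
          \<Longrightarrow> wfhom F a b \<in> hom W (whom A a b) (whom B (wfobj F a) (wfobj F b))"
    and wfhom_comp: "\<lbrakk>a \<in> wobj A; b \<in> wobj A; c \<in> wobj A\<rbrakk>
          \<Longrightarrow> wfhom F a c \<cdot> wcomp A a b c
            = wcomp B (wfobj F a) (wfobj F b) (wfobj F c) \<cdot> (wfhom F a b \<boxtimes> wfhom F b c)"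
    and wfhom_id: "a \<in> wobj A \<Longrightarrow> wfhom F a a \<cdot> wid A a = wid B (wfobj F a)"

type_synonym ('s, 'o, 'a) warr = "('s, 'o, 'a) wcat \<times> ('s, 'o, 'a) wcat \<times> ('s, 'a) wfun"

definition wcat_cat :: "('o, 'a) mcat \<Rightarrow> (('s, 'o, 'a) wcat, ('s, 'o, 'a) warr) cat" where
  "wcat_cat W = triple_cat
     {A. wcategory W A}
     (\<lambda>A B. {F. wfunctor W A B F})
     (\<lambda>A. \<lparr>wfobj = (\<lambda>a \<in> wobj A. a),
           wfhom = (\<lambda>a \<in> wobj A. \<lambda>b \<in> wobj A. Idn W (whom A a b))\<rparr>)
     (\<lambda>A G F. \<lparr>wfobj = compose (wobj A) (wfobj G) (wfobj F),
               wfhom = (\<lambda>a \<in> wobj A. \<lambda>b \<in> wobj A.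
                          wfhom G (wfobj F a) (wfobj F b) \<cdot>\<^bsub>W\<^esub> wfhom F a b)\<rparr>)"

definition ob_functor ::
  "(('s, 'o, 'a) wcat, ('s, 'o, 'a) warr, 's set, 's set \<times> 's set \<times> ('s \<Rightarrow> 's)) func" where
  "ob_functor = \<lparr>fobj = wobj, farr = (\<lambda>(A, B, F). (wobj A, wobj B, wfobj F))\<rparr>"


section \<open>The simplex category and simplicial sets\<close>

type_synonym delta_arr = "nat \<times> nat \<times> (nat \<Rightarrow> nat)"

definition delta_cat :: "(nat, delta_arr) cat" where
  "delta_cat = triple_cat UNIV
     (\<lambda>m n. {f \<in> {0..m} \<rightarrow>\<^sub>E {0..n}. mono_on {0..m} f})
     (\<lambda>n. \<lambda>k \<in> {0..n}. k)
     (\<lambda>m g f. compose {0..m} g f)"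

definition inert :: "delta_arr \<Rightarrow> bool" where
  "inert = (\<lambda>(m, n, \<delta>). \<forall>i \<in> {0..m}. \<delta> i = \<delta> 0 + i)"

text \<open>To regard \<open>[n]\<close> as a small set, we use an injection \<open>\<iota>\<close> of the natural numbers into the
  universe \<open>'s\<close> and realise \<open>[n]\<close> as \<open>\<iota> ` {0..n}\<close>, with \<open>\<iota> k\<close> standing for the vertex \<open>k\<close>.\<close>

definition ob_delta ::
  "(nat \<Rightarrow> 's) \<Rightarrow> (nat, delta_arr, 's set, 's set \<times> 's set \<times> ('s \<Rightarrow> 's)) func" where
  "ob_delta \<iota> =
     \<lparr>fobj = (\<lambda>n. \<iota> ` {0..n}),
      farr = (\<lambda>(m, n, f). (\<iota> ` {0..m}, \<iota> ` {0..n}, \<lambda>a \<in> \<iota> ` {0..m}. \<iota> (f (inv \<iota> a))))\<rparr>"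

type_synonym 's sset = "(nat, delta_arr, 's set, 's set \<times> 's set \<times> ('s \<Rightarrow> 's)) func"

definition sset_cat :: "('s sset,
    's sset \<times> 's sset \<times> (nat \<Rightarrow> 's set \<times> 's set \<times> ('s \<Rightarrow> 's))) cat" where
  "sset_cat = fun_cat (op_cat delta_cat) set_cat"


section \<open>Necklaces\<close>

text \<open>The necklace with simplices of dimensions \<open>n\<^sub>1, \<dots>, n\<^sub>k\<close> is encoded by its set
  \<open>T = {0, n\<^sub>1, n\<^sub>1 + n\<^sub>2, \<dots>, p}\<close> of joints (including both end points) and its total
  length \<open>p\<close>.\<close>

type_synonym necklace = "nat set \<times> nat"
type_synonym nec_arr = "necklace \<times> necklace \<times> (nat \<Rightarrow> nat)"

definition simplex :: "nat \<Rightarrow> necklace" where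
  "simplex n = ({0, n}, n)"

definition nec_hom :: "necklace \<Rightarrow> necklace \<Rightarrow> (nat \<Rightarrow> nat) set" where
  "nec_hom = (\<lambda>(T, p) (U, q).
     {f \<in> {0..p} \<rightarrow>\<^sub>E {0..q}. mono_on {0..p} f \<and> f 0 = 0 \<and> f p = q \<and> U \<subseteq> f ` T})"

definition nec_cat :: "(necklace, nec_arr) cat" where
  "nec_cat = triple_cat
     {(T, p). {0, p} \<subseteq> T \<and> T \<subseteq> {0..p}}
     nec_hom
     (\<lambda>(T, p). \<lambda>k \<in> {0..p}. k)
     (\<lambda>(T, p) g f. compose {0..p} g f)"

definition wedge :: "necklace \<Rightarrow> necklace \<Rightarrow> necklace" where
  "wedge = (\<lambda>(T, p) (U, q). (T \<union> (+) p ` U, p + q))"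

definition wedge_arr :: "nec_arr \<Rightarrow> nec_arr \<Rightarrow> nec_arr" where
  "wedge_arr = (\<lambda>(X, X', f) (Y, Y', g).
     (wedge X Y, wedge X' Y',
      \<lambda>k \<in> {0..snd X + snd Y}. if k \<le> snd X then f k else snd X' + g (k - snd X)))"

text \<open>In this encoding the wedge is strictly associative and unital.\<close>

definition nec :: "(necklace, nec_arr) mcat" where
  "nec = cat.extend nec_cat
     (mcat.fields wedge wedge_arr (simplex 0)
        (\<lambda>X Y Z. Idn nec_cat (wedge X (wedge Y Z))) (Idn nec_cat) (Idn nec_cat))"


section \<open>The functor Phi\<close>

type_synonym ('o, 'a) nec_mfunc = "(necklace, nec_arr, 'o, 'a) mfunc"
type_synonym ('s, 'o, 'a) wdiagram = "(nat, delta_arr, ('s, 'o, 'a) wcat, ('s, 'o, 'a) warr) func"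

definition the_hom :: "('o, 'a, 'z) cat_scheme \<Rightarrow> 'o \<Rightarrow> 'o \<Rightarrow> 'a" where
  "the_hom C x y = (THE f. f \<in> hom C x y)"

definition init_obj :: "('o, 'a, 'z) cat_scheme \<Rightarrow> 'o" where
  "init_obj C = (SOME x. is_initial C x)"

definition phi_hom :: "('o, 'a) mcat \<Rightarrow> ('o, 'a) nec_mfunc \<Rightarrow> nat \<Rightarrow> nat \<Rightarrow> 'o" where
  "phi_hom W D i j = (if i \<le> j then fobj D (simplex (j - i)) else init_obj W)"

text \<open>Unless \<open>i \<le> k \<le> j\<close>, one of the two tensor factors in the source of the composition is
  initial, hence so is that source, because the tensor product preserves initial objects.\<close>

definition phi_comp :: "('o, 'a) mcat \<Rightarrow> ('o, 'a) nec_mfunc \<Rightarrow> nat \<Rightarrow> nat \<Rightarrow> nat \<Rightarrow> 'a" where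
  "phi_comp W D i k j =
     (if i \<le> k \<and> k \<le> j
      then farr D (wedge (simplex (k - i)) (simplex (j - k)), simplex (j - i), \<lambda>l \<in> {0..j - i}. l)
             \<cdot>\<^bsub>W\<^esub> mu D (simplex (k - i)) (simplex (j - k))
      else the_hom W (phi_hom W D i k \<otimes>\<^bsub>W\<^esub> phi_hom W D k j) (phi_hom W D i j))"

definition phi_wcat ::
  "(nat \<Rightarrow> 's) \<Rightarrow> ('o, 'a) mcat \<Rightarrow> ('o, 'a) nec_mfunc \<Rightarrow> nat \<Rightarrow> ('s, 'o, 'a) wcat" where
  "phi_wcat \<iota> W D n =
     \<lparr>wobj = \<iota> ` {0..n},
      whom = (\<lambda>a b. phi_hom W D (inv \<iota> a) (inv \<iota> b)),
      wcomp = (\<lambda>a b c. phi_comp W D (inv \<iota> a) (inv \<iota> b) (inv \<iota> c)),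
      wid = (\<lambda>a. eps D)\<rparr>"

definition phi_wfun ::
  "(nat \<Rightarrow> 's) \<Rightarrow> ('o, 'a) mcat \<Rightarrow> ('o, 'a) nec_mfunc \<Rightarrow> delta_arr \<Rightarrow> ('s, 'o, 'a) warr" where
  "phi_wfun \<iota> W D = (\<lambda>(m, n, f).
     (phi_wcat \<iota> W D m, phi_wcat \<iota> W D n,
      \<lparr>wfobj = (\<lambda>a \<in> \<iota> ` {0..m}. \<iota> (f (inv \<iota> a))),
       wfhom = (\<lambda>a \<in> \<iota> ` {0..m}. \<lambda>b \<in> \<iota> ` {0..m}.
          let i = inv \<iota> a; j = inv \<iota> b in
          if i \<le> j
          then farr D (simplex (j - i), simplex (f j - f i), \<lambda>k \<in> {0..j - i}. f (k + i) - f i)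
          else the_hom W (phi_hom W D i j) (phi_hom W D (f i) (f j)))\<rparr>))"

definition phi_obj ::
  "(nat \<Rightarrow> 's) \<Rightarrow> ('o, 'a) mcat \<Rightarrow> ('o, 'a) nec_mfunc \<Rightarrow> ('s, 'o, 'a) wdiagram" where
  "phi_obj \<iota> W D = \<lparr>fobj = phi_wcat \<iota> W D, farr = phi_wfun \<iota> W D\<rparr>"

definition phi_arr ::
  "(nat \<Rightarrow> 's) \<Rightarrow> ('o, 'a) mcat
    \<Rightarrow> ('o, 'a) nec_mfunc \<times> ('o, 'a) nec_mfunc \<times> (necklace \<Rightarrow> 'a)
    \<Rightarrow> ('s, 'o, 'a) wdiagram \<times> ('s, 'o, 'a) wdiagram \<times> (nat \<Rightarrow> ('s, 'o, 'a) warr)" where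
  "phi_arr \<iota> W = (\<lambda>(D, E, \<alpha>).
     (phi_obj \<iota> W D, phi_obj \<iota> W E,
      \<lambda>n. (phi_wcat \<iota> W D n, phi_wcat \<iota> W E n,
           \<lparr>wfobj = (\<lambda>a \<in> \<iota> ` {0..n}. a),
            wfhom = (\<lambda>a \<in> \<iota> ` {0..n}. \<lambda>b \<in> \<iota> ` {0..n}.
              let i = inv \<iota> a; j = inv \<iota> b in
              if i \<le> j then \<alpha> (simplex (j - i))
              else the_hom W (phi_hom W D i j) (phi_hom W E i j))\<rparr>)))"

definition Phi ::
  "(nat \<Rightarrow> 's) \<Rightarrow> ('o, 'a) mcat \<Rightarrow>
    (('o, 'a) nec_mfunc, ('o, 'a) nec_mfunc \<times> ('o, 'a) nec_mfunc \<times> (necklace \<Rightarrow> 'a),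
     ('s, 'o, 'a) wdiagram,
     ('s, 'o, 'a) wdiagram \<times> ('s, 'o, 'a) wdiagram \<times> (nat \<Rightarrow> ('s, 'o, 'a) warr)) func" where
  "Phi \<iota> W = \<lparr>fobj = phi_obj \<iota> W, farr = phi_arr \<iota> W\<rparr>"


section \<open>Nerves\<close>

definition nerve_obj ::
  "('o, 'a) mcat \<Rightarrow> ('s, 'o, 'a) wdiagram \<Rightarrow> ('s, 'o, 'a) wcat \<Rightarrow> ('s, 'o, 'a) warr sset" where
  "nerve_obj W \<DD> C =
     \<lparr>fobj = (\<lambda>n. hom (wcat_cat W) (fobj \<DD> n) C),
      farr = (\<lambda>(m, n, f).
        (hom (wcat_cat W) (fobj \<DD> n) C, hom (wcat_cat W) (fobj \<DD> m) C,
         \<lambda>G \<in> hom (wcat_cat W) (fobj \<DD> n) C. G \<cdot>\<^bsub>wcat_cat W\<^esub> farr \<DD> (m, n, f)))\<rparr>"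

definition nerve ::
  "('o, 'a) mcat \<Rightarrow> ('s, 'o, 'a) wdiagram \<Rightarrow>
    (('s, 'o, 'a) wcat, ('s, 'o, 'a) warr, ('s, 'o, 'a) warr sset,
     ('s, 'o, 'a) warr sset \<times> ('s, 'o, 'a) warr sset \<times>
       (nat \<Rightarrow> ('s, 'o, 'a) warr set \<times> ('s, 'o, 'a) warr set
                \<times> (('s, 'o, 'a) warr \<Rightarrow> ('s, 'o, 'a) warr))) func" where
  "nerve W \<DD> =
     \<lparr>fobj = nerve_obj W \<DD>,
      farr = (\<lambda>H. let A = Dom (wcat_cat W) H; B = Cod (wcat_cat W) H in
        (nerve_obj W \<DD> A, nerve_obj W \<DD> B,
         \<lambda>n. (hom (wcat_cat W) (fobj \<DD> n) A, hom (wcat_cat W) (fobj \<DD> n) B,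
              \<lambda>G \<in> hom (wcat_cat W) (fobj \<DD> n) A. H \<cdot>\<^bsub>wcat_cat W\<^esub> G)))\<rparr>"

definition necklicial_nerve ::
  "(nat \<Rightarrow> 's) \<Rightarrow> ('o, 'a) mcat \<Rightarrow>
    (('s, 'o, 'a) wcat, ('s, 'o, 'a) warr, ('s, 'o, 'a) warr sset,
     ('s, 'o, 'a) warr sset \<times> ('s, 'o, 'a) warr sset \<times>
       (nat \<Rightarrow> ('s, 'o, 'a) warr set \<times> ('s, 'o, 'a) warr set
                \<times> (('s, 'o, 'a) warr \<Rightarrow> ('s, 'o, 'a) warr))) func \<Rightarrow> bool" where
  "necklicial_nerve \<iota> W N \<longleftrightarrow>
     N \<in> Obj (fun_cat (wcat_cat W) sset_cat) \<and>
     (\<exists>\<DD> D. \<DD> \<in> Obj (fun_cat delta_cat (wcat_cat W)) \<and> N = nerve W \<DD> \<and>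
        D \<in> Obj (strmon_cat nec W) \<and>
        isomorphic (fun_cat delta_cat (wcat_cat W)) \<DD> (fobj (Phi \<iota> W) D))"


section \<open>The characterising properties\<close>

text \<open>A natural isomorphism \<open>\<theta>\<close> from \<open>[n] \<mapsto> [n]\<close> to \<open>Ob \<circ> \<DD>\<close> identifies the vertex \<open>k\<close> of
  \<open>[n]\<close> with the object \<open>vertex \<iota> \<theta> n k\<close> of the enriched category at stage \<open>n\<close>.\<close>

definition vertex ::
  "(nat \<Rightarrow> 's) \<Rightarrow> ('f \<times> 'f \<times> (nat \<Rightarrow> 's set \<times> 's set \<times> ('s \<Rightarrow> 's))) \<Rightarrow> nat \<Rightarrow> nat \<Rightarrow> 's" where
  "vertex \<iota> = (\<lambda>(_, _, t) n k. snd (snd (t n)) (\<iota> k))"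

definition necklicial_properties ::
  "(nat \<Rightarrow> 's) \<Rightarrow> ('o, 'a) mcat \<Rightarrow> ('s, 'o, 'a) wdiagram \<Rightarrow> bool" where
  "necklicial_properties \<iota> W \<DD> \<longleftrightarrow>
     (\<exists>\<theta> \<in> hom (fun_cat delta_cat set_cat) (ob_delta \<iota>) (func_comp ob_functor \<DD>).
        is_iso (fun_cat delta_cat set_cat) \<theta> \<and>
        (\<forall>n i j. i < j \<and> j \<le> n \<longrightarrow>
           is_initial W (whom (fobj \<DD> n) (vertex \<iota> \<theta> n j) (vertex \<iota> \<theta> n i))) \<and>
        is_iso W (wid (fobj \<DD> 0) (vertex \<iota> \<theta> 0 0)) \<and>
        (\<forall>m n \<delta>. (m, n, \<delta>) \<in> Arr delta_cat \<and> inert (m, n, \<delta>) \<longrightarrow>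
           is_iso W (wfhom (snd (snd (farr \<DD> (m, n, \<delta>)))) (vertex \<iota> \<theta> m 0) (vertex \<iota> \<theta> m m))))"

end

theory Submission
  imports Defs
begin

text \<open>
  A necklace map into \<open>\<Delta>\<^bsup>m(1)\<^esup> \<or> \<dots> \<or> \<Delta>\<^bsup>m(l)\<^esup>\<close> is a wedge of maps into the single simplices \<open>\<Delta>\<^bsup>m(i)\<^esup>\<close>.
  Hence a diagram \<open>\<DD>\<close> determines a strong monoidal functor with value \<open>\<DD>\<^sup>n(0,n)\<close> on \<open>\<Delta>\<^sup>n\<close>, \<open>n > 0\<close>:
  a map from a necklace with beads of dimensions \<open>n(1), \<dots>, n(k)\<close> into \<open>\<Delta>\<^sup>m\<close> acts by applying \<open>\<DD>\<close> to
  each bead and then composing in the enriched category \<open>\<DD>\<^sup>m\<close>. The splitting of a map is unique only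
  up to pieces that collapse to \<open>\<Delta>\<^sup>0\<close>; these do not matter because the unit \<open>I \<rightarrow> \<DD>\<^sup>0(0,0)\<close> is
  invertible. Associators are avoided by building the functor with values in the strictification of
  \<open>W\<close>, whose objects are lists of objects of \<open>W\<close>. The inert maps identify \<open>\<DD>\<^bsup>j-i\<^esup>(0,j-i)\<close> with
  \<open>\<DD>\<^sup>n(i,j)\<close>, which gives the isomorphism between \<open>\<DD>\<close> and the image of the functor under \<open>\<Phi>\<close>.
  The converse is a transport of the properties along an isomorphism. A diagram is determined by its
  nerve by the Yoneda lemma.
\<close>

section \<open>Categories and inverses\<close>

text \<open>Two obstacles shape the construction. Different cuts of one necklace map compose the
  same beads with different brackets; in a strict category the results are equal, while in
  \<open>W\<close> every comparison would carry associators. Moreover the 0-simplex is the empty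
  wedge, so the functor has to send it to \<open>I\<close>, whereas the diagram offers
  \<open>\<DD>^0(0,0)\<close>; inverting the unit morphism lets a collapsing piece of a necklace end
  in \<open>I\<close>. The comparison from the value on a (j-i)-simplex to
  \<open>\<DD>^n(i,j)\<close> is the composite along the inclusion of [j-i] as the interval from i
  to j. It respects units, composition and simplicial maps by itself; the inert maps make it
  invertible. The colimit hypotheses enter through the empty diagram: they give the hom-objects
  below the diagonal and make the source of a composition initial unless i \<le> k \<le> j, so the
  equations there hold by uniqueness.\<close>

definition inverse_arr :: "('o, 'a, 'z) cat_scheme \<Rightarrow> 'a \<Rightarrow> 'a" where
  "inverse_arr C f = (SOME g. g \<in> hom C (Cod C f) (Dom C f) \<and>
     g \<cdot>\<^bsub>C\<^esub> f = Idn C (Dom C f) \<and> f \<cdot>\<^bsub>C\<^esub> g = Idn C (Cod C f))"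

context category
begin

lemma homE [elim]: "f \<in> hom C x y \<Longrightarrow> (\<lbrakk>f \<in> Arr C; Dom C f = x; Cod C f = y\<rbrakk> \<Longrightarrow> P) \<Longrightarrow> P"
  by (auto simp: hom_def)

lemma homI [intro]: "\<lbrakk>f \<in> Arr C; Dom C f = x; Cod C f = y\<rbrakk> \<Longrightarrow> f \<in> hom C x y"
  by (auto simp: hom_def)

lemma Dom_Obj [simp]: "f \<in> Arr C \<Longrightarrow> Dom C f \<in> Obj C"
  and Cod_Obj [simp]: "f \<in> Arr C \<Longrightarrow> Cod C f \<in> Obj C"
  using dom_cod by auto

lemma Idn_Arr [simp]: "x \<in> Obj C \<Longrightarrow> Idn C x \<in> Arr C"
  and Dom_Idn [simp]: "x \<in> Obj C \<Longrightarrow> Dom C (Idn C x) = x"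
  and Cod_Idn [simp]: "x \<in> Obj C \<Longrightarrow> Cod C (Idn C x) = x"
  using id_hom by (auto simp: hom_def)

lemma comp_Arr [simp]: "\<lbrakk>f \<in> Arr C; g \<in> Arr C; Dom C g = Cod C f\<rbrakk> \<Longrightarrow> g \<cdot> f \<in> Arr C"
  and Dom_comp [simp]: "\<lbrakk>f \<in> Arr C; g \<in> Arr C; Dom C g = Cod C f\<rbrakk> \<Longrightarrow> Dom C (g \<cdot> f) = Dom C f"
  and Cod_comp [simp]: "\<lbrakk>f \<in> Arr C; g \<in> Arr C; Dom C g = Cod C f\<rbrakk> \<Longrightarrow> Cod C (g \<cdot> f) = Cod C g"
  using comp_hom[of f "Dom C f" "Cod C f" g "Cod C g"] by (auto simp: hom_def)

lemma comp_Idn [simp]: "\<lbrakk>f \<in> Arr C; Dom C f = x\<rbrakk> \<Longrightarrow> f \<cdot> Idn C x = f"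
  and Idn_comp [simp]: "\<lbrakk>f \<in> Arr C; Cod C f = x\<rbrakk> \<Longrightarrow> Idn C x \<cdot> f = f"
  using comp_id id_comp by (auto simp: hom_def)

text \<open>Oriented this way, the law makes right-nested composites the normal form. The premises
  are equations between \<open>Dom\<close> and \<open>Cod\<close>, which simp can discharge;
  \<open>hom\<close> premises would leave the intermediate objects to be guessed.\<close>

lemma comp_assoc_Arr [simp]:
  "\<lbrakk>f \<in> Arr C; g \<in> Arr C; h \<in> Arr C; Dom C g = Cod C f; Dom C h = Cod C g\<rbrakk>
    \<Longrightarrow> (h \<cdot> g) \<cdot> f = h \<cdot> (g \<cdot> f)"
  by (rule comp_assoc[of f "Dom C f" "Cod C f" g "Cod C g" h "Cod C h"]) auto

lemma is_iso_Arr: "is_iso C f \<Longrightarrow> f \<in> Arr C"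
  by (simp add: is_iso_def)

lemma inverse_arr:
  assumes "is_iso C f"
  shows "inverse_arr C f \<in> hom C (Cod C f) (Dom C f)"
    and "inverse_arr C f \<cdot> f = Idn C (Dom C f)"
    and "f \<cdot> inverse_arr C f = Idn C (Cod C f)"
proof -
  have "\<exists>g. g \<in> hom C (Cod C f) (Dom C f) \<and> g \<cdot> f = Idn C (Dom C f) \<and> f \<cdot> g = Idn C (Cod C f)"
    using assms by (auto simp: is_iso_def)
  from someI_ex[OF this]
  show "inverse_arr C f \<in> hom C (Cod C f) (Dom C f)"
    and "inverse_arr C f \<cdot> f = Idn C (Dom C f)"
    and "f \<cdot> inverse_arr C f = Idn C (Cod C f)"
    by (auto simp: inverse_arr_def)
qed

lemma inverse_arr_simps [simp]:
  assumes "is_iso C f"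
  shows "inverse_arr C f \<in> Arr C" "Dom C (inverse_arr C f) = Cod C f"
    "Cod C (inverse_arr C f) = Dom C f"
    "inverse_arr C f \<cdot> f = Idn C (Dom C f)" "f \<cdot> inverse_arr C f = Idn C (Cod C f)"
  using inverse_arr[OF assms] by (auto simp: hom_def)

lemma inverse_cancel [simp]:
  assumes "is_iso C f"
  shows "\<lbrakk>g \<in> Arr C; Cod C g = Dom C f\<rbrakk> \<Longrightarrow> inverse_arr C f \<cdot> (f \<cdot> g) = g"
    and "\<lbrakk>h \<in> Arr C; Cod C h = Cod C f\<rbrakk> \<Longrightarrow> f \<cdot> (inverse_arr C f \<cdot> h) = h"
  using assms is_iso_Arr[OF assms] by (simp_all flip: comp_assoc_Arr)

lemma is_isoI:
  "\<lbrakk>f \<in> hom C x y; g \<in> hom C y x; g \<cdot> f = Idn C x; f \<cdot> g = Idn C y\<rbrakk> \<Longrightarrow> is_iso C f"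
  by (auto simp: is_iso_def hom_def)

lemma is_iso_inverse [simp]: "is_iso C f \<Longrightarrow> is_iso C (inverse_arr C f)"
  by (rule is_isoI[of _ "Cod C f" "Dom C f" f]) (auto simp: is_iso_Arr)

lemma is_iso_Idn [simp]: "x \<in> Obj C \<Longrightarrow> is_iso C (Idn C x)"
  by (rule is_isoI[of _ x x "Idn C x"]) auto

lemma is_iso_comp [simp]:
  assumes "is_iso C f" "is_iso C g" "Dom C g = Cod C f"
  shows "is_iso C (g \<cdot> f)"
  using assms is_iso_Arr[OF assms(1)] is_iso_Arr[OF assms(2)]
  by (intro is_isoI[of _ "Dom C f" "Cod C g" "inverse_arr C f \<cdot> inverse_arr C g"]) auto

lemma iso_cancel_left:
  assumes "is_iso C f" "g \<in> Arr C" "h \<in> Arr C" "Cod C g = Dom C f" "Cod C h = Dom C f"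
    and "f \<cdot> g = f \<cdot> h"
  shows "g = h"
  using assms by (metis inverse_cancel(1))

lemma iso_cancel_right:
  assumes "is_iso C f" "g \<in> Arr C" "h \<in> Arr C" "Dom C g = Cod C f" "Dom C h = Cod C f"
    and "g \<cdot> f = h \<cdot> f"
  shows "g = h"
proof -
  have "g \<cdot> f \<cdot> inverse_arr C f = h \<cdot> f \<cdot> inverse_arr C f" using assms(6) by simp
  then show ?thesis using assms(1-5) is_iso_Arr[OF assms(1)] by simp
qed

lemma inverse_comp_cancel_right [simp]:
  assumes "is_iso C f" "g \<in> Arr C" "Dom C g = Cod C f"
  shows "(g \<cdot> f) \<cdot> inverse_arr C f = g"
  using assms is_iso_Arr[OF assms(1)] by simp

lemma is_iso_of_comp_left:
  assumes "is_iso C (g \<cdot> f)" "is_iso C f" "g \<in> Arr C" "Dom C g = Cod C f"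
  shows "is_iso C g"
proof -
  have f: "f \<in> Arr C" using assms(2) is_iso_Arr by blast
  have "is_iso C ((g \<cdot> f) \<cdot> inverse_arr C f)"
    using assms f by (rule_tac is_iso_comp) simp_all
  also have "(g \<cdot> f) \<cdot> inverse_arr C f = g"
    using assms by (intro inverse_comp_cancel_right)
  finally show ?thesis .
qed

lemma initial_Obj: "is_initial C x \<Longrightarrow> x \<in> Obj C"
  by (simp add: is_initial_def)

lemma the_hom_initial: "\<lbrakk>is_initial C x; y \<in> Obj C\<rbrakk> \<Longrightarrow> the_hom C x y \<in> hom C x y"
  unfolding the_hom_def is_initial_def by (rule theI') blast

lemma initial_unique:
  "\<lbrakk>is_initial C x; f \<in> Arr C; g \<in> Arr C; Dom C f = x; Dom C g = x; Cod C f = Cod C g\<rbrakk> \<Longrightarrow> f = g"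
  unfolding is_initial_def using Cod_Obj by (metis homI)

lemma initial_iso:
  assumes "is_initial C x" "is_initial C y" "f \<in> hom C x y"
  shows "is_iso C f"
proof -
  have g: "the_hom C y x \<in> hom C y x"
    using assms by (intro the_hom_initial initial_Obj)
  show ?thesis
  proof (rule is_isoI[OF assms(3) g])
    show "the_hom C y x \<cdot> f = Idn C x"
      using assms g by (elim homE) (rule initial_unique[of x], simp_all add: initial_Obj)
    show "f \<cdot> the_hom C y x = Idn C y"
      using assms g by (elim homE) (rule initial_unique[of y], simp_all add: initial_Obj)
  qed
qed

text \<open>A map \<open>g\<close> out of \<open>y\<close> is determined by
  \<open>g \<cdot> f\<close>, which starts at the initial object \<open>x\<close>.\<close>

lemma initial_transport:
  assumes "is_initial C x" "is_iso C f" "Dom C f = x" "Cod C f = y"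
  shows "is_initial C y"
  unfolding is_initial_def
proof (intro conjI ballI)
  have f: "f \<in> Arr C" using assms(2) is_iso_Arr by blast
  then show "y \<in> Obj C" using assms(4) Cod_Obj by blast
  fix z assume z: "z \<in> Obj C"
  have h: "the_hom C x z \<in> hom C x z" using assms(1) z by (rule the_hom_initial)
  show "\<exists>!g. g \<in> hom C y z"
  proof (rule ex1I)
    show "the_hom C x z \<cdot> inverse_arr C f \<in> hom C y z"
      using h f assms by (intro homI) (auto elim!: homE)
    fix g assume g: "g \<in> hom C y z"
    have "g \<cdot> f = the_hom C x z"
      using h f assms g by (intro initial_unique[OF assms(1)]) (auto elim!: homE)
    then have "the_hom C x z \<cdot> inverse_arr C f = (g \<cdot> f) \<cdot> inverse_arr C f" by simp
    also have "\<dots> = g" using g assms by (intro inverse_comp_cancel_right) (auto elim!: homE)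
    finally show "g = the_hom C x z \<cdot> inverse_arr C f" by simp
  qed
qed

end

section \<open>Coherence in monoidal categories\<close>

context monoidal_category
begin

lemma tensor_Obj [simp]: "\<lbrakk>x \<in> Obj W; y \<in> Obj W\<rbrakk> \<Longrightarrow> x \<otimes> y \<in> Obj W"
  by (rule tobj_Obj)

lemma tensor_Arr [simp]: "\<lbrakk>f \<in> Arr W; g \<in> Arr W\<rbrakk> \<Longrightarrow> f \<boxtimes> g \<in> Arr W"
  and Dom_tensor [simp]: "\<lbrakk>f \<in> Arr W; g \<in> Arr W\<rbrakk> \<Longrightarrow> Dom W (f \<boxtimes> g) = Dom W f \<otimes> Dom W g"
  and Cod_tensor [simp]: "\<lbrakk>f \<in> Arr W; g \<in> Arr W\<rbrakk> \<Longrightarrow> Cod W (f \<boxtimes> g) = Cod W f \<otimes> Cod W g"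
  using tarr_hom[of f "Dom W f" "Cod W f" g "Dom W g" "Cod W g"] by (auto simp: hom_def)

lemma unit_Obj [simp]: "munit W \<in> Obj W"
  by (rule munit_Obj)

lemma tensor_Idn [simp]: "\<lbrakk>x \<in> Obj W; y \<in> Obj W\<rbrakk> \<Longrightarrow> Idn W x \<boxtimes> Idn W y = Idn W (x \<otimes> y)"
  by (rule tarr_id)

lemma interchange [simp]:
  "\<lbrakk>f \<in> Arr W; f' \<in> Arr W; g \<in> Arr W; g' \<in> Arr W; Dom W f' = Cod W f; Dom W g' = Cod W g\<rbrakk>
    \<Longrightarrow> (f' \<boxtimes> g') \<cdot> (f \<boxtimes> g) = (f' \<cdot> f) \<boxtimes> (g' \<cdot> g)"
  by (rule tarr_comp[symmetric, of f "Dom W f" "Cod W f" f' "Cod W f'" g "Dom W g" "Cod W g" g' "Cod W g'"]) auto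

text \<open>The interchange law in the shape it takes inside a right-nested composite.\<close>

lemma interchange' [simp]:
  "\<lbrakk>f \<in> Arr W; f' \<in> Arr W; g \<in> Arr W; g' \<in> Arr W; Dom W f' = Cod W f; Dom W g' = Cod W g;
    h \<in> Arr W; Cod W h = Dom W f \<otimes> Dom W g\<rbrakk>
    \<Longrightarrow> (f' \<boxtimes> g') \<cdot> ((f \<boxtimes> g) \<cdot> h) = ((f' \<cdot> f) \<boxtimes> (g' \<cdot> g)) \<cdot> h"
  by (simp flip: comp_assoc_Arr)

lemma assoc_simps [simp]:
  assumes "x \<in> Obj W" "y \<in> Obj W" "z \<in> Obj W"
  shows "assoc W x y z \<in> Arr W" "Dom W (assoc W x y z) = (x \<otimes> y) \<otimes> z"
    "Cod W (assoc W x y z) = x \<otimes> (y \<otimes> z)" "is_iso W (assoc W x y z)"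
  using assoc_hom[OF assms] assoc_iso[OF assms] by (auto simp: hom_def)

lemma lunit_simps [simp]:
  assumes "x \<in> Obj W"
  shows "lunit W x \<in> Arr W" "Dom W (lunit W x) = munit W \<otimes> x"
    "Cod W (lunit W x) = x" "is_iso W (lunit W x)"
  using lunit_hom[OF assms] lunit_iso[OF assms] by (auto simp: hom_def)

lemma runit_simps [simp]:
  assumes "x \<in> Obj W"
  shows "runit W x \<in> Arr W" "Dom W (runit W x) = x \<otimes> munit W"
    "Cod W (runit W x) = x" "is_iso W (runit W x)"
  using runit_hom[OF assms] runit_iso[OF assms] by (auto simp: hom_def)

lemma assoc_natural:
  "\<lbrakk>f \<in> Arr W; g \<in> Arr W; h \<in> Arr W; Cod W f = x; Cod W g = y; Cod W h = z\<rbrakk>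
    \<Longrightarrow> assoc W x y z \<cdot> ((f \<boxtimes> g) \<boxtimes> h) = (f \<boxtimes> (g \<boxtimes> h)) \<cdot> assoc W (Dom W f) (Dom W g) (Dom W h)"
  by (rule assoc_nat) auto

lemma lunit_natural:
  "\<lbrakk>f \<in> Arr W; Cod W f = x\<rbrakk> \<Longrightarrow> lunit W x \<cdot> (Idn W (munit W) \<boxtimes> f) = f \<cdot> lunit W (Dom W f)"
  by (rule lunit_nat) auto

lemma runit_natural:
  "\<lbrakk>f \<in> Arr W; Cod W f = x\<rbrakk> \<Longrightarrow> runit W x \<cdot> (f \<boxtimes> Idn W (munit W)) = f \<cdot> runit W (Dom W f)"
  by (rule runit_nat) auto

lemma is_iso_tensor [simp]:
  assumes "is_iso W f" "is_iso W g"
  shows "is_iso W (f \<boxtimes> g)"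
  using assms assms[THEN is_iso_Arr]
  by (intro is_isoI[of _ "Dom W f \<otimes> Dom W g" "Cod W f \<otimes> Cod W g" "inverse_arr W f \<boxtimes> inverse_arr W g"]) auto

text \<open>Tensoring with the unit is faithful, since \<open>runit\<close> makes it isomorphic to
  the identity functor.\<close>

lemma tensor_unit_right_cancel:
  assumes "f \<in> Arr W" "g \<in> Arr W" "Dom W f = Dom W g" "Cod W f = Cod W g"
    and eq: "f \<boxtimes> Idn W (munit W) = g \<boxtimes> Idn W (munit W)"
  shows "f = g"
proof (rule iso_cancel_right)
  show "is_iso W (runit W (Dom W f))" using assms by simp
  show "f \<cdot> runit W (Dom W f) = g \<cdot> runit W (Dom W f)"
    using runit_natural[of f "Cod W f"] runit_natural[of g "Cod W f"] eq assms by simp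
qed (use assms in auto)

lemma tensor_unit_left_cancel:
  assumes "f \<in> Arr W" "g \<in> Arr W" "Dom W f = Dom W g" "Cod W f = Cod W g"
    and eq: "Idn W (munit W) \<boxtimes> f = Idn W (munit W) \<boxtimes> g"
  shows "f = g"
proof (rule iso_cancel_right)
  show "is_iso W (lunit W (Dom W f))" using assms by simp
  show "f \<cdot> lunit W (Dom W f) = g \<cdot> lunit W (Dom W f)"
    using lunit_natural[of f "Cod W f"] lunit_natural[of g "Cod W f"] eq assms by simp
qed (use assms in auto)

lemma triangle_left:
  assumes [simp]: "x \<in> Obj W" "y \<in> Obj W" "f \<in> Arr W" "Cod W f = (x \<otimes> munit W) \<otimes> y"
  shows "(Idn W x \<boxtimes> lunit W y) \<cdot> (assoc W x (munit W) y \<cdot> f) = (runit W x \<boxtimes> Idn W y) \<cdot> f"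
  by (simp add: triangle flip: comp_assoc_Arr)

text \<open>The next three laws are among Mac Lane's original axioms; Kelly derived them from the others.\<close>

lemma runit_tensor:
  assumes [simp]: "x \<in> Obj W" "y \<in> Obj W"
  shows "runit W (x \<otimes> y) = (Idn W x \<boxtimes> runit W y) \<cdot> assoc W x y (munit W)"
proof (rule tensor_unit_right_cancel)
  let ?I = "munit W"
  let ?a = "assoc W x y ?I"
  show "runit W (x \<otimes> y) \<boxtimes> Idn W ?I = ((Idn W x \<boxtimes> runit W y) \<cdot> ?a) \<boxtimes> Idn W ?I"
  proof (rule iso_cancel_left[of ?a])
    \<comment> \<open>The triangle trades the right unitor for a left one; the pentagon at
      \<open>x\<close>, \<open>y\<close>, \<open>munit W\<close>, \<open>munit W\<close> then brings
      a second triangle, the one at \<open>y\<close>, into play.\<close>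
    have "?a \<cdot> (runit W (x \<otimes> y) \<boxtimes> Idn W ?I)
        = ?a \<cdot> ((Idn W (x \<otimes> y) \<boxtimes> lunit W ?I) \<cdot> assoc W (x \<otimes> y) ?I ?I)"
      by (simp add: triangle)
    also have "\<dots> = (?a \<cdot> ((Idn W x \<boxtimes> Idn W y) \<boxtimes> lunit W ?I)) \<cdot> assoc W (x \<otimes> y) ?I ?I"
      by simp
    also have "\<dots> = (Idn W x \<boxtimes> (Idn W y \<boxtimes> lunit W ?I)) \<cdot> (assoc W x y (?I \<otimes> ?I) \<cdot> assoc W (x \<otimes> y) ?I ?I)"
      by (subst assoc_natural) auto
    also have "\<dots> = (Idn W x \<boxtimes> ((Idn W y \<boxtimes> lunit W ?I) \<cdot> assoc W y ?I ?I))
        \<cdot> (assoc W x (y \<otimes> ?I) ?I \<cdot> (assoc W x y ?I \<boxtimes> Idn W ?I))"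
      by (simp add: pentagon)
    also have "\<dots> = ((Idn W x \<boxtimes> (runit W y \<boxtimes> Idn W ?I)) \<cdot> assoc W x (y \<otimes> ?I) ?I) \<cdot> (assoc W x y ?I \<boxtimes> Idn W ?I)"
      by (simp add: triangle)
    also have "(Idn W x \<boxtimes> (runit W y \<boxtimes> Idn W ?I)) \<cdot> assoc W x (y \<otimes> ?I) ?I
        = ?a \<cdot> ((Idn W x \<boxtimes> runit W y) \<boxtimes> Idn W ?I)"
      by (subst assoc_natural) auto
    finally show "?a \<cdot> (runit W (x \<otimes> y) \<boxtimes> Idn W ?I)
        = ?a \<cdot> (((Idn W x \<boxtimes> runit W y) \<cdot> ?a) \<boxtimes> Idn W ?I)" by simp
  qed auto
qed auto

lemma lunit_tensor:
  assumes [simp]: "x \<in> Obj W" "y \<in> Obj W"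
  shows "lunit W (x \<otimes> y) \<cdot> assoc W (munit W) x y = lunit W x \<boxtimes> Idn W y"
proof (rule tensor_unit_left_cancel)
  let ?I = "munit W"
  \<comment> \<open>\<open>?b\<close> completes \<open>Idn W ?I \<boxtimes> assoc W ?I x y\<close>
    to the three-arrow side of the pentagon at \<open>munit W\<close>, \<open>munit W\<close>,
    \<open>x\<close>, \<open>y\<close>.\<close>
  let ?b = "assoc W ?I (?I \<otimes> x) y \<cdot> (assoc W ?I ?I x \<boxtimes> Idn W y)"
  show "Idn W ?I \<boxtimes> (lunit W (x \<otimes> y) \<cdot> assoc W ?I x y) = Idn W ?I \<boxtimes> (lunit W x \<boxtimes> Idn W y)"
  proof (rule iso_cancel_right[of ?b])
    have "(Idn W ?I \<boxtimes> (lunit W (x \<otimes> y) \<cdot> assoc W ?I x y)) \<cdot> ?b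
       = (Idn W ?I \<boxtimes> lunit W (x \<otimes> y)) \<cdot> ((Idn W ?I \<boxtimes> assoc W ?I x y) \<cdot> ?b)"
      by simp
    also have "\<dots> = (Idn W ?I \<boxtimes> lunit W (x \<otimes> y)) \<cdot> (assoc W ?I ?I (x \<otimes> y) \<cdot> assoc W (?I \<otimes> ?I) x y)"
      by (subst pentagon) auto
    also have "\<dots> = (runit W ?I \<boxtimes> (Idn W x \<boxtimes> Idn W y)) \<cdot> assoc W (?I \<otimes> ?I) x y"
      by (simp add: triangle_left)
    also have "\<dots> = assoc W ?I x y \<cdot> ((runit W ?I \<boxtimes> Idn W x) \<boxtimes> Idn W y)"
      by (subst assoc_natural) auto
    also have "\<dots> = assoc W ?I x y \<cdot> (((Idn W ?I \<boxtimes> lunit W x) \<boxtimes> Idn W y) \<cdot> (assoc W ?I ?I x \<boxtimes> Idn W y))"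
      by (simp flip: triangle)
    also have "\<dots> = (assoc W ?I x y \<cdot> ((Idn W ?I \<boxtimes> lunit W x) \<boxtimes> Idn W y)) \<cdot> (assoc W ?I ?I x \<boxtimes> Idn W y)"
      by simp
    also have "\<dots> = (Idn W ?I \<boxtimes> (lunit W x \<boxtimes> Idn W y)) \<cdot> ?b"
      by (subst assoc_natural) auto
    finally show "(Idn W ?I \<boxtimes> (lunit W (x \<otimes> y) \<cdot> assoc W ?I x y)) \<cdot> ?b
       = (Idn W ?I \<boxtimes> (lunit W x \<boxtimes> Idn W y)) \<cdot> ?b" .
  qed auto
qed auto

lemma lunit_unit_eq_runit_unit: "lunit W (munit W) = runit W (munit W)"
proof (rule tensor_unit_right_cancel)
  let ?I = "munit W"
  \<comment> \<open>Naturality of \<open>lunit\<close> at the arrow \<open>lunit W ?I\<close>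
    itself, followed by cancelling that isomorphism.\<close>
  have "lunit W (?I \<otimes> ?I) = Idn W ?I \<boxtimes> lunit W ?I"
    by (rule iso_cancel_left[of "lunit W ?I"]) (simp_all add: lunit_natural)
  then show "lunit W ?I \<boxtimes> Idn W ?I = runit W ?I \<boxtimes> Idn W ?I"
    using lunit_tensor[of ?I ?I] triangle[of ?I ?I] by simp
qed auto

end

section \<open>Categories of triples and their monoidal extensions\<close>

lemma triple_cat_simps [simp]:
  "Obj (triple_cat A H i c) = A"
  "Arr (triple_cat A H i c) = {(x, y, f). x \<in> A \<and> y \<in> A \<and> f \<in> H x y}"
  "Dom (triple_cat A H i c) (x, y, f) = x"
  "Cod (triple_cat A H i c) (x, y, f) = y"
  "Idn (triple_cat A H i c) x = (x, x, i x)"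
  "Comp (triple_cat A H i c) (y', z, g) (x, y, f) = (x, z, c x g f)"
  by (simp_all add: triple_cat_def)

lemma hom_triple_cat:
  "hom (triple_cat A H i c) x y = {(x', y', f). x' = x \<and> y' = y \<and> x \<in> A \<and> y \<in> A \<and> f \<in> H x y}"
  by (auto simp: hom_def)

lemma category_triple_cat:
  assumes "\<And>x. x \<in> A \<Longrightarrow> i x \<in> H x x"
    and "\<And>x y z f g. \<lbrakk>x \<in> A; y \<in> A; z \<in> A; f \<in> H x y; g \<in> H y z\<rbrakk> \<Longrightarrow> c x g f \<in> H x z"
    and "\<And>x y f. \<lbrakk>x \<in> A; y \<in> A; f \<in> H x y\<rbrakk> \<Longrightarrow> c x f (i x) = f"
    and "\<And>x y f. \<lbrakk>x \<in> A; y \<in> A; f \<in> H x y\<rbrakk> \<Longrightarrow> c x (i y) f = f"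
    and "\<And>w x y z f g h. \<lbrakk>w \<in> A; x \<in> A; y \<in> A; z \<in> A; f \<in> H w x; g \<in> H x y; h \<in> H y z\<rbrakk>
      \<Longrightarrow> c w (c x h g) f = c w h (c w g f)"
  shows "category (triple_cat A H i c)"
  by unfold_locales (auto simp: hom_triple_cat assms intro: assms(2))

lemma cat_extend_simps [simp]:
  fixes C :: "('o, 'a) cat"
  shows "Obj (cat.extend C m) = Obj C" "Arr (cat.extend C m) = Arr C" "Dom (cat.extend C m) = Dom C"
    "Cod (cat.extend C m) = Cod C" "Idn (cat.extend C m) = Idn C" "Comp (cat.extend C m) = Comp C"
    "hom (cat.extend C m) = hom C"
  by (simp_all add: cat.extend_def hom_def fun_eq_iff)

lemma category_extend: "category C \<Longrightarrow> category (cat.extend C m)"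
  by (simp add: category_def)

lemma mcat_fields_simps [simp]:
  fixes C :: "('o, 'a) cat"
  shows "tobj (cat.extend C (mcat.fields t t' u a l r)) = t"
    "tarr (cat.extend C (mcat.fields t t' u a l r)) = t'"
    "munit (cat.extend C (mcat.fields t t' u a l r)) = u"
    "assoc (cat.extend C (mcat.fields t t' u a l r)) = a"
    "lunit (cat.extend C (mcat.fields t t' u a l r)) = l"
    "runit (cat.extend C (mcat.fields t t' u a l r)) = r"
  by (simp_all add: cat.extend_def mcat.fields_def)

section \<open>Strict monoidal categories\<close>

locale strict_monoidal = monoidal_category S for S :: "('o, 'a, 'z) mcat_scheme" (structure) +
  assumes strict_tobj_assoc: "\<lbrakk>x \<in> Obj S; y \<in> Obj S; z \<in> Obj S\<rbrakk> \<Longrightarrow> (x \<otimes> y) \<otimes> z = x \<otimes> (y \<otimes> z)"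
    and strict_tobj_lunit: "x \<in> Obj S \<Longrightarrow> munit S \<otimes> x = x"
    and strict_tobj_runit: "x \<in> Obj S \<Longrightarrow> x \<otimes> munit S = x"
    and strict_assoc: "\<lbrakk>x \<in> Obj S; y \<in> Obj S; z \<in> Obj S\<rbrakk> \<Longrightarrow> assoc S x y z = Idn S (x \<otimes> (y \<otimes> z))"
    and strict_lunit: "x \<in> Obj S \<Longrightarrow> lunit S x = Idn S x"
    and strict_runit: "x \<in> Obj S \<Longrightarrow> runit S x = Idn S x"
begin

text \<open>Naturality of an associator all of whose components are identities. The two unit laws
  for arrows arise from the unitors in the same way.\<close>

lemma tarr_assoc:
  "\<lbrakk>f \<in> Arr S; g \<in> Arr S; h \<in> Arr S\<rbrakk> \<Longrightarrow> (f \<boxtimes> g) \<boxtimes> h = f \<boxtimes> (g \<boxtimes> h)"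
  using assoc_natural[OF _ _ _ refl refl refl, of f g h] by (simp add: strict_assoc strict_tobj_assoc)

lemma tarr_lunit: "f \<in> Arr S \<Longrightarrow> Idn S (munit S) \<boxtimes> f = f"
  using lunit_natural[OF _ refl, of f] by (simp add: strict_lunit strict_tobj_lunit)

lemma tarr_runit: "f \<in> Arr S \<Longrightarrow> f \<boxtimes> Idn S (munit S) = f"
  using runit_natural[OF _ refl, of f] by (simp add: strict_runit strict_tobj_runit)

end

text \<open>For identity constraints, naturality amounts to the three laws for tensors of arrows,
  while pentagon and triangle become equations between identities.\<close>

lemma strict_monoidalI:
  fixes S :: "('o, 'a, 'z) mcat_scheme" (structure)
  assumes "category S"
    and tobj: "\<And>x y. \<lbrakk>x \<in> Obj S; y \<in> Obj S\<rbrakk> \<Longrightarrow> x \<otimes> y \<in> Obj S"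
    and tarr: "\<And>f g x x' y y'. \<lbrakk>f \<in> hom S x x'; g \<in> hom S y y'\<rbrakk> \<Longrightarrow> f \<boxtimes> g \<in> hom S (x \<otimes> y) (x' \<otimes> y')"
    and tid: "\<And>x y. \<lbrakk>x \<in> Obj S; y \<in> Obj S\<rbrakk> \<Longrightarrow> Idn S x \<boxtimes> Idn S y = Idn S (x \<otimes> y)"
    and tcomp: "\<And>f f' g g' x x' x'' y y' y''.
        \<lbrakk>f \<in> hom S x x'; f' \<in> hom S x' x''; g \<in> hom S y y'; g' \<in> hom S y' y''\<rbrakk>
          \<Longrightarrow> (f' \<cdot> f) \<boxtimes> (g' \<cdot> g) = (f' \<boxtimes> g') \<cdot> (f \<boxtimes> g)"
    and unit: "munit S \<in> Obj S"
    and oassoc: "\<And>x y z. \<lbrakk>x \<in> Obj S; y \<in> Obj S; z \<in> Obj S\<rbrakk> \<Longrightarrow> (x \<otimes> y) \<otimes> z = x \<otimes> (y \<otimes> z)"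
    and olunit: "\<And>x. x \<in> Obj S \<Longrightarrow> munit S \<otimes> x = x"
    and orunit: "\<And>x. x \<in> Obj S \<Longrightarrow> x \<otimes> munit S = x"
    and aassoc: "\<And>f g h. \<lbrakk>f \<in> Arr S; g \<in> Arr S; h \<in> Arr S\<rbrakk> \<Longrightarrow> (f \<boxtimes> g) \<boxtimes> h = f \<boxtimes> (g \<boxtimes> h)"
    and alunit: "\<And>f. f \<in> Arr S \<Longrightarrow> Idn S (munit S) \<boxtimes> f = f"
    and arunit: "\<And>f. f \<in> Arr S \<Longrightarrow> f \<boxtimes> Idn S (munit S) = f"
    and assoc: "\<And>x y z. \<lbrakk>x \<in> Obj S; y \<in> Obj S; z \<in> Obj S\<rbrakk> \<Longrightarrow> assoc S x y z = Idn S (x \<otimes> (y \<otimes> z))"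
    and lunit: "\<And>x. x \<in> Obj S \<Longrightarrow> lunit S x = Idn S x"
    and runit: "\<And>x. x \<in> Obj S \<Longrightarrow> runit S x = Idn S x"
  shows "strict_monoidal S"
proof -
  interpret category S by fact
  note [simp] = tobj unit tid oassoc olunit orunit assoc lunit runit aassoc alunit arunit
  have [simp]: "f \<boxtimes> g \<in> Arr S" "Dom S (f \<boxtimes> g) = Dom S f \<otimes> Dom S g" "Cod S (f \<boxtimes> g) = Cod S f \<otimes> Cod S g"
    if "f \<in> Arr S" "g \<in> Arr S" for f g
    using tarr[of f "Dom S f" "Cod S f" g "Dom S g" "Cod S g"] that by (auto simp: hom_def)
  show ?thesis
    by unfold_locales ((fact tarr) | (rule tcomp; assumption) | (auto elim!: homE)[1])+
qed

section \<open>Strictification\<close>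

text \<open>Nesting to the right and ending in the unit gives the empty list the value
  \<open>munit W\<close> and makes prepending uniform; the price is that \<open>[x]\<close> realises
  \<open>x \<otimes> munit W\<close> rather than \<open>x\<close>.\<close>

primrec tensor_list :: "('o, 'a, 'z) mcat_scheme \<Rightarrow> 'o list \<Rightarrow> 'o" where
  "tensor_list W [] = munit W"
| "tensor_list W (x # xs) = x \<otimes>\<^bsub>W\<^esub> tensor_list W xs"

text \<open>The canonical isomorphism from the tensor product of two realised lists to the
  realisation of their concatenation. It is the monoidal structure of realisation.\<close>

primrec tensor_append :: "('o, 'a, 'z) mcat_scheme \<Rightarrow> 'o list \<Rightarrow> 'o list \<Rightarrow> 'a" where
  "tensor_append W [] ys = lunit W (tensor_list W ys)"
| "tensor_append W (x # xs) ys = (Idn W x \<boxtimes>\<^bsub>W\<^esub> tensor_append W xs ys)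
     \<cdot>\<^bsub>W\<^esub> assoc W x (tensor_list W xs) (tensor_list W ys)"

text \<open>The hom-sets are pulled back along realisation, which is thereby fully faithful; arrows
  are tensored in \<open>W\<close> and conjugated with \<open>tensor_append\<close>. Concatenation
  makes the product of objects strictly associative.\<close>

definition strictification ::
  "('o, 'a, 'z) mcat_scheme \<Rightarrow> ('o list, 'o list \<times> 'o list \<times> 'a) mcat" where
  "strictification W = cat.extend
     (triple_cat (lists (Obj W)) (\<lambda>xs ys. hom W (tensor_list W xs) (tensor_list W ys))
        (\<lambda>xs. Idn W (tensor_list W xs)) (\<lambda>_ g f. g \<cdot>\<^bsub>W\<^esub> f))
     (mcat.fields (@)
        (\<lambda>(xs, ys, f) (xs', ys', g). (xs @ xs', ys @ ys',
           tensor_append W ys ys' \<cdot>\<^bsub>W\<^esub> ((f \<boxtimes>\<^bsub>W\<^esub> g) \<cdot>\<^bsub>W\<^esub> inverse_arr W (tensor_append W xs xs'))))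
        []
        (\<lambda>xs ys zs. (xs @ ys @ zs, xs @ ys @ zs, Idn W (tensor_list W (xs @ ys @ zs))))
        (\<lambda>xs. (xs, xs, Idn W (tensor_list W xs)))
        (\<lambda>xs. (xs, xs, Idn W (tensor_list W xs))))"

context monoidal_category
begin

lemma tensor_list_Obj [simp]: "set xs \<subseteq> Obj W \<Longrightarrow> tensor_list W xs \<in> Obj W"
  by (induction xs) auto

lemma tensor_append_simps [simp]:
  assumes "set xs \<subseteq> Obj W" "set ys \<subseteq> Obj W"
  shows "tensor_append W xs ys \<in> Arr W"
    "Dom W (tensor_append W xs ys) = tensor_list W xs \<otimes> tensor_list W ys"
    "Cod W (tensor_append W xs ys) = tensor_list W (xs @ ys)"
    "is_iso W (tensor_append W xs ys)"
  using assms by (induction xs) auto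

text \<open>The associativity axiom for realisation as a monoidal functor. The empty list needs
  \<open>lunit_tensor\<close>; a further factor costs one pentagon and two uses of naturality of the
  associator.\<close>

lemma tensor_append_assoc:
  assumes "set xs \<subseteq> Obj W" "set ys \<subseteq> Obj W" "set zs \<subseteq> Obj W"
  shows "tensor_append W (xs @ ys) zs \<cdot> (tensor_append W xs ys \<boxtimes> Idn W (tensor_list W zs))
    = tensor_append W xs (ys @ zs) \<cdot> ((Idn W (tensor_list W xs) \<boxtimes> tensor_append W ys zs)
        \<cdot> assoc W (tensor_list W xs) (tensor_list W ys) (tensor_list W zs))"
  using assms(1)
proof (induction xs)
  case Nil
  note [simp] = assms(2,3)
  have "lunit W (tensor_list W (ys @ zs)) \<cdot> ((Idn W (munit W) \<boxtimes> tensor_append W ys zs)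
        \<cdot> assoc W (munit W) (tensor_list W ys) (tensor_list W zs))
      = (lunit W (tensor_list W (ys @ zs)) \<cdot> (Idn W (munit W) \<boxtimes> tensor_append W ys zs))
        \<cdot> assoc W (munit W) (tensor_list W ys) (tensor_list W zs)"
    by simp
  also have "\<dots> = tensor_append W ys zs \<cdot> (lunit W (tensor_list W ys) \<boxtimes> Idn W (tensor_list W zs))"
    by (simp add: lunit_natural lunit_tensor)
  finally show ?case by simp
next
  case (Cons x xs)
  let ?X = "tensor_list W xs" and ?Y = "tensor_list W ys" and ?Z = "tensor_list W zs"
  let ?a = "tensor_append W"
  have [simp]: "x \<in> Obj W" "set xs \<subseteq> Obj W" "set ys \<subseteq> Obj W" "set zs \<subseteq> Obj W"
    using Cons.prems assms by auto
  have "?a (x # xs @ ys) zs \<cdot> (?a (x # xs) ys \<boxtimes> Idn W ?Z)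
      = (Idn W x \<boxtimes> ?a (xs @ ys) zs) \<cdot> ((assoc W x (tensor_list W (xs @ ys)) ?Z
          \<cdot> ((Idn W x \<boxtimes> ?a xs ys) \<boxtimes> Idn W ?Z)) \<cdot> (assoc W x ?X ?Y \<boxtimes> Idn W ?Z))"
    by simp
  also have "assoc W x (tensor_list W (xs @ ys)) ?Z \<cdot> ((Idn W x \<boxtimes> ?a xs ys) \<boxtimes> Idn W ?Z)
      = (Idn W x \<boxtimes> (?a xs ys \<boxtimes> Idn W ?Z)) \<cdot> assoc W x (?X \<otimes> ?Y) ?Z"
    by (subst assoc_natural) auto
  also have "(Idn W x \<boxtimes> ?a (xs @ ys) zs) \<cdot> (\<dots> \<cdot> (assoc W x ?X ?Y \<boxtimes> Idn W ?Z))
      = (Idn W x \<boxtimes> (?a xs (ys @ zs) \<cdot> (Idn W ?X \<boxtimes> ?a ys zs)))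
        \<cdot> ((Idn W x \<boxtimes> assoc W ?X ?Y ?Z) \<cdot> (assoc W x (?X \<otimes> ?Y) ?Z \<cdot> (assoc W x ?X ?Y \<boxtimes> Idn W ?Z)))"
    using Cons.IH by simp
  also have "\<dots> = (Idn W x \<boxtimes> ?a xs (ys @ zs)) \<cdot> (((Idn W x \<boxtimes> (Idn W ?X \<boxtimes> ?a ys zs))
        \<cdot> assoc W x ?X (?Y \<otimes> ?Z)) \<cdot> assoc W (x \<otimes> ?X) ?Y ?Z)"
    by (simp flip: pentagon)
  also have "(Idn W x \<boxtimes> (Idn W ?X \<boxtimes> ?a ys zs)) \<cdot> assoc W x ?X (?Y \<otimes> ?Z)
      = assoc W x ?X (tensor_list W (ys @ zs)) \<cdot> ((Idn W x \<boxtimes> Idn W ?X) \<boxtimes> ?a ys zs)"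
    by (subst assoc_natural) auto
  finally show ?case by simp
qed

text \<open>The right unit axiom for realisation. For the empty list it asks that the two unitors of
  the unit object agree.\<close>

lemma tensor_append_Nil:
  "set xs \<subseteq> Obj W \<Longrightarrow> tensor_append W xs [] = runit W (tensor_list W xs)"
  by (induction xs) (auto simp: lunit_unit_eq_runit_unit runit_tensor)

text \<open>The triangle identity: appending to \<open>[x]\<close> absorbs the trailing unit of
  \<open>x \<otimes> munit W\<close>.\<close>

lemma tensor_append_single:
  "\<lbrakk>x \<in> Obj W; set ys \<subseteq> Obj W\<rbrakk>
    \<Longrightarrow> tensor_append W [x] ys = runit W x \<boxtimes> Idn W (tensor_list W ys)"
  by (simp add: triangle)

abbreviation (input) "st \<equiv> strictification W"

lemma strictification_simps [simp]:
  "Obj st = lists (Obj W)"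
  "Arr st = {(xs, ys, f). set xs \<subseteq> Obj W \<and> set ys \<subseteq> Obj W \<and> f \<in> hom W (tensor_list W xs) (tensor_list W ys)}"
  "Dom st (xs, ys, f) = xs"
  "Cod st (xs, ys, f) = ys"
  "Idn st xs = (xs, xs, Idn W (tensor_list W xs))"
  "Comp st (ys', zs, g) (xs, ys, f) = (xs, zs, g \<cdot> f)"
  "tobj st xs ys = xs @ ys"
  "tarr st (xs, ys, f) (xs', ys', f') = (xs @ xs', ys @ ys',
           tensor_append W ys ys' \<cdot> ((f \<boxtimes> f') \<cdot> inverse_arr W (tensor_append W xs xs')))"
  "munit st = []"
  by (auto simp: strictification_def)

lemma hom_strictification:
  "hom st xs ys = {(xs', ys', f). xs' = xs \<and> ys' = ys \<and> set xs \<subseteq> Obj W \<and> set ys \<subseteq> Obj W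
     \<and> f \<in> hom W (tensor_list W xs) (tensor_list W ys)}"
  by (auto simp: hom_def)

lemma strictification_tarr_assoc:
  assumes "F \<in> Arr st" "G \<in> Arr st" "H \<in> Arr st"
  shows "tarr st (tarr st F G) H = tarr st F (tarr st G H)"
proof -
  obtain x x' f y y' g z z' h where
    F: "F = (x, x', f)" and G: "G = (y, y', g)" and H: "H = (z, z', h)"
    by (metis prod.exhaust)
  let ?T = "tensor_list W" and ?a = "tensor_append W" and ?i = "\<lambda>xs ys. inverse_arr W (tensor_append W xs ys)"
  have [simp]: "set x \<subseteq> Obj W" "set x' \<subseteq> Obj W" "set y \<subseteq> Obj W" "set y' \<subseteq> Obj W"
    "set z \<subseteq> Obj W" "set z' \<subseteq> Obj W" "f \<in> Arr W" "Dom W f = ?T x" "Cod W f = ?T x'"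
    "g \<in> Arr W" "Dom W g = ?T y" "Cod W g = ?T y'" "h \<in> Arr W" "Dom W h = ?T z" "Cod W h = ?T z'"
    using assms by (auto simp: F G H elim: homE)
  let ?l = "?a (x' @ y') z' \<cdot> ((?a x' y' \<cdot> ((f \<boxtimes> g) \<cdot> ?i x y)) \<boxtimes> h) \<cdot> ?i (x @ y) z"
  let ?r = "?a x' (y' @ z') \<cdot> (f \<boxtimes> (?a y' z' \<cdot> ((g \<boxtimes> h) \<cdot> ?i y z))) \<cdot> ?i x (y @ z)"
  \<comment> \<open>Composing with the iterated append at the source removes all inverses; what
    remains is naturality of the associator, framed by \<open>tensor_append_assoc\<close> at source
    and target.\<close>
  let ?c = "?a (x @ y) z \<cdot> (?a x y \<boxtimes> Idn W (?T z))"
  have "?l = ?r"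
  proof (rule iso_cancel_right[of ?c])
    have "?l \<cdot> ?c = (?a (x' @ y') z' \<cdot> (?a x' y' \<boxtimes> Idn W (?T z'))) \<cdot> ((f \<boxtimes> g) \<boxtimes> h)"
      by simp
    also have "\<dots> = ?a x' (y' @ z') \<cdot> ((Idn W (?T x') \<boxtimes> ?a y' z') \<cdot> (assoc W (?T x') (?T y') (?T z') \<cdot> ((f \<boxtimes> g) \<boxtimes> h)))"
      by (subst tensor_append_assoc) auto
    also have "assoc W (?T x') (?T y') (?T z') \<cdot> ((f \<boxtimes> g) \<boxtimes> h) = (f \<boxtimes> (g \<boxtimes> h)) \<cdot> assoc W (?T x) (?T y) (?T z)"
      by (subst assoc_natural) auto
    also have "?a x' (y' @ z') \<cdot> ((Idn W (?T x') \<boxtimes> ?a y' z') \<cdot> \<dots>) = ?r \<cdot>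
        (?a x (y @ z) \<cdot> ((Idn W (?T x) \<boxtimes> ?a y z) \<cdot> assoc W (?T x) (?T y) (?T z)))"
      by simp
    also have "?a x (y @ z) \<cdot> ((Idn W (?T x) \<boxtimes> ?a y z) \<cdot> assoc W (?T x) (?T y) (?T z)) = ?c"
      by (subst tensor_append_assoc) auto
    finally show "?l \<cdot> ?c = ?r \<cdot> ?c" .
  qed auto
  then show ?thesis by (simp add: F G H)
qed

lemma strict_monoidal_strictification: "strict_monoidal st"
proof (rule strict_monoidalI)
  show "category st"
    unfolding strictification_def
    by (intro category_extend category_triple_cat) (auto simp: subset_iff elim!: homE intro!: homI)
next
  fix F assume "F \<in> Arr st"
  then obtain xs ys f where F: "F = (xs, ys, f)" and [simp]: "set xs \<subseteq> Obj W" "set ys \<subseteq> Obj W"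
    "f \<in> Arr W" "Dom W f = tensor_list W xs" "Cod W f = tensor_list W ys"
    by (auto elim!: homE)
  have "lunit W (tensor_list W ys) \<cdot> ((Idn W (munit W) \<boxtimes> f) \<cdot> inverse_arr W (lunit W (tensor_list W xs))) =
    (lunit W (tensor_list W ys) \<cdot> (Idn W (munit W) \<boxtimes> f)) \<cdot> inverse_arr W (lunit W (tensor_list W xs))"
    by simp
  also have "\<dots> = f" by (subst lunit_natural) auto
  finally show "tarr st (Idn st (munit st)) F = F" by (simp add: F)
  have "runit W (tensor_list W ys) \<cdot> ((f \<boxtimes> Idn W (munit W)) \<cdot> inverse_arr W (runit W (tensor_list W xs))) =
    (runit W (tensor_list W ys) \<cdot> (f \<boxtimes> Idn W (munit W))) \<cdot> inverse_arr W (runit W (tensor_list W xs))"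
    by simp
  also have "\<dots> = f" by (subst runit_natural) auto
  finally show "tarr st F (Idn st (munit st)) = F" by (simp add: F tensor_append_Nil)
next
  fix F F' G G' xs xs' xs'' ys ys' ys''
  assume *: "F \<in> hom st xs xs'" "F' \<in> hom st xs' xs''" "G \<in> hom st ys ys'" "G' \<in> hom st ys' ys''"
  then show "tarr st (Comp st F' F) (Comp st G' G) = Comp st (tarr st F' G') (tarr st F G)"
    by (auto simp: hom_strictification elim!: homE)
next
  fix F G H assume "F \<in> Arr st" "G \<in> Arr st" "H \<in> Arr st"
  then show "tarr st (tarr st F G) H = tarr st F (tarr st G H)"
    by (rule strictification_tarr_assoc)
next
  fix F G xs xs' ys ys' assume "F \<in> hom st xs xs'" "G \<in> hom st ys ys'"
  then show "tarr st F G \<in> hom st (tobj st xs ys) (tobj st xs' ys')"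
    by (auto simp: hom_strictification elim!: homE intro!: homI)
next
  fix xs ys assume "xs \<in> Obj st" "ys \<in> Obj st"
  then have "set xs \<subseteq> Obj W" "set ys \<subseteq> Obj W" by auto
  then show "tarr st (Idn st xs) (Idn st ys) = Idn st (tobj st xs ys)" by simp
qed (simp_all add: strictification_def)

end

section \<open>Maps between lists of simplices\<close>

text \<open>Maps from [m] to [n] are total functions of which only the values up to \<open>m\<close>
  count, so that shifting and composing are plain lambda terms. Monotonicity lets the bound at
  \<open>m\<close> stand for all bounds.\<close>

definition simplex_map :: "nat \<Rightarrow> nat \<Rightarrow> (nat \<Rightarrow> nat) \<Rightarrow> bool" where
  "simplex_map m n f \<longleftrightarrow> mono_on {0..m} f \<and> f m \<le> n"

lemma simplex_map_mono: "\<lbrakk>simplex_map m n f; a \<le> b; b \<le> m\<rbrakk> \<Longrightarrow> f a \<le> f b"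
  unfolding simplex_map_def mono_on_def by simp

lemma simplex_map_le [simp]: "\<lbrakk>simplex_map m n f; a \<le> m\<rbrakk> \<Longrightarrow> f a \<le> n"
  using simplex_map_mono[of m n f a m] unfolding simplex_map_def by linarith

lemma simplex_mapI:
  "\<lbrakk>\<And>a b. \<lbrakk>a \<le> b; b \<le> m\<rbrakk> \<Longrightarrow> f a \<le> f b; f m \<le> n\<rbrakk> \<Longrightarrow> simplex_map m n f"
  unfolding simplex_map_def mono_on_def by simp

lemma simplex_map_restrict: "\<lbrakk>simplex_map m n f; m' \<le> m; f m' \<le> n'\<rbrakk> \<Longrightarrow> simplex_map m' n' f"
  by (rule simplex_mapI) (simp_all add: simplex_map_mono)

lemma simplex_map_prefix: "\<lbrakk>simplex_map m n f; m' \<le> m\<rbrakk> \<Longrightarrow> simplex_map m' n f"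
  by (rule simplex_map_restrict) auto

lemma simplex_map_shift: "simplex_map (m + k) n f \<Longrightarrow> simplex_map k n (\<lambda>i. f (m + i))"
  by (rule simplex_mapI) (simp_all add: simplex_map_mono)

lemma simplex_map_comp: "\<lbrakk>simplex_map m n f; simplex_map n k g\<rbrakk> \<Longrightarrow> simplex_map m k (\<lambda>i. g (f i))"
  by (rule simplex_mapI) (simp_all add: simplex_map_mono[of m n f] simplex_map_mono[of n k g])

lemma simplex_map_cong: "\<lbrakk>\<And>i. i \<le> m \<Longrightarrow> f i = g i\<rbrakk> \<Longrightarrow> simplex_map m n f \<longleftrightarrow> simplex_map m n g"
  unfolding simplex_map_def mono_on_def by simp

text \<open>These are the partial sums. A zero gap is allowed and merely repeats a joint; lists with
  positive gaps are determined by their joints (\<open>joints_inject\<close>).\<close>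

primrec joints :: "nat list \<Rightarrow> nat set" where
  "joints [] = {0}"
| "joints (n # ns) = insert 0 ((+) n ` joints ns)"

lemma joints_append: "joints (ms @ ns) = joints ms \<union> (+) (sum_list ms) ` joints ns"
proof (induction ms)
  case Nil
  show ?case by (cases ns) auto
qed (auto simp: image_Un image_image add.assoc)

lemma joints_split: "t \<in> joints ns \<Longrightarrow> \<exists>as bs. ns = as @ bs \<and> sum_list as = t"
proof (induction ns arbitrary: t)
  case (Cons n ns)
  show ?case
  proof (cases "t = 0")
    case True
    then show ?thesis by (metis append_Nil sum_list.Nil)
  next
    case False
    with Cons.prems obtain t' where t': "t = n + t'" "t' \<in> joints ns" by auto
    then obtain as bs where "ns = as @ bs" "sum_list as = t'" using Cons.IH by blast
    then have "n # ns = (n # as) @ bs \<and> sum_list (n # as) = t" using t' by simp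
    then show ?thesis by blast
  qed
qed auto

lemma joints_le: "t \<in> joints ns \<Longrightarrow> t \<le> sum_list ns"
  by (induction ns arbitrary: t) auto

lemma zero_in_joints [simp]: "0 \<in> joints ns"
  by (cases ns) auto

lemma sum_in_joints [simp]: "sum_list ns \<in> joints ns"
  by (induction ns) auto

text \<open>A necklace is encoded by the list of gaps between its joints; these are the maps from the
  necklace \<open>ns\<close> to the necklace \<open>ms\<close>.\<close>

definition joint_map :: "nat list \<Rightarrow> nat list \<Rightarrow> (nat \<Rightarrow> nat) \<Rightarrow> bool" where
  "joint_map ns ms f \<longleftrightarrow> simplex_map (sum_list ns) (sum_list ms) f \<and> f 0 = 0
     \<and> f (sum_list ns) = sum_list ms \<and> joints ms \<subseteq> f ` joints ns"

lemma joint_map_cong: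
  assumes "joint_map ns ms f" "\<And>i. i \<le> sum_list ns \<Longrightarrow> f i = g i"
  shows "joint_map ns ms g"
proof -
  have "f ` joints ns = g ` joints ns"
    using assms(2) by (intro image_cong) (auto dest: joints_le)
  then show ?thesis
    using assms simplex_map_cong[of "sum_list ns" f g] unfolding joint_map_def by force
qed

lemma joint_map_Nil: "joint_map ns [] f \<longleftrightarrow> (\<forall>i \<le> sum_list ns. f i = 0)"
proof
  show "joint_map ns [] f \<Longrightarrow> \<forall>i \<le> sum_list ns. f i = 0"
    unfolding joint_map_def using simplex_map_le[of "sum_list ns" 0 f] by simp
  assume "\<forall>i \<le> sum_list ns. f i = 0"
  then show "joint_map ns [] f"
    unfolding joint_map_def by (auto intro: simplex_mapI image_eqI[of _ _ 0])
qed

lemma joint_map_simplex_map: "joint_map ns ms f \<Longrightarrow> simplex_map (sum_list ns) (sum_list ms) f"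
  by (simp add: joint_map_def)

lemma joint_map_single:
  "\<lbrakk>simplex_map (sum_list ns) m f; f 0 = 0; f (sum_list ns) = m\<rbrakk> \<Longrightarrow> joint_map ns [m] f"
  unfolding joint_map_def
  by (auto intro: image_eqI[of _ _ 0] image_eqI[of _ _ "sum_list ns"])

lemma joint_map_id: "joint_map ns ns (\<lambda>i. i)"
  unfolding joint_map_def by (auto intro: simplex_mapI)

text \<open>The cut may be any joint over \<open>sum_list ms\<close>. By monotonicity, a joint of
  \<open>ms\<close> hit from beyond the cut equals \<open>sum_list ms\<close> and is hit at the cut
  as well; the other half is symmetric.\<close>

lemma joint_map_cut:
  assumes f: "joint_map (as @ bs) (ms @ ms') f" and fa: "f (sum_list as) = sum_list ms"
  shows "joint_map as ms f" and "joint_map bs ms' (\<lambda>i. f (sum_list as + i) - sum_list ms)"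
proof -
  let ?a = "sum_list as" and ?b = "sum_list bs" and ?m = "sum_list ms" and ?m' = "sum_list ms'"
  have mono: "f i \<le> f j" if "i \<le> j" "j \<le> ?a + ?b" for i j
    using f that by (auto simp: joint_map_def intro: simplex_map_mono)
  have sub: "\<exists>t. (t \<in> joints as \<or> t \<in> (+) ?a ` joints bs) \<and> f t = j"
    if "j \<in> joints ms \<union> (+) ?m ` joints ms'" for j
  proof -
    have "joints (ms @ ms') \<subseteq> f ` joints (as @ bs)"
      using f by (simp add: joint_map_def)
    then have "j \<in> f ` joints (as @ bs)" using that unfolding joints_append[of ms] by blast
    then show ?thesis unfolding joints_append by blast
  qed
  show "joint_map as ms f"
    unfolding joint_map_def
  proof (intro conjI subsetI)
    fix j assume j: "j \<in> joints ms"
    obtain t where t: "t \<in> joints as \<or> t \<in> (+) ?a ` joints bs" "f t = j"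
      using sub j by blast
    show "j \<in> f ` joints as"
    proof (cases "t \<in> joints as")
      case False
      with t obtain u where u: "t = ?a + u" "u \<le> ?b" by (auto dest: joints_le)
      then have "?m \<le> j" using mono[of ?a t] fa t by simp
      then have "j = f ?a" using joints_le[OF j] fa by simp
      then show ?thesis by simp
    qed (use t in auto)
  qed (use f fa mono in \<open>auto simp: joint_map_def intro: simplex_mapI\<close>)
  show "joint_map bs ms' (\<lambda>i. f (?a + i) - ?m)"
    unfolding joint_map_def
  proof (intro conjI subsetI)
    fix j assume j: "j \<in> joints ms'"
    obtain t where t: "t \<in> joints as \<or> t \<in> (+) ?a ` joints bs" "f t = ?m + j"
      using sub j by blast
    show "j \<in> (\<lambda>i. f (?a + i) - ?m) ` joints bs"
    proof (cases "t \<in> (+) ?a ` joints bs")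
      case True
      then obtain u where "t = ?a + u" "u \<in> joints bs" by blast
      then show ?thesis using t by (intro image_eqI[of _ _ u]) auto
    next
      case False
      with t have "t \<le> ?a" by (auto dest: joints_le)
      then have "?m + j \<le> ?m" using mono[of t ?a] fa t by simp
      then show ?thesis using fa by (auto simp: image_iff intro!: bexI[of _ 0])
    qed
  qed (use f fa mono in \<open>auto simp: joint_map_def intro!: simplex_mapI diff_le_mono\<close>)
qed

text \<open>A necklace map covers the joints of its target by joints, so some joint lies over the
  wedge point, and the map can be cut there.\<close>

lemma joint_map_append_split:
  assumes f: "joint_map ns (ms @ ms') f"
  obtains as bs where "ns = as @ bs" "f (sum_list as) = sum_list ms" "joint_map as ms f"
    "joint_map bs ms' (\<lambda>i. f (sum_list as + i) - sum_list ms)"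
proof -
  have "sum_list ms \<in> joints (ms @ ms')" by (simp add: joints_append)
  then obtain t where "t \<in> joints ns" "f t = sum_list ms"
    using f by (auto simp: joint_map_def image_iff)
  then obtain as bs where ns: "ns = as @ bs" and fa: "f (sum_list as) = sum_list ms"
    using joints_split by metis
  show ?thesis
    using that[OF ns fa] joint_map_cut[of as bs ms ms' f] f fa unfolding ns by simp
qed

text \<open>The premise \<open>ge\<close> ensures that the truncated subtraction in the second map
  loses nothing.\<close>

lemma joint_map_append:
  assumes f: "joint_map ns ms f" and g: "joint_map ns' ms' (\<lambda>i. f (sum_list ns + i) - sum_list ms)"
    and ge: "\<And>i. i \<le> sum_list ns' \<Longrightarrow> sum_list ms \<le> f (sum_list ns + i)"
  shows "joint_map (ns @ ns') (ms @ ms') f"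
proof -
  let ?n = "sum_list ns" and ?m = "sum_list ms" and ?g = "\<lambda>i. f (sum_list ns + i) - sum_list ms"
  have fg: "f (?n + i) = ?m + ?g i" if "i \<le> sum_list ns'" for i using ge[OF that] by simp
  have gm: "?g i \<le> ?g j" if "i \<le> j" "j \<le> sum_list ns'" for i j
    using g that by (auto simp: joint_map_def dest: simplex_map_mono)
  have fm: "f i \<le> f j" if "i \<le> j" "j \<le> ?n" for i j
    using f that by (auto simp: joint_map_def dest: simplex_map_mono)
  have fn: "f ?n = ?m" "f 0 = 0" using f by (auto simp: joint_map_def)
  have end': "f (?n + sum_list ns') = ?m + sum_list ms'"
    using g fg[of "sum_list ns'"] by (auto simp: joint_map_def)
  have mono: "f i \<le> f j" if "i \<le> j" "j \<le> ?n + sum_list ns'" for i j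
  proof (cases "j \<le> ?n")
    case False
    define j' where "j' = j - ?n"
    have j: "j = ?n + j'" "j' \<le> sum_list ns'" using that False by (auto simp: j'_def)
    show ?thesis
    proof (cases "i \<le> ?n")
      case True
      then have "f i \<le> ?m" using fm[of i ?n] fn by simp
      then show ?thesis using ge[OF j(2)] j by simp
    next
      case False
      define i' where "i' = i - ?n"
      have "i = ?n + i'" using False by (simp add: i'_def)
      then show ?thesis using fg[of i'] fg[of j'] gm[of i' j'] j that by simp
    qed
  qed (use fm that in simp)
  have "j \<in> f ` joints (ns @ ns')" if mem: "j \<in> joints (ms @ ms')" for j
  proof (cases "j \<in> joints ms")
    case True
    then show ?thesis using f by (auto simp: joint_map_def joints_append)
  next
    case False
    then obtain j' where j: "j = ?m + j'" "j' \<in> joints ms'" using mem False by (auto simp: joints_append)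
    then obtain t where t: "t \<in> joints ns'" "?g t = j'"
      using g unfolding joint_map_def by blast
    then have "f (?n + t) = j" using fg[of t] joints_le[of t ns'] j by simp
    then show ?thesis using t by (auto simp: joints_append)
  qed
  then show ?thesis
    using mono fn end' by (auto simp: joint_map_def intro: simplex_mapI)
qed

lemma joint_map_comp:
  assumes "joint_map ns ms f" "joint_map ms ks g"
  shows "joint_map ns ks (\<lambda>i. g (f i))"
proof -
  have "joints ks \<subseteq> g ` joints ms" "joints ms \<subseteq> f ` joints ns"
    using assms by (auto simp: joint_map_def)
  then have "joints ks \<subseteq> (\<lambda>i. g (f i)) ` joints ns" by (force simp: image_iff)
  then show ?thesis
    using assms unfolding joint_map_def by (auto intro: simplex_map_comp)
qed

section \<open>The monoidal functor of a simplicial enriched category\<close>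

text \<open>The data of a diagram of enriched categories with object sets \<open>[n]\<close>: \<open>A n a b\<close> are the
  hom-objects, \<open>K\<close> the compositions, \<open>U\<close> the units, and \<open>M m n f\<close> the action of \<open>f : [m] \<rightarrow> [n]\<close>
  on hom-objects.\<close>

locale simplicial_wcat = monoidal_category W for W :: "('o, 'a, 'z) mcat_scheme" (structure) +
  fixes A :: "nat \<Rightarrow> nat \<Rightarrow> nat \<Rightarrow> 'o"
    and K :: "nat \<Rightarrow> nat \<Rightarrow> nat \<Rightarrow> nat \<Rightarrow> 'a"
    and U :: "nat \<Rightarrow> nat \<Rightarrow> 'a"
    and M :: "nat \<Rightarrow> nat \<Rightarrow> (nat \<Rightarrow> nat) \<Rightarrow> nat \<Rightarrow> nat \<Rightarrow> 'a"
  assumes A_Obj [simp]: "\<lbrakk>a \<le> n; b \<le> n\<rbrakk> \<Longrightarrow> A n a b \<in> Obj W"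
    and K_hom: "\<lbrakk>a \<le> n; b \<le> n; c \<le> n\<rbrakk> \<Longrightarrow> K n a b c \<in> hom W (A n a b \<otimes> A n b c) (A n a c)"
    and U_hom: "a \<le> n \<Longrightarrow> U n a \<in> hom W (munit W) (A n a a)"
    and M_hom: "\<lbrakk>simplex_map m n f; a \<le> m; b \<le> m\<rbrakk> \<Longrightarrow> M m n f a b \<in> hom W (A m a b) (A n (f a) (f b))"
    and K_assoc: "\<lbrakk>a \<le> n; b \<le> n; c \<le> n; d \<le> n\<rbrakk>
      \<Longrightarrow> K n a c d \<cdot> (K n a b c \<boxtimes> Idn W (A n c d))
        = K n a b d \<cdot> ((Idn W (A n a b) \<boxtimes> K n b c d) \<cdot> assoc W (A n a b) (A n b c) (A n c d))"
    and K_U_left: "\<lbrakk>a \<le> n; b \<le> n\<rbrakk> \<Longrightarrow> K n a a b \<cdot> (U n a \<boxtimes> Idn W (A n a b)) = lunit W (A n a b)"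
    and K_U_right: "\<lbrakk>a \<le> n; b \<le> n\<rbrakk> \<Longrightarrow> K n a b b \<cdot> (Idn W (A n a b) \<boxtimes> U n b) = runit W (A n a b)"
    and M_K: "\<lbrakk>simplex_map m n f; a \<le> m; b \<le> m; c \<le> m\<rbrakk>
      \<Longrightarrow> M m n f a c \<cdot> K m a b c = K n (f a) (f b) (f c) \<cdot> (M m n f a b \<boxtimes> M m n f b c)"
    and M_U: "\<lbrakk>simplex_map m n f; a \<le> m\<rbrakk> \<Longrightarrow> M m n f a a \<cdot> U m a = U n (f a)"
    and M_id: "\<lbrakk>a \<le> n; b \<le> n\<rbrakk> \<Longrightarrow> M n n (\<lambda>i. i) a b = Idn W (A n a b)"
    and M_comp: "\<lbrakk>simplex_map m n f; simplex_map n k g; a \<le> m; b \<le> m\<rbrakk>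
      \<Longrightarrow> M n k g (f a) (f b) \<cdot> M m n f a b = M m k (\<lambda>i. g (f i)) a b"
    and M_cong: "\<lbrakk>\<And>i. i \<le> m \<Longrightarrow> f i = g i; a \<le> m; b \<le> m\<rbrakk> \<Longrightarrow> M m n f a b = M m n g a b"
    and U_iso: "is_iso W (U 0 0)"
begin

lemma K_simps [simp]:
  assumes "a \<le> n" "b \<le> n" "c \<le> n"
  shows "K n a b c \<in> Arr W" "Dom W (K n a b c) = A n a b \<otimes> A n b c" "Cod W (K n a b c) = A n a c"
  using K_hom[OF assms] by (auto elim: homE)

lemma U_simps [simp]:
  assumes "a \<le> n"
  shows "U n a \<in> Arr W" "Dom W (U n a) = munit W" "Cod W (U n a) = A n a a"
  using U_hom[OF assms] by (auto elim: homE)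

lemma M_simps [simp]:
  assumes "simplex_map m n f" "a \<le> m" "b \<le> m"
  shows "M m n f a b \<in> Arr W" "Dom W (M m n f a b) = A m a b" "Cod W (M m n f a b) = A n (f a) (f b)"
  using M_hom[OF assms] by (auto elim: homE)

end

locale strict_simplicial_wcat = strict_monoidal S + simplicial_wcat S A K U M
  for S :: "('o, 'a, 'z) mcat_scheme" (structure) and A K U M
begin

lemma strict_K_assoc: "\<lbrakk>a \<le> n; b \<le> n; c \<le> n; d \<le> n\<rbrakk>
  \<Longrightarrow> K n a c d \<cdot> (K n a b c \<boxtimes> Idn S (A n c d)) = K n a b d \<cdot> (Idn S (A n a b) \<boxtimes> K n b c d)"
  by (simp add: K_assoc strict_assoc)

lemma strict_K_U_left: "\<lbrakk>a \<le> n; b \<le> n\<rbrakk> \<Longrightarrow> K n a a b \<cdot> (U n a \<boxtimes> Idn S (A n a b)) = Idn S (A n a b)"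
  by (simp add: K_U_left strict_lunit)

lemma strict_K_U_right: "\<lbrakk>a \<le> n; b \<le> n\<rbrakk> \<Longrightarrow> K n a b b \<cdot> (Idn S (A n a b) \<boxtimes> U n b) = Idn S (A n a b)"
  by (simp add: K_U_right strict_runit)

section \<open>Values on maps from a necklace into a single simplex\<close>

primrec beads :: "nat list \<Rightarrow> 'o" where
  "beads [] = munit S"
| "beads (n # ns) = A n 0 n \<otimes> beads ns"

lemma beads_Obj [simp]: "beads ns \<in> Obj S"
  by (induction ns) auto

lemma beads_append: "beads (ms @ ns) = beads ms \<otimes> beads ns"
  by (induction ms) (auto simp: strict_tobj_lunit strict_tobj_assoc)

text \<open>Here \<open>f\<close> need not preserve end points, so a chain may end in any hom-object
  \<open>A m (f 0) (f (sum_list ns))\<close>. The recursion needs this, as the rest of the map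
  starts at \<open>f n\<close>; later it yields the comparison \<open>psi\<close>.\<close>

primrec chain :: "nat list \<Rightarrow> nat \<Rightarrow> (nat \<Rightarrow> nat) \<Rightarrow> 'a" where
  "chain [] m f = U m (f 0)"
| "chain (n # ns) m f = K m (f 0) (f n) (f (n + sum_list ns))
     \<cdot> (M n m f 0 n \<boxtimes> chain ns m (\<lambda>i. f (n + i)))"

lemma chain_simps [simp]:
  assumes "simplex_map (sum_list ns) m f"
  shows "chain ns m f \<in> Arr S" "Dom S (chain ns m f) = beads ns"
    "Cod S (chain ns m f) = A m (f 0) (f (sum_list ns))"
  using assms
proof (induction ns arbitrary: f)
  case (Cons n ns)
  { case 1 then show ?case
      using Cons.IH[OF simplex_map_shift[of n]] simplex_map_prefix[OF 1, of n] by simp }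
  { case 2 then show ?case
      using Cons.IH[OF simplex_map_shift[of n]] simplex_map_prefix[OF 2, of n] by simp }
  { case 3 then show ?case
      using Cons.IH[OF simplex_map_shift[of n]] simplex_map_prefix[OF 3, of n] by simp }
qed auto

lemma chain_cong: "\<lbrakk>\<And>i. i \<le> sum_list ns \<Longrightarrow> f i = g i\<rbrakk> \<Longrightarrow> chain ns m f = chain ns m g"
proof (induction ns arbitrary: f g)
  case (Cons n ns)
  have "chain ns m (\<lambda>i. f (n + i)) = chain ns m (\<lambda>i. g (n + i))"
    using Cons.prems by (intro Cons.IH) auto
  moreover have "M n m f 0 n = M n m g 0 n" using Cons.prems by (intro M_cong) auto
  ultimately show ?case using Cons.prems by simp
qed auto

text \<open>Associativity of composition moves the cut across one bead; the empty left part is the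
  left unit law.\<close>

lemma chain_append:
  assumes "simplex_map (sum_list ns + sum_list ns') m f"
  shows "chain (ns @ ns') m f = K m (f 0) (f (sum_list ns)) (f (sum_list ns + sum_list ns'))
    \<cdot> (chain ns m f \<boxtimes> chain ns' m (\<lambda>i. f (sum_list ns + i)))"
  using assms
proof (induction ns arbitrary: f)
  case Nil
  then have f: "simplex_map (sum_list ns') m f" by simp
  let ?c = "chain ns' m f"
  have "K m (f 0) (f 0) (f (sum_list ns')) \<cdot> (U m (f 0) \<boxtimes> ?c)
      = K m (f 0) (f 0) (f (sum_list ns')) \<cdot> ((U m (f 0) \<boxtimes> Idn S (A m (f 0) (f (sum_list ns')))) \<cdot> (Idn S (munit S) \<boxtimes> ?c))"
    using f by simp
  also have "\<dots> = (K m (f 0) (f 0) (f (sum_list ns')) \<cdot> (U m (f 0) \<boxtimes> Idn S (A m (f 0) (f (sum_list ns'))))) \<cdot> (Idn S (munit S) \<boxtimes> ?c)"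
    using f by (subst comp_assoc_Arr) simp_all
  also have "\<dots> = ?c"
    using f by (simp add: strict_K_U_left tarr_lunit strict_tobj_lunit)
  finally show ?case by simp
next
  case (Cons n ns)
  let ?f = "\<lambda>i. f (n + i)"
  let ?s = "sum_list ns" and ?s' = "sum_list ns'"
  let ?a = "f 0" and ?b = "f n" and ?c = "f (n + ?s)" and ?d = "f (n + (?s + ?s'))"
  let ?x = "M n m f 0 n" and ?y = "chain ns m ?f" and ?z = "chain ns' m (\<lambda>i. f (n + (?s + i)))"
  have f: "simplex_map (n + (?s + ?s')) m f" using Cons.prems by (simp add: add.assoc)
  have f': "simplex_map (?s + ?s') m ?f" using simplex_map_shift[OF f] .
  have fs: "simplex_map ?s m ?f" using simplex_map_prefix[OF f'] by simp
  have fz: "simplex_map ?s' m (\<lambda>i. f (n + (?s + i)))" using simplex_map_shift[OF f'] .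
  have fn: "simplex_map n m f" using simplex_map_prefix[OF f] by simp
  have [simp]: "?a \<le> m" "?b \<le> m" "?c \<le> m" "?d \<le> m"
    using f by (auto intro: simplex_map_le)
  note [simp] = f fs fz fn
  have "chain ((n # ns) @ ns') m f = K m ?a ?b ?d \<cdot> (?x \<boxtimes> (K m ?b ?c ?d \<cdot> (?y \<boxtimes> ?z)))"
    using Cons.IH[OF f'] by (simp add: add.assoc)
  also have "\<dots> = (K m ?a ?b ?d \<cdot> (Idn S (A m ?a ?b) \<boxtimes> K m ?b ?c ?d)) \<cdot> (?x \<boxtimes> (?y \<boxtimes> ?z))"
    by simp
  also have "\<dots> = (K m ?a ?c ?d \<cdot> (K m ?a ?b ?c \<boxtimes> Idn S (A m ?c ?d))) \<cdot> ((?x \<boxtimes> ?y) \<boxtimes> ?z)"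
    by (subst strict_K_assoc[symmetric]) (simp_all add: tarr_assoc)
  also have "\<dots> = K m ?a ?c ?d \<cdot> ((K m ?a ?b ?c \<cdot> (?x \<boxtimes> ?y)) \<boxtimes> ?z)"
    by (simp add: strict_tobj_assoc)
  finally show ?case by (simp add: add.assoc)
qed

text \<open>The action of \<open>g\<close> is an enriched functor: it passes through each
  composition by \<open>M_K\<close>, through the final unit by \<open>M_U\<close>, and merges with
  the action on each bead by \<open>M_comp\<close>.\<close>

lemma chain_natural:
  assumes "simplex_map (sum_list ns) m f" "simplex_map m k g"
  shows "M m k g (f 0) (f (sum_list ns)) \<cdot> chain ns m f = chain ns k (\<lambda>i. g (f i))"
  using assms(1)
proof (induction ns arbitrary: f)
  case Nil
  then show ?case using assms(2) by (simp add: M_U)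
next
  case (Cons n ns)
  have [simp]: "simplex_map (n + sum_list ns) m f" "simplex_map m k g" "simplex_map n m f"
      "simplex_map (sum_list ns) m (\<lambda>i. f (n + i))"
    using Cons.prems assms simplex_map_prefix[of "n + sum_list ns" m f n]
      simplex_map_shift[of n "sum_list ns" m f] by auto
  let ?a = "f 0" and ?b = "f n" and ?c = "f (n + sum_list ns)"
  have [simp]: "?a \<le> m" "?b \<le> m" "?c \<le> m"
    using simplex_map_le[OF Cons.prems] by auto
  have [simp]: "g ?a \<le> k" "g ?b \<le> k" "g ?c \<le> k"
    by (auto intro: simplex_map_le[OF assms(2)])
  have "M m k g ?a ?c \<cdot> chain (n # ns) m f
     = (M m k g ?a ?c \<cdot> K m ?a ?b ?c) \<cdot> (M n m f 0 n \<boxtimes> chain ns m (\<lambda>i. f (n + i)))"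
    by simp
  also have "\<dots> = K k (g ?a) (g ?b) (g ?c) \<cdot> ((M m k g ?a ?b \<cdot> M n m f 0 n)
      \<boxtimes> (M m k g (f (n + 0)) ?c \<cdot> chain ns m (\<lambda>i. f (n + i))))"
    by (simp add: M_K)
  also have "\<dots> = chain (n # ns) k (\<lambda>i. g (f i))"
    by (subst Cons.IH) (simp_all add: M_comp)
  finally show ?case by simp
qed

text \<open>The chain closes with a composition with a unit, which the right unit law
  absorbs.\<close>

lemma chain_single:
  assumes f: "simplex_map n m f"
  shows "chain [n] m f = M n m f 0 n"
proof -
  have [simp]: "f 0 \<le> m" "f n \<le> m" using simplex_map_le[OF f] by auto
  let ?K = "K m (f 0) (f n) (f n)"
  have "?K \<cdot> (M n m f 0 n \<boxtimes> U m (f n))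
      = (?K \<cdot> (Idn S (A m (f 0) (f n)) \<boxtimes> U m (f n))) \<cdot> (M n m f 0 n \<boxtimes> Idn S (munit S))"
    using f by simp
  also have "\<dots> = M n m f 0 n" using f by (simp add: strict_K_U_right tarr_runit strict_tobj_runit)
  finally show ?thesis by simp
qed

text \<open>The value on the map that collapses the necklace \<open>ns\<close> to a point: compose
  inside stage 0 and return to the monoidal unit through the inverse of
  \<open>U 0 0\<close>.\<close>

definition degenerate :: "nat list \<Rightarrow> 'a" where
  "degenerate ns = inverse_arr S (U 0 0) \<cdot> chain ns 0 (\<lambda>_. 0)"

lemma const_simplex_map [simp]: "c \<le> n \<Longrightarrow> simplex_map m n (\<lambda>_. c)"
  by (rule simplex_mapI) auto

lemma degenerate_simps [simp]:
  "degenerate ns \<in> Arr S" "Dom S (degenerate ns) = beads ns" "Cod S (degenerate ns) = munit S"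
  using U_iso by (simp_all add: degenerate_def)

text \<open>A constant map factors through [0], and the action of
  \<open>[0] \<rightarrow> [m]\<close> carries \<open>U 0 0\<close> to \<open>U m a\<close>.\<close>

lemma chain_degenerate:
  assumes "\<And>i. i \<le> sum_list ns \<Longrightarrow> f i = a" "a \<le> m"
  shows "chain ns m f = U m a \<cdot> degenerate ns"
proof -
  have "U m a \<cdot> degenerate ns = M 0 m (\<lambda>_. a) 0 0 \<cdot> (U 0 0 \<cdot> degenerate ns)"
    using M_U[of 0 m "\<lambda>_. a" 0] assms(2) by (simp flip: comp_assoc_Arr)
  also have "\<dots> = M 0 m (\<lambda>_. a) 0 0 \<cdot> chain ns 0 (\<lambda>_. 0)"
    using U_iso assms(2) by (simp add: degenerate_def)
  also have "\<dots> = chain ns m (\<lambda>_. a)"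
    using chain_natural[of ns 0 "\<lambda>_. 0" m "\<lambda>_. a"] assms(2) by simp
  also have "\<dots> = chain ns m f" using assms(1) by (intro chain_cong) auto
  finally show ?thesis by simp
qed

text \<open>The chain of the collapsing part is a unit preceded by \<open>degenerate ns'\<close>,
  and the unit law removes the composition. The collapsing part thus survives as a separate tensor
  factor ending in the monoidal unit.\<close>

lemma chain_append_degenerate_right:
  assumes f: "simplex_map (sum_list ns + sum_list ns') m f"
    and c: "\<And>i. i \<le> sum_list ns' \<Longrightarrow> f (sum_list ns + i) = f (sum_list ns)"
  shows "chain (ns @ ns') m f = chain ns m f \<boxtimes> degenerate ns'"
proof -
  let ?a = "f 0" and ?b = "f (sum_list ns)"
  have [simp]: "simplex_map (sum_list ns) m f" "?a \<le> m" "?b \<le> m"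
    using f simplex_map_prefix by auto
  have "chain ns' m (\<lambda>i. f (sum_list ns + i)) = U m ?b \<cdot> degenerate ns'"
    by (rule chain_degenerate[OF c]) auto
  then have "chain (ns @ ns') m f = K m ?a ?b ?b \<cdot> (chain ns m f \<boxtimes> (U m ?b \<cdot> degenerate ns'))"
    using chain_append[OF f] c[of "sum_list ns'"] by simp
  also have "\<dots> = (K m ?a ?b ?b \<cdot> (Idn S (A m ?a ?b) \<boxtimes> U m ?b)) \<cdot> (chain ns m f \<boxtimes> degenerate ns')"
    by simp
  also have "\<dots> = chain ns m f \<boxtimes> degenerate ns'"
    by (subst strict_K_U_right) (simp_all add: strict_tobj_runit)
  finally show ?thesis .
qed

lemma chain_append_degenerate_left:
  assumes f: "simplex_map (sum_list ns + sum_list ns') m f"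
    and c: "\<And>i. i \<le> sum_list ns \<Longrightarrow> f i = f 0"
  shows "chain (ns @ ns') m f = degenerate ns \<boxtimes> chain ns' m (\<lambda>i. f (sum_list ns + i))"
proof -
  let ?a = "f 0" and ?b = "f (sum_list ns + sum_list ns')" and ?c = "chain ns' m (\<lambda>i. f (sum_list ns + i))"
  have [simp]: "simplex_map (sum_list ns') m (\<lambda>i. f (sum_list ns + i))" "?a \<le> m" "?b \<le> m" "f (sum_list ns) = f 0"
    using f simplex_map_shift[OF f] c[of "sum_list ns"] by auto
  have "chain ns m f = U m ?a \<cdot> degenerate ns" by (rule chain_degenerate[OF c]) auto
  then have "chain (ns @ ns') m f = K m ?a ?a ?b \<cdot> ((U m ?a \<cdot> degenerate ns) \<boxtimes> ?c)"
    using chain_append[OF f] by simp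
  also have "\<dots> = (K m ?a ?a ?b \<cdot> (U m ?a \<boxtimes> Idn S (A m ?a ?b))) \<cdot> (degenerate ns \<boxtimes> ?c)"
    by simp
  also have "\<dots> = degenerate ns \<boxtimes> ?c"
    by (subst strict_K_U_left) (simp_all add: strict_tobj_lunit)
  finally show ?thesis .
qed

lemma degenerate_append: "degenerate (ns @ ns') = degenerate ns \<boxtimes> degenerate ns'"
proof -
  \<comment> \<open>The constant map into [0] is treated as a map whose second part
    collapses.\<close>
  have "degenerate (ns @ ns') = inverse_arr S (U 0 0) \<cdot> (chain ns 0 (\<lambda>_. 0) \<boxtimes> degenerate ns')"
    unfolding degenerate_def[of "ns @ ns'"] by (subst chain_append_degenerate_right) auto
  also have "\<dots> = (inverse_arr S (U 0 0) \<boxtimes> Idn S (munit S)) \<cdot> (chain ns 0 (\<lambda>_. 0) \<boxtimes> degenerate ns')"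
    using U_iso by (simp add: tarr_runit)
  also have "\<dots> = degenerate ns \<boxtimes> degenerate ns'"
    using U_iso by (simp add: degenerate_def)
  finally show ?thesis .
qed

text \<open>The list \<open>ns\<close> is cut at the first joint sent to the first joint of \<open>m # ms\<close>; by
  \<open>nec_map_cut\<close>, any other such joint gives the same result.\<close>

primrec nec_map :: "nat list \<Rightarrow> nat list \<Rightarrow> (nat \<Rightarrow> nat) \<Rightarrow> 'a" where
  "nec_map ns [] f = degenerate ns"
| "nec_map ns (m # ms) f =
    (let r = LEAST r. r \<le> length ns \<and> f (sum_list (take r ns)) = m in
     chain (take r ns) m f \<boxtimes> nec_map (drop r ns) ms (\<lambda>i. f (sum_list (take r ns) + i) - m))"

text \<open>The minimum in \<open>nec_map\<close> inspects \<open>f\<close> only at joints of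
  \<open>ns\<close>, and chains use only values up to \<open>sum_list ns\<close>.\<close>

lemma nec_map_cong: "\<lbrakk>\<And>i. i \<le> sum_list ns \<Longrightarrow> f i = g i\<rbrakk> \<Longrightarrow> nec_map ns ms f = nec_map ns ms g"
proof (induction ms arbitrary: ns f g)
  case (Cons m ms)
  have le: "sum_list (take r ns) \<le> sum_list ns" for r
    by (metis append_take_drop_id le_add1 sum_list_append)
  have eq: "(LEAST r. r \<le> length ns \<and> f (sum_list (take r ns)) = m)
      = (LEAST r. r \<le> length ns \<and> g (sum_list (take r ns)) = m)" (is "_ = ?r")
    by (simp only: Cons.prems[OF le])
  have "chain (take ?r ns) m f = chain (take ?r ns) m g"
    using Cons.prems le by (intro chain_cong) (metis Cons.prems le order_trans)
  moreover have "nec_map (drop ?r ns) ms (\<lambda>i. f (sum_list (take ?r ns) + i) - m)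
      = nec_map (drop ?r ns) ms (\<lambda>i. g (sum_list (take ?r ns) + i) - m)"
  proof (rule Cons.IH)
    fix i assume "i \<le> sum_list (drop ?r ns)"
    moreover have "sum_list (take ?r ns) + sum_list (drop ?r ns) = sum_list ns"
      by (simp flip: sum_list_append)
    ultimately have "f (sum_list (take ?r ns) + i) = g (sum_list (take ?r ns) + i)"
      by (intro Cons.prems) simp
    then show "f (sum_list (take ?r ns) + i) - m = g (sum_list (take ?r ns) + i) - m"
      by simp
  qed
  ultimately show ?case using eq by (simp add: Let_def)
qed simp

text \<open>Presents the least cut as a concatenation and keeps its minimality, against which other
  cuts are compared below.\<close>

lemma nec_map_least_cut:
  assumes f: "joint_map ns (m # ms) f"
  obtains as bs where "ns = as @ bs" "f (sum_list as) = m"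
    "\<And>r. r < length as \<Longrightarrow> f (sum_list (take r as)) \<noteq> m"
    "nec_map ns (m # ms) f = chain as m f \<boxtimes> nec_map bs ms (\<lambda>i. f (sum_list as + i) - m)"
proof -
  let ?P = "\<lambda>r. r \<le> length ns \<and> f (sum_list (take r ns)) = m"
  obtain as bs where "ns = as @ bs" "f (sum_list as) = m"
    using joint_map_append_split[of ns "[m]" ms f thesis] f by auto
  then have "?P (length as)" by simp
  define r where "r = (LEAST r. ?P r)"
  have r: "?P r" unfolding r_def using \<open>?P (length as)\<close> by (rule LeastI)
  show ?thesis
  proof (rule that[of "take r ns" "drop r ns"])
    fix q assume q: "q < length (take r ns)"
    then show "f (sum_list (take q (take r ns))) \<noteq> m"
      using not_less_Least[of q ?P] r by (auto simp: r_def[symmetric])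
  qed (use r in \<open>simp_all add: r_def[symmetric] Let_def\<close>)
qed

lemma simplex_map_cut:
  "\<lbrakk>joint_map (as @ bs) ms f; f (sum_list as) = m\<rbrakk> \<Longrightarrow> simplex_map (sum_list as) m f"
  by (rule simplex_map_restrict) (auto simp: joint_map_def)

lemma nec_map_simps [simp]:
  assumes "joint_map ns ms f"
  shows "nec_map ns ms f \<in> Arr S" "Dom S (nec_map ns ms f) = beads ns"
    "Cod S (nec_map ns ms f) = beads ms"
proof -
  have "nec_map ns ms f \<in> Arr S \<and> Dom S (nec_map ns ms f) = beads ns
    \<and> Cod S (nec_map ns ms f) = beads ms"
    using assms
  proof (induction ms arbitrary: ns f)
    case (Cons m ms)
    obtain as bs where ns: "ns = as @ bs" and fa: "f (sum_list as) = m"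
      and eq: "nec_map ns (m # ms) f = chain as m f \<boxtimes> nec_map bs ms (\<lambda>i. f (sum_list as + i) - m)"
      using nec_map_least_cut[OF Cons.prems] by metis
    have "simplex_map (sum_list as) m f" using Cons.prems fa unfolding ns by (rule simplex_map_cut)
    moreover have "joint_map bs ms (\<lambda>i. f (sum_list as + i) - m)"
      using joint_map_cut(2)[of as bs "[m]" ms f] Cons.prems fa ns by simp
    moreover have "f 0 = 0" using Cons.prems by (simp add: joint_map_def)
    ultimately show ?case using eq ns fa Cons.IH by (simp add: beads_append)
  qed simp
  then show "nec_map ns ms f \<in> Arr S" "Dom S (nec_map ns ms f) = beads ns"
    "Cod S (nec_map ns ms f) = beads ms" by auto
qed

text \<open>The first gap of the target is positive while \<open>f\<close> vanishes on
  \<open>xs\<close>, so the least cut lies beyond \<open>xs\<close> and is the least cut of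
  \<open>ns\<close> shifted by \<open>xs\<close>. For an empty target everything collapses.\<close>

lemma nec_map_append_degenerate:
  assumes f: "joint_map (xs @ ns) ms f" and "\<And>i. i \<le> sum_list xs \<Longrightarrow> f i = 0" and "0 \<notin> set ms"
  shows "nec_map (xs @ ns) ms f = degenerate xs \<boxtimes> nec_map ns ms (\<lambda>i. f (sum_list xs + i))"
proof (cases ms)
  case Nil
  then show ?thesis by (simp add: degenerate_append)
next
  case (Cons m ms')
  let ?g = "\<lambda>i. f (sum_list xs + i)"
  have m: "m > 0" using assms(3) Cons by simp
  have fxs: "f (sum_list xs) = 0" using assms(2) by simp
  have g: "joint_map ns ms ?g"
    using joint_map_cut(2)[of xs ns "[]" ms f] f fxs by simp
  obtain as bs where ns: "ns = as @ bs" and fa: "f (sum_list xs + sum_list as) = m"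
    and least: "\<And>r. r < length as \<Longrightarrow> f (sum_list xs + sum_list (take r as)) \<noteq> m"
    and eq: "nec_map ns ms ?g = chain as m ?g \<boxtimes> nec_map bs ms' (\<lambda>i. f (sum_list xs + (sum_list as + i)) - m)"
    using nec_map_least_cut[of ns m ms' ?g] g Cons by metis
  have "(LEAST r. r \<le> length (xs @ ns) \<and> f (sum_list (take r (xs @ ns))) = m) = length (xs @ as)"
  proof (rule Least_equality)
    show "length (xs @ as) \<le> length (xs @ ns) \<and> f (sum_list (take (length (xs @ as)) (xs @ ns))) = m"
      using fa ns by simp
    fix q assume q: "q \<le> length (xs @ ns) \<and> f (sum_list (take q (xs @ ns))) = m"
    show "length (xs @ as) \<le> q"
    proof (rule ccontr)
      assume less: "\<not> length (xs @ as) \<le> q"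
      show False
      proof (cases "q \<le> length xs")
        case True
        have "sum_list (take q xs) \<le> sum_list xs"
          by (metis append_take_drop_id le_add1 sum_list_append)
        then show False using assms(2)[of "sum_list (take q xs)"] q m True by simp
      next
        case False
        then show False using least[of "q - length xs"] less q ns by simp
      qed
    qed
  qed
  then have "nec_map (xs @ ns) ms f = chain (xs @ as) m f
      \<boxtimes> nec_map bs ms' (\<lambda>i. f (sum_list xs + sum_list as + i) - m)"
    using Cons ns by (simp add: Let_def)
  also have "chain (xs @ as) m f = degenerate xs \<boxtimes> chain as m ?g"
  proof (rule chain_append_degenerate_left)
    show "simplex_map (sum_list xs + sum_list as) m f"
      using simplex_map_cut[of "xs @ as" bs ms f m] f ns fa by simp
    show "f i = f 0" if "i \<le> sum_list xs" for i using that assms(2)[of i] assms(2)[of 0] by simp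
  qed
  also have "(degenerate xs \<boxtimes> chain as m ?g)
      \<boxtimes> nec_map bs ms' (\<lambda>i. f (sum_list xs + sum_list as + i) - m)
     = degenerate xs \<boxtimes> nec_map ns ms ?g"
  proof -
    have "joint_map bs ms' (\<lambda>i. ?g (sum_list as + i) - m)"
      using joint_map_cut(2)[of as bs "[m]" ms' ?g] g ns Cons fa by simp
    moreover have "simplex_map (sum_list as) m ?g"
      using simplex_map_cut[of as bs ms ?g m] g ns fa by simp
    ultimately show ?thesis by (simp add: eq tarr_assoc add.assoc)
  qed
  finally show ?thesis .
qed

text \<open>Between the least cut and the given one lies a piece \<open>xs\<close> on which
  \<open>f\<close> is constantly \<open>m\<close>. It contributes the same factor
  \<open>degenerate xs\<close> whether it closes the left part or opens the right part.\<close>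

lemma nec_map_cut:
  assumes f: "joint_map (as @ bs) (m # ms) f" and fa: "f (sum_list as) = m" and "0 \<notin> set ms"
  shows "nec_map (as @ bs) (m # ms) f = chain as m f \<boxtimes> nec_map bs ms (\<lambda>i. f (sum_list as + i) - m)"
proof -
  obtain as' bs' where ns: "as @ bs = as' @ bs'" and fa': "f (sum_list as') = m"
    and least: "\<And>r. r < length as' \<Longrightarrow> f (sum_list (take r as')) \<noteq> m"
    and eq: "nec_map (as @ bs) (m # ms) f = chain as' m f \<boxtimes> nec_map bs' ms (\<lambda>i. f (sum_list as' + i) - m)"
    using nec_map_least_cut[OF f] by metis
  have "\<not> length as < length as'"
  proof
    assume less: "length as < length as'"
    then have "take (length as) as' = as"
      using ns by (metis append_eq_append_conv_if less_imp_le_nat)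
    then show False using least[OF less] fa by simp
  qed
  then obtain xs where as: "as = as' @ xs" and bs': "bs' = xs @ bs"
    using ns by (auto simp: append_eq_append_conv2)
  have sm: "simplex_map (sum_list as) m f" using simplex_map_cut[OF f fa] .
  have const: "f (sum_list as' + i) = m" if "i \<le> sum_list xs" for i
    using simplex_map_mono[OF sm, of "sum_list as'" "sum_list as' + i"]
      simplex_map_le[OF sm, of "sum_list as' + i"] that fa fa' as by simp
  have g: "joint_map (xs @ bs) ms (\<lambda>i. f (sum_list as' + i) - m)"
    using joint_map_cut(2)[of as' bs' "[m]" ms f] f fa' ns bs' by simp
  have "nec_map bs' ms (\<lambda>i. f (sum_list as' + i) - m)
      = degenerate xs \<boxtimes> nec_map bs ms (\<lambda>i. f (sum_list as' + (sum_list xs + i)) - m)"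
    unfolding bs' using const assms(3) by (subst nec_map_append_degenerate[OF g]) simp_all
  moreover have "chain as m f = chain as' m f \<boxtimes> degenerate xs"
    unfolding as using sm const fa' as by (intro chain_append_degenerate_right) simp_all
  moreover have "joint_map bs ms (\<lambda>i. f (sum_list as' + (sum_list xs + i)) - m)"
    using joint_map_cut(2)[of as bs "[m]" ms f] f fa as by (simp add: add.assoc)
  moreover have "simplex_map (sum_list as') m f" using simplex_map_prefix[OF sm] as by simp
  ultimately show ?thesis using eq as by (simp add: tarr_assoc add.assoc)
qed

text \<open>Compatibility with wedges. By \<open>nec_map_cut\<close> the cuts over the beads of
  \<open>ms\<close> may be taken inside \<open>ns\<close>. When none are left, the remaining part of
  \<open>ns\<close> collapses and \<open>nec_map_append_degenerate\<close> applies.\<close>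

lemma nec_map_append:
  assumes "joint_map ns ms f" "joint_map ns' ms' (\<lambda>i. f (sum_list ns + i) - sum_list ms)"
    and "\<And>i. i \<le> sum_list ns' \<Longrightarrow> sum_list ms \<le> f (sum_list ns + i)" and "0 \<notin> set ms" "0 \<notin> set ms'"
  shows "nec_map (ns @ ns') (ms @ ms') f
    = nec_map ns ms f \<boxtimes> nec_map ns' ms' (\<lambda>i. f (sum_list ns + i) - sum_list ms)"
  using assms(1-4)
proof (induction ms arbitrary: ns f)
  case Nil
  then have "joint_map (ns @ ns') ([] @ ms') f" by (intro joint_map_append)
  then show ?case
    using Nil assms(5) by (auto simp: joint_map_Nil nec_map_append_degenerate)
next
  case (Cons m ms)
  let ?h = "\<lambda>i. f (sum_list ns + i) - sum_list (m # ms)"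
  have f: "joint_map (ns @ ns') ((m # ms) @ ms') f" using Cons.prems by (intro joint_map_append)
  obtain as bs where ns: "ns = as @ bs" and fa: "f (sum_list as) = m"
    and as: "joint_map as [m] f" and bs: "joint_map bs ms (\<lambda>i. f (sum_list as + i) - m)" (is "joint_map bs ms ?g")
    using joint_map_append_split[of ns "[m]" ms f] Cons.prems(1) by auto
  have h: "(\<lambda>i. ?g (sum_list bs + i) - sum_list ms) = ?h"
    using ns by (auto simp: add.assoc)
  have ge: "m + sum_list ms \<le> f (sum_list as + (sum_list bs + i))" if "i \<le> sum_list ns'" for i
    using Cons.prems(3)[OF that] ns by (simp add: add.assoc)
  have "nec_map (ns @ ns') ((m # ms) @ ms') f = chain as m f \<boxtimes> nec_map (bs @ ns') (ms @ ms') ?g"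
    using nec_map_cut[of as "bs @ ns'" m "ms @ ms'" f] f fa ns Cons.prems(4) assms(5) by simp
  also have "nec_map (bs @ ns') (ms @ ms') ?g = nec_map bs ms ?g \<boxtimes> nec_map ns' ms' ?h"
    using Cons.IH[of bs ?g] bs Cons.prems h ge by fastforce
  also have "chain as m f \<boxtimes> (nec_map bs ms ?g \<boxtimes> nec_map ns' ms' ?h)
     = (chain as m f \<boxtimes> nec_map bs ms ?g) \<boxtimes> nec_map ns' ms' ?h"
    using as bs Cons.prems(2) by (simp add: tarr_assoc joint_map_simplex_map[of as "[m]" f, simplified])
  also have "chain as m f \<boxtimes> nec_map bs ms ?g = nec_map ns (m # ms) f"
    using nec_map_cut[of as bs m ms f] Cons.prems ns fa by simp
  finally show ?case .
qed

lemma nec_map_id: "0 \<notin> set ns \<Longrightarrow> nec_map ns ns (\<lambda>i. i) = Idn S (beads ns)"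
proof (induction ns)
  case Nil
  then show ?case using U_iso by (simp add: degenerate_def)
next
  case (Cons n ns)
  have "nec_map ([n] @ ns) (n # ns) (\<lambda>i. i) = chain [n] n (\<lambda>i. i) \<boxtimes> nec_map ns ns (\<lambda>i. n + i - n)"
    using nec_map_cut[of "[n]" ns n ns "\<lambda>i. i"] joint_map_id[of "n # ns"] Cons.prems by simp
  then show ?case using Cons by (simp add: M_id strict_K_U_right)
qed

text \<open>Functoriality for composites ending in a single simplex. The source is cut over the
  first bead of \<open>ms\<close>: on the left part \<open>chain_natural\<close> applies, on the
  right part the induction hypothesis, and \<open>chain_append\<close> joins the results.\<close>

lemma chain_nec_map:
  assumes "joint_map ns ms f" "simplex_map (sum_list ms) k g" "0 \<notin> set ms"
  shows "chain ms k g \<cdot> nec_map ns ms f = chain ns k (\<lambda>i. g (f i))"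
  using assms
proof (induction ms arbitrary: ns f g)
  case Nil
  then have z: "f i = 0" if "i \<le> sum_list ns" for i using that by (simp add: joint_map_Nil)
  have "chain ns k (\<lambda>i. g (f i)) = U k (g 0) \<cdot> degenerate ns"
    using Nil z by (intro chain_degenerate) simp_all
  then show ?case by simp
next
  case (Cons m ms)
  obtain as bs where ns: "ns = as @ bs" and fa: "f (sum_list as) = m"
    and as: "joint_map as [m] f" and bs: "joint_map bs ms (\<lambda>i. f (sum_list as + i) - m)" (is "joint_map bs ms ?f")
    using joint_map_append_split[of ns "[m]" ms f] Cons.prems(1) by auto
  have f0: "f 0 = 0" and fn: "f (sum_list as + sum_list bs) = m + sum_list ms"
    using Cons.prems(1) ns by (simp_all add: joint_map_def)
  have f: "simplex_map (sum_list as + sum_list bs) (m + sum_list ms) f"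
    using Cons.prems(1) ns by (simp add: joint_map_def)
  have ge: "m \<le> f (sum_list as + i)" if "i \<le> sum_list bs" for i
    using simplex_map_mono[OF f, of "sum_list as" "sum_list as + i"] fa that by simp
  have g: "simplex_map (m + sum_list ms) k g" using Cons.prems(2) by simp
  have gm: "simplex_map m k g" using simplex_map_prefix[OF g] by simp
  have sas: "simplex_map (sum_list as) m f" using as by (simp add: joint_map_def)
  have gs: "simplex_map (sum_list ms) k (\<lambda>i. g (m + i))" using simplex_map_shift[OF g] .
  have [simp]: "g 0 \<le> k" "g m \<le> k" "g (m + sum_list ms) \<le> k" using simplex_map_le[OF g] by auto
  let ?K = "K k (g 0) (g m) (g (m + sum_list ms))"
  have "chain (m # ms) k g \<cdot> nec_map ns (m # ms) f
      = ?K \<cdot> ((M m k g 0 m \<cdot> chain as m f) \<boxtimes> (chain ms k (\<lambda>i. g (m + i)) \<cdot> nec_map bs ms ?f))"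
    using nec_map_cut[of as bs m ms f] Cons.prems ns fa bs gm gs sas f0 by simp
  also have "M m k g 0 m \<cdot> chain as m f = chain as k (\<lambda>i. g (f i))"
    using chain_natural[OF sas gm] f0 fa by simp
  also have "chain ms k (\<lambda>i. g (m + i)) \<cdot> nec_map bs ms ?f = chain bs k (\<lambda>i. g (m + ?f i))"
    using Cons.IH[OF bs gs] Cons.prems by simp
  also have "\<dots> = chain bs k (\<lambda>i. g (f (sum_list as + i)))"
    using ge by (intro chain_cong) simp
  also have "?K \<cdot> (chain as k (\<lambda>i. g (f i)) \<boxtimes> chain bs k (\<lambda>i. g (f (sum_list as + i))))
      = chain ns k (\<lambda>i. g (f i))"
    using chain_append[of as bs k "\<lambda>i. g (f i)"] simplex_map_comp[OF f g] ns f0 fa fn by simp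
  finally show ?case .
qed

text \<open>Cutting \<open>ms\<close> over the first bead of the target, and \<open>ns\<close> over
  that cut, splits both maps compatibly. The left factors compose by \<open>chain_nec_map\<close>,
  the right ones by induction.\<close>

lemma nec_map_comp:
  assumes "joint_map ns ms f" "joint_map ms ks g" "0 \<notin> set ms" "0 \<notin> set ks"
  shows "nec_map ms ks g \<cdot> nec_map ns ms f = nec_map ns ks (\<lambda>i. g (f i))"
  using assms
proof (induction ks arbitrary: ns ms f g)
  case Nil
  then have g: "g i = 0" if "i \<le> sum_list ms" for i using that by (simp add: joint_map_Nil)
  \<comment> \<open>\<open>degenerate\<close> is a chain in stage 0 followed by a fixed isomorphism,
    so the empty target is covered by \<open>chain_nec_map\<close>, with \<open>g\<close> read as a
    map into [0].\<close>
  have "chain ms 0 g = chain ms 0 (\<lambda>_. 0)" using g by (intro chain_cong) simp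
  moreover have "chain ms 0 g \<cdot> nec_map ns ms f = chain ns 0 (\<lambda>i. g (f i))"
    using Nil by (intro chain_nec_map) (auto simp: joint_map_def)
  moreover have "chain ns 0 (\<lambda>i. g (f i)) = chain ns 0 (\<lambda>_. 0)"
    using Nil.prems(1) g by (intro chain_cong) (auto simp: joint_map_def)
  ultimately show ?case using Nil U_iso by (simp add: degenerate_def)
next
  case (Cons k ks)
  obtain as bs where ms: "ms = as @ bs" and ga: "g (sum_list as) = k"
    and as: "joint_map as [k] g" and bs: "joint_map bs ks (\<lambda>i. g (sum_list as + i) - k)" (is "joint_map bs ks ?g")
    using joint_map_append_split[of ms "[k]" ks g] Cons.prems(2) by auto
  obtain cs ds where ns: "ns = cs @ ds" and fc: "f (sum_list cs) = sum_list as"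
    and cs: "joint_map cs as f" and ds: "joint_map ds bs (\<lambda>i. f (sum_list cs + i) - sum_list as)" (is "joint_map ds bs ?f")
    using joint_map_append_split[of ns as bs f] Cons.prems(1) ms by blast
  have f: "simplex_map (sum_list cs + sum_list ds) (sum_list as + sum_list bs) f"
    using Cons.prems(1) ns ms by (simp add: joint_map_def)
  have ge: "sum_list as \<le> f (sum_list cs + i)" if "i \<le> sum_list ds" for i
    using simplex_map_mono[OF f, of "sum_list cs" "sum_list cs + i"] fc that by simp
  have nz: "0 \<notin> set as" "0 \<notin> set bs" "0 \<notin> set ks" using Cons.prems ms by auto
  have sg: "simplex_map (sum_list as) k g" "g 0 = 0" using as by (simp_all add: joint_map_def)
  have gf: "joint_map (cs @ ds) (k # ks) (\<lambda>i. g (f i))"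
    using joint_map_comp[OF Cons.prems(1,2)] ns by simp
  have "nec_map ms (k # ks) g \<cdot> nec_map ns ms f
      = (chain as k g \<boxtimes> nec_map bs ks ?g) \<cdot> (nec_map cs as f \<boxtimes> nec_map ds bs ?f)"
    using nec_map_cut[of as bs k ks g] nec_map_append[of cs as f ds bs] Cons.prems ms ns ga cs ds ge nz by simp
  also have "\<dots> = (chain as k g \<cdot> nec_map cs as f) \<boxtimes> (nec_map bs ks ?g \<cdot> nec_map ds bs ?f)"
    using bs cs ds sg by simp
  also have "chain as k g \<cdot> nec_map cs as f = chain cs k (\<lambda>i. g (f i))"
    using cs sg nz by (intro chain_nec_map)
  also have "nec_map bs ks ?g \<cdot> nec_map ds bs ?f = nec_map ds ks (\<lambda>i. ?g (?f i))"
    using Cons.IH ds bs nz by blast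
  also have "\<dots> = nec_map ds ks (\<lambda>i. g (f (sum_list cs + i)) - k)"
    using ge by (intro nec_map_cong) simp
  also have "chain cs k (\<lambda>i. g (f i)) \<boxtimes> \<dots> = nec_map ns (k # ks) (\<lambda>i. g (f i))"
    using nec_map_cut[OF gf] fc ga nz ns by simp
  finally show ?case .
qed

end

section \<open>Necklaces as lists of gaps\<close>

text \<open>With positive gaps the first gap is the least nonzero joint; the other joints, shifted
  down by it, determine the rest.\<close>

lemma joints_inject:
  "\<lbrakk>joints ms = joints ns; 0 \<notin> set ms; 0 \<notin> set ns\<rbrakk> \<Longrightarrow> ms = ns"
proof (induction ms arbitrary: ns)
  case Nil
  show ?case
  proof (cases ns)
    case (Cons n ns')
    have "n \<in> joints (n # ns')" by (auto intro: image_eqI[of _ _ 0])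
    then have "n \<in> joints []" using Nil.prems(1) Cons by metis
    then show ?thesis using Nil.prems(3) Cons by simp
  qed simp
next
  case (Cons m ms)
  show ?case
  proof (cases ns)
    case Nil
    have "m \<in> joints (m # ms)" by (auto intro: image_eqI[of _ _ 0])
    then have "m \<in> joints []" using Cons.prems(1) Nil by metis
    then show ?thesis using Cons.prems(2) by simp
  next
    case (Cons n ns')
    have le: "a \<le> b" if "joints (a # as) = joints (b # bs)" "b \<noteq> 0" for a b :: nat and as bs
    proof -
      have "b \<in> joints (b # bs)" by (auto intro: image_eqI[of _ _ 0])
      then have "b \<in> joints (a # as)" using that by blast
      then show ?thesis using that(2) by auto
    qed
    have mn: "m = n"
      using le[of m ms n ns'] le[of n ns' m ms] Cons.prems Cons by auto
    have "(+) m ` joints ms = joints (m # ms) - {0}" "(+) n ` joints ns' = joints (n # ns') - {0}"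
      using Cons.prems(2,3) Cons by auto
    then have "(+) m ` joints ms = (+) m ` joints ns'"
      by (metis Cons.prems(1) Cons mn)
    then have "joints ms = joints ns'" by (simp add: inj_image_eq_iff)
    then show ?thesis using Cons.IH[of ns'] Cons.prems Cons mn by simp
  qed
qed

text \<open>Strong induction on \<open>p\<close>: the least positive element of \<open>T\<close> is
  the first gap, and the rest of \<open>T\<close> is shifted down by it.\<close>

lemma joints_surj:
  "\<lbrakk>{0, p} \<subseteq> T; T \<subseteq> {0..p}\<rbrakk> \<Longrightarrow> \<exists>ns. 0 \<notin> set ns \<and> joints ns = T \<and> sum_list ns = p"
proof (induction p arbitrary: T rule: less_induct)
  case (less p)
  show ?case
  proof (cases "p = 0")
    case True
    then show ?thesis using less.prems by (intro exI[of _ "[]"]) auto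
  next
    case False
    define t where "t = Min (T - {0})"
    have fin: "finite (T - {0})" using less.prems by (auto intro: finite_subset)
    have "p \<in> T - {0}" using less.prems False by simp
    then have "T - {0} \<noteq> {}" by blast
    then have t: "t \<in> T - {0}" unfolding t_def by (rule Min_in[OF fin])
    have t_le: "t \<le> u" if "u \<in> T - {0}" for u
      unfolding t_def using that by (rule Min_le[OF fin])
    have tp: "t \<le> p" using t less.prems by auto
    have "\<exists>ns. 0 \<notin> set ns \<and> joints ns = {k. t + k \<in> T} \<and> sum_list ns = p - t"
    proof (rule less.IH)
      show "p - t < p" using t tp by auto
      show "{0, p - t} \<subseteq> {k. t + k \<in> T}" using t tp less.prems by simp
      show "{k. t + k \<in> T} \<subseteq> {0..p - t}" using less.prems by (auto simp: subset_iff)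
    qed
    then obtain ns where ns: "0 \<notin> set ns" "joints ns = {k. t + k \<in> T}" "sum_list ns = p - t" by blast
    have "joints (t # ns) = T"
    proof (intro equalityI subsetI)
      fix u assume u: "u \<in> T"
      show "u \<in> joints (t # ns)"
      proof (cases "u = 0")
        case False
        then have tu: "t \<le> u" using t_le u by simp
        then have "u - t \<in> joints ns" using u ns(2) by simp
        then show ?thesis using tu by (auto intro!: image_eqI[of _ _ "u - t"])
      qed simp
    next
      fix u assume "u \<in> joints (t # ns)"
      then show "u \<in> T" using ns(2) less.prems(1) by auto
    qed
    then show ?thesis using ns t tp by (intro exI[of _ "t # ns"]) auto
  qed
qed

text \<open>Recursion over beads needs a list in place of the joint set. Positivity of the gaps
  makes the chosen list unique.\<close>

definition gaps :: "necklace \<Rightarrow> nat list" where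
  "gaps X = (SOME ns. 0 \<notin> set ns \<and> joints ns = fst X \<and> sum_list ns = snd X)"

lemma gaps_eqI: "\<lbrakk>0 \<notin> set ns; joints ns = fst X; sum_list ns = snd X\<rbrakk> \<Longrightarrow> gaps X = ns"
  unfolding gaps_def by (rule some_equality) (auto intro: joints_inject)

lemma Obj_nec: "Obj nec = {(T, p). {0, p} \<subseteq> T \<and> T \<subseteq> {0..p}}"
  by (simp add: nec_def nec_cat_def)

lemma gaps:
  assumes "X \<in> Obj nec"
  shows "0 \<notin> set (gaps X)" "joints (gaps X) = fst X" "sum_list (gaps X) = snd X"
proof -
  obtain ns where "0 \<notin> set ns \<and> joints ns = fst X \<and> sum_list ns = snd X"
    using assms joints_surj[of "snd X" "fst X"] by (auto simp: Obj_nec)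
  then have "0 \<notin> set (gaps X) \<and> joints (gaps X) = fst X \<and> sum_list (gaps X) = snd X"
    unfolding gaps_def by (rule someI)
  then show "0 \<notin> set (gaps X)" "joints (gaps X) = fst X" "sum_list (gaps X) = snd X" by auto
qed

lemma simplex_Obj [simp]: "simplex n \<in> Obj nec"
  by (auto simp: Obj_nec simplex_def)

lemma wedge_Obj [simp]: "\<lbrakk>X \<in> Obj nec; Y \<in> Obj nec\<rbrakk> \<Longrightarrow> wedge X Y \<in> Obj nec"
  by (fastforce simp: Obj_nec wedge_def split: prod.splits)

text \<open>The 0-simplex has no beads, so the functor built below sends it to the unit object, not
  to the endomorphism object of stage 0.\<close>

lemma gaps_simplex: "gaps (simplex n) = (if n = 0 then [] else [n])"
  by (rule gaps_eqI) (auto simp: simplex_def)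

lemma sum_gaps_simplex [simp]: "sum_list (gaps (simplex n)) = n"
  by (simp add: gaps_simplex)

lemma snd_simplex [simp]: "snd (simplex n) = n"
  by (simp add: simplex_def)

lemma snd_wedge [simp]: "snd (wedge X Y) = snd X + snd Y"
  by (simp add: wedge_def split: prod.splits)

lemma gaps_wedge: "\<lbrakk>X \<in> Obj nec; Y \<in> Obj nec\<rbrakk> \<Longrightarrow> gaps (wedge X Y) = gaps X @ gaps Y"
  using gaps[of X] gaps[of Y]
  by (intro gaps_eqI) (auto simp: wedge_def joints_append split: prod.splits)

text \<open>The bridge between the extensional maps that are the arrows of \<open>nec\<close> and
  the total functions used by \<open>joint_map\<close>.\<close>

lemma nec_hom_iff:
  assumes "X \<in> Obj nec" "Y \<in> Obj nec"
  shows "f \<in> nec_hom X Y \<longleftrightarrow> joint_map (gaps X) (gaps Y) f \<and> f \<in> extensional {0..snd X}"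
proof -
  have mono: "simplex_map (snd X) (snd Y) f"
    if "mono_on {0..snd X} f" "f (snd X) = snd Y"
    using that by (simp add: simplex_map_def)
  show ?thesis
    using assms[THEN gaps(2)] assms[THEN gaps(3)] mono
    by (auto simp: nec_hom_def joint_map_def PiE_def simplex_map_le simplex_map_def split: prod.splits
        intro: simplex_map_le[unfolded simplex_map_def])
qed

lemma Arr_nec: "Arr nec = {(X, Y, f). X \<in> Obj nec \<and> Y \<in> Obj nec \<and> joint_map (gaps X) (gaps Y) f \<and> f \<in> extensional {0..snd X}}"
  using nec_hom_iff by (auto simp: Obj_nec) (auto simp: nec_def nec_cat_def Obj_nec)

lemma nec_simps [simp]:
  "Dom nec (X, Y, f) = X" "Cod nec (X, Y, f) = Y"
  "Idn nec X = (X, X, \<lambda>k \<in> {0..snd X}. k)"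
  "Comp nec (Y', Z, g) (X, Y, f) = (X, Z, compose {0..snd X} g f)"
  "tobj nec X Y = wedge X Y"
  "tarr nec (X, X', f) (Y, Y', g) = (wedge X Y, wedge X' Y',
      \<lambda>k \<in> {0..snd X + snd Y}. if k \<le> snd X then f k else snd X' + g (k - snd X))"
  "munit nec = simplex 0"
  "assoc nec X Y Z = Idn nec (wedge X (wedge Y Z))"
  "lunit nec X = Idn nec X" "runit nec X = Idn nec X"
  by (auto simp: nec_def nec_cat_def wedge_arr_def split: prod.splits)

lemma hom_nec: "hom nec X Y = {(X', Y', f). X' = X \<and> Y' = Y \<and> X \<in> Obj nec \<and> Y \<in> Obj nec
    \<and> joint_map (gaps X) (gaps Y) f \<and> f \<in> extensional {0..snd X}}"
  by (auto simp: hom_def Arr_nec)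

lemma joint_map_gaps_le:
  "\<lbrakk>joint_map (gaps X) (gaps Y) f; X \<in> Obj nec; Y \<in> Obj nec; i \<le> snd X\<rbrakk> \<Longrightarrow> f i \<le> snd Y"
  using simplex_map_le[of "snd X" "snd Y" f i] gaps(3)[of X] gaps(3)[of Y] by (simp add: joint_map_def)

text \<open>At the shared vertex \<open>k = snd X\<close> both clauses of \<open>h\<close> give
  \<open>snd X'\<close>, since \<open>f\<close> preserves the last vertex and \<open>g\<close> the
  first.\<close>

lemma wedge_map:
  fixes X X' Y Y' :: necklace and f g :: "nat \<Rightarrow> nat"
  defines "h \<equiv> (\<lambda>k \<in> {0..snd X + snd Y}. if k \<le> snd X then f k else snd X' + g (k - snd X))"
  assumes "X \<in> Obj nec" "X' \<in> Obj nec" "Y \<in> Obj nec" "Y' \<in> Obj nec"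
    and f: "joint_map (gaps X) (gaps X') f" and g: "joint_map (gaps Y) (gaps Y') g"
  shows "\<And>i. i \<le> snd X \<Longrightarrow> h i = f i" "\<And>i. i \<le> snd Y \<Longrightarrow> h (snd X + i) = snd X' + g i"
    "joint_map (gaps X @ gaps Y) (gaps X' @ gaps Y') h"
proof -
  have fX: "f (snd X) = snd X'" and g0: "g 0 = 0"
    using f g assms by (auto simp: joint_map_def gaps(3))
  show 1: "\<And>i. i \<le> snd X \<Longrightarrow> h i = f i" by (simp add: h_def)
  show 2: "\<And>i. i \<le> snd Y \<Longrightarrow> h (snd X + i) = snd X' + g i" using fX g0 by (auto simp: h_def)
  show "joint_map (gaps X @ gaps Y) (gaps X' @ gaps Y') h"
  proof (rule joint_map_append)
    show "joint_map (gaps X) (gaps X') h"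
      using f by (rule joint_map_cong) (use 1 assms in \<open>simp add: gaps(3)\<close>)
    show "joint_map (gaps Y) (gaps Y') (\<lambda>i. h (sum_list (gaps X) + i) - sum_list (gaps X'))"
      using g by (rule joint_map_cong) (use 2 assms in \<open>simp add: gaps(3)\<close>)
  qed (use 2 assms in \<open>simp add: gaps(3)\<close>)
qed

lemma wedge_unit: "X \<in> Obj nec \<Longrightarrow> wedge (simplex 0) X = X" "X \<in> Obj nec \<Longrightarrow> wedge X (simplex 0) = X"
  by (auto simp: Obj_nec wedge_def simplex_def)

lemma wedge_assoc: "wedge (wedge X Y) Z = wedge X (wedge Y Z)"
  by (cases X; cases Y; cases Z) (simp add: wedge_def image_Un image_image add.assoc Un_assoc)

lemma category_nec: "category nec"
proof
  fix f assume "f \<in> Arr nec"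
  then show "Dom nec f \<in> Obj nec \<and> Cod nec f \<in> Obj nec" by (auto simp: Arr_nec)
next
  fix X assume X: "X \<in> Obj nec"
  have "joint_map (gaps X) (gaps X) (\<lambda>k \<in> {0..snd X}. k)"
    by (rule joint_map_cong[OF joint_map_id]) (simp add: gaps(3) X)
  then show "Idn nec X \<in> hom nec X X" using X by (simp add: hom_nec)
next
  fix f g X Y Z assume fg: "f \<in> hom nec X Y" "g \<in> hom nec Y Z"
  obtain f' g' where fg': "f = (X, Y, f')" "g = (Y, Z, g')" using fg by (auto simp: hom_nec)
  have "joint_map (gaps X) (gaps Z) (compose {0..snd X} g' f')"
    by (rule joint_map_cong[OF joint_map_comp[of "gaps X" "gaps Y" f' "gaps Z" g']])
      (use fg fg' in \<open>auto simp: hom_nec gaps(3) compose_def\<close>)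
  then show "Comp nec g f \<in> hom nec X Z" using fg fg' by (auto simp: hom_nec compose_def)
next
  fix f X Y assume "f \<in> hom nec X Y"
  then show "Comp nec f (Idn nec X) = f"
    by (auto simp: hom_nec compose_def simp: extensional_def intro!: ext)
next
  fix f X Y assume "f \<in> hom nec X Y"
  then obtain a where a: "f = (X, Y, a)" "a \<in> extensional {0..snd X}"
    "X \<in> Obj nec" "Y \<in> Obj nec" "joint_map (gaps X) (gaps Y) a"
    by (auto simp: hom_nec)
  have "compose {0..snd X} (\<lambda>k \<in> {0..snd Y}. k) a = a"
    using a(2) joint_map_gaps_le[OF a(5,3,4)] by (auto simp: compose_def extensional_def)
  then show "Comp nec (Idn nec Y) f = f" by (simp add: a)
next
  fix f g h X Y Z V assume fgh: "f \<in> hom nec X Y" "g \<in> hom nec Y Z" "h \<in> hom nec Z V"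
  then obtain a b c where a: "f = (X, Y, a)" "g = (Y, Z, b)" "h = (Z, V, c)"
    "X \<in> Obj nec" "Y \<in> Obj nec" "joint_map (gaps X) (gaps Y) a"
    by (auto simp: hom_nec)
  have "compose {0..snd X} (compose {0..snd Y} c b) a = compose {0..snd X} c (compose {0..snd X} b a)"
    using joint_map_gaps_le[OF a(6,4,5)] by (auto simp: compose_def)
  then show "Comp nec (Comp nec h g) f = Comp nec h (Comp nec g f)" by (simp add: a)
qed

lemma strict_monoidal_nec: "strict_monoidal nec"
proof (rule strict_monoidalI)
  show "category nec" by (rule category_nec)
next
  fix f g X X' Y Y' assume "f \<in> hom nec X X'" "g \<in> hom nec Y Y'"
  then show "tarr nec f g \<in> hom nec (tobj nec X Y) (tobj nec X' Y')"
    using wedge_map(3)[of X X' Y Y'] by (auto simp: hom_nec gaps_wedge)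
next
  fix f f' g g' X X' X'' Y Y' Y''
  assume fg: "f \<in> hom nec X X'" "f' \<in> hom nec X' X''" "g \<in> hom nec Y Y'" "g' \<in> hom nec Y' Y''"
  obtain a a' b b' where eqs: "f = (X, X', a)" "f' = (X', X'', a')" "g = (Y, Y', b)" "g' = (Y', Y'', b')"
    using fg by (auto simp: hom_nec)
  have le: "a k \<le> snd X'" if "k \<le> snd X" for k
    using joint_map_gaps_le[of X X' a] fg that by (auto simp: eqs hom_nec)
  have le': "b k \<le> snd Y'" if "k \<le> snd Y" for k
    using joint_map_gaps_le[of Y Y' b] fg that by (auto simp: eqs hom_nec)
  \<comment> \<open>Needed when a vertex of the second factor lands on the wedge point of the middle
    necklace, where the \<open>if\<close> switches to \<open>a'\<close>.\<close>
  have a': "a' (snd X') = snd X''" "b' 0 = 0" using fg by (auto simp: eqs hom_nec joint_map_def gaps(3))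
  have "(\<lambda>k \<in> {0..snd X + snd Y}. if k \<le> snd X then compose {0..snd X} a' a k
        else snd X'' + compose {0..snd Y} b' b (k - snd X))
      = compose {0..snd X + snd Y}
        (\<lambda>k \<in> {0..snd X' + snd Y'}. if k \<le> snd X' then a' k else snd X'' + b' (k - snd X'))
        (\<lambda>k \<in> {0..snd X + snd Y}. if k \<le> snd X then a k else snd X' + b (k - snd X))"
    (is "?l = ?r")
  proof
    fix k show "?l k = ?r k"
      using le[of k] le'[of "k - snd X"] a' by (auto simp: compose_def)
  qed
  then show "tarr nec (Comp nec f' f) (Comp nec g' g) = Comp nec (tarr nec f' g') (tarr nec f g)"
    by (simp add: eqs)
next
  fix f g h assume fgh: "f \<in> Arr nec" "g \<in> Arr nec" "h \<in> Arr nec"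
  obtain X X' a Y Y' b Z Z' c where eqs: "f = (X, X', a)" "g = (Y, Y', b)" "h = (Z, Z', c)"
    by (metis prod.exhaust)
  show "tarr nec (tarr nec f g) h = tarr nec f (tarr nec g h)"
    by (simp add: eqs wedge_assoc add.assoc) (auto simp: add.assoc intro!: ext)
next
  fix f assume f: "f \<in> Arr nec"
  then obtain X Y a where eq: "f = (X, Y, a)" and XY: "X \<in> Obj nec" "Y \<in> Obj nec"
    and a: "joint_map (gaps X) (gaps Y) a" "a \<in> extensional {0..snd X}"
    by (auto simp: Arr_nec)
  have "a 0 = 0" "a (snd X) = snd Y" using a XY by (auto simp: joint_map_def gaps(3))
  then show "tarr nec (Idn nec (munit nec)) f = f" "tarr nec f (Idn nec (munit nec)) = f"
    using a XY by (auto simp: eq wedge_unit simp: extensional_def intro!: ext)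
next
  fix X Y assume "X \<in> Obj nec" "Y \<in> Obj nec"
  show "tarr nec (Idn nec X) (Idn nec Y) = Idn nec (tobj nec X Y)"
    by (simp, intro ext) auto
qed (auto simp: wedge_unit wedge_assoc)

section \<open>The strong monoidal functor of a diagram\<close>

text \<open>The strictified data are again of the kind \<open>simplicial_wcat\<close>. Attaching the
  strictification to this separate name keeps it from being applied to its own result.\<close>

locale necklicial_data = simplicial_wcat W A K U M
  for W :: "('o, 'a, 'z) mcat_scheme" (structure) and A K U M
begin

text \<open>The image of the data under the equivalence \<open>x \<mapsto> [x]\<close> to the strictification, where
  \<open>[x]\<close> stands for \<open>x \<otimes> munit W\<close>.\<close>

definition st_A :: "nat \<Rightarrow> nat \<Rightarrow> nat \<Rightarrow> 'o list" where
  "st_A n a b = [A n a b]"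

text \<open>\<open>[x, y]\<close> stands for \<open>x \<otimes> (y \<otimes> munit W)\<close>: one
  \<open>runit\<close> drops the trailing unit before \<open>K\<close> composes, and an inverse
  \<open>runit\<close> restores it afterwards.\<close>

definition st_K :: "nat \<Rightarrow> nat \<Rightarrow> nat \<Rightarrow> nat \<Rightarrow> 'o list \<times> 'o list \<times> 'a" where
  "st_K n a b c = ([A n a b, A n b c], [A n a c],
     inverse_arr W (runit W (A n a c)) \<cdot> (K n a b c \<cdot> (Idn W (A n a b) \<boxtimes> runit W (A n b c))))"

definition st_U :: "nat \<Rightarrow> nat \<Rightarrow> 'o list \<times> 'o list \<times> 'a" where
  "st_U n a = ([], [A n a a], inverse_arr W (runit W (A n a a)) \<cdot> U n a)"

definition st_M :: "nat \<Rightarrow> nat \<Rightarrow> (nat \<Rightarrow> nat) \<Rightarrow> nat \<Rightarrow> nat \<Rightarrow> 'o list \<times> 'o list \<times> 'a" where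
  "st_M m n f a b = ([A m a b], [A n (f a) (f b)], M m n f a b \<boxtimes> Idn W (munit W))"

lemma is_iso_strictification:
  assumes "is_iso W f" "f \<in> hom W (tensor_list W xs) (tensor_list W ys)" "set xs \<subseteq> Obj W" "set ys \<subseteq> Obj W"
  shows "is_iso st (xs, ys, f)"
proof -
  interpret st: strict_monoidal st by (rule strict_monoidal_strictification)
  have "(xs, ys, f) \<in> hom st xs ys"
    "(ys, xs, inverse_arr W f) \<in> hom st ys xs"
    using assms by (auto simp: hom_strictification elim!: homE intro!: homI)
  then show ?thesis
    by (rule st.is_isoI) (use assms in \<open>auto elim!: homE\<close>)
qed

lemma tensor_append_single2:
  assumes [simp]: "x \<in> Obj W" "y \<in> Obj W" "z \<in> Obj W"
  shows "tensor_append W [x, y] [z] = (Idn W x \<boxtimes> (runit W y \<boxtimes> Idn W (z \<otimes> munit W))) \<cdot> assoc W x (y \<otimes> munit W) (z \<otimes> munit W)"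
  by (simp add: triangle)

text \<open>Lists nest to the right, so putting \<open>z\<close> after \<open>[x, y]\<close> forces
  a rebracketing that survives as one inverse associator, while putting it in front
  (\<open>st_K_right\<close>) forces none. This asymmetry accounts for the associator in
  \<open>K_assoc\<close>.\<close>

lemma st_K_left:
  assumes [simp]: "a \<le> n" "b \<le> n" "c \<le> n" "z \<in> Obj W"
  shows "tarr st (st_K n a b c) (Idn st [z])
    = ([A n a b, A n b c, z], [A n a c, z],
        (K n a b c \<boxtimes> Idn W (z \<otimes> munit W)) \<cdot> inverse_arr W (assoc W (A n a b) (A n b c) (z \<otimes> munit W)))"
proof -
  let ?x = "A n a b" and ?y = "A n b c" and ?w = "A n a c" and ?I = "munit W"
  let ?Z = "z \<otimes> ?I" and ?f = "inverse_arr W (runit W (A n a c)) \<cdot> (K n a b c \<cdot> (Idn W (A n a b) \<boxtimes> runit W (A n b c)))"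
  let ?l = "(runit W ?w \<boxtimes> Idn W ?Z) \<cdot> ((?f \<boxtimes> Idn W ?Z) \<cdot> inverse_arr W (tensor_append W [?x, ?y] [z]))"
  let ?r = "(K n a b c \<boxtimes> Idn W ?Z) \<cdot> inverse_arr W (assoc W ?x ?y ?Z)"
  let ?g = "(Idn W ?x \<boxtimes> (runit W ?y \<boxtimes> Idn W ?Z)) \<cdot> assoc W ?x (?y \<otimes> ?I) ?Z"
  have eq: "tensor_append W [?x, ?y] [z] = ?g" by (rule tensor_append_single2) simp_all
  have "?l = ?r"
  proof (rule iso_cancel_right[of ?g])
    \<comment> \<open>Naturality brings the associator to the left end of \<open>?g\<close>, where
      the inverse associator of \<open>?r\<close> cancels it.\<close>
    have g: "?g = assoc W ?x ?y ?Z \<cdot> ((Idn W ?x \<boxtimes> runit W ?y) \<boxtimes> Idn W ?Z)"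
      by (subst assoc_natural) auto
    have "?r \<cdot> ?g = (K n a b c \<cdot> (Idn W ?x \<boxtimes> runit W ?y)) \<boxtimes> Idn W ?Z"
      unfolding g by simp
    also have "\<dots> = ?l \<cdot> ?g"
      unfolding eq by simp
    finally show "?l \<cdot> ?g = ?r \<cdot> ?g" by simp
  qed (auto simp: eq)
  then show ?thesis by (simp add: st_K_def tensor_append_single del: tensor_append.simps)
qed

lemma runit_tensor_cancel:
  assumes "z \<in> Obj W" "f \<in> Arr W" "Dom W f = y"
  shows "(runit W z \<boxtimes> f) \<cdot> inverse_arr W (runit W z \<boxtimes> Idn W y) = Idn W z \<boxtimes> f"
proof -
  have "y \<in> Obj W" using assms by auto
  then show ?thesis
    using inverse_comp_cancel_right[of "runit W z \<boxtimes> Idn W y" "Idn W z \<boxtimes> f"] assms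
    by (simp del: inverse_comp_cancel_right)
qed

lemma st_K_right:
  assumes [simp]: "a \<le> n" "b \<le> n" "c \<le> n" "z \<in> Obj W"
  shows "tarr st (Idn st [z]) (st_K n a b c)
    = ([z, A n a b, A n b c], [z, A n a c], Idn W z \<boxtimes> snd (snd (st_K n a b c)))"
  by (simp add: st_K_def tensor_append_single runit_tensor_cancel del: tensor_append.simps)

text \<open>Each law is the corresponding law in \<open>W\<close>, with the unitors that come from
  trailing units moved past the other arrows by naturality.\<close>

lemma st_simplicial_wcat: "strict_simplicial_wcat st st_A st_K st_U st_M"
proof -
  interpret st: strict_monoidal st by (rule strict_monoidal_strictification)
  let ?I = "munit W"
  show ?thesis
  proof
    fix a b c d n :: nat assume [simp]: "a \<le> n" "b \<le> n" "c \<le> n" "d \<le> n"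
    let ?x = "A n a b" and ?y = "A n b c" and ?z = "A n c d" and ?w = "A n a d"
    let ?ai = "inverse_arr W (assoc W ?x ?y (?z \<otimes> ?I))"
    let ?r = "inverse_arr W (runit W ?w)"
    have "?r \<cdot> (K n a c d \<cdot> (Idn W (A n a c) \<boxtimes> runit W ?z)) \<cdot> ((K n a b c \<boxtimes> Idn W (?z \<otimes> ?I)) \<cdot> ?ai)
      = ?r \<cdot> (((K n a c d \<cdot> (K n a b c \<boxtimes> Idn W ?z)) \<cdot> ((Idn W ?x \<boxtimes> Idn W ?y) \<boxtimes> runit W ?z)) \<cdot> ?ai)"
      by simp
    also have "K n a c d \<cdot> (K n a b c \<boxtimes> Idn W ?z) = K n a b d \<cdot> ((Idn W ?x \<boxtimes> K n b c d) \<cdot> assoc W ?x ?y ?z)"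
      by (rule K_assoc) simp_all
    also have "?r \<cdot> ((\<dots> \<cdot> ((Idn W ?x \<boxtimes> Idn W ?y) \<boxtimes> runit W ?z)) \<cdot> ?ai)
        = ?r \<cdot> (K n a b d \<cdot> ((Idn W ?x \<boxtimes> K n b c d) \<cdot> ((assoc W ?x ?y ?z \<cdot> ((Idn W ?x \<boxtimes> Idn W ?y) \<boxtimes> runit W ?z)) \<cdot> ?ai)))"
      by simp
    also have "assoc W ?x ?y ?z \<cdot> ((Idn W ?x \<boxtimes> Idn W ?y) \<boxtimes> runit W ?z)
        = (Idn W ?x \<boxtimes> (Idn W ?y \<boxtimes> runit W ?z)) \<cdot> assoc W ?x ?y (?z \<otimes> ?I)"
      by (subst assoc_natural) auto
    also have "?r \<cdot> (K n a b d \<cdot> ((Idn W ?x \<boxtimes> K n b c d) \<cdot> (\<dots> \<cdot> ?ai)))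
        = ?r \<cdot> (K n a b d \<cdot> (Idn W ?x \<boxtimes> (K n b c d \<cdot> (Idn W ?y \<boxtimes> runit W ?z))))"
      by simp
    finally have eq: "?r \<cdot> (K n a c d \<cdot> (Idn W (A n a c) \<boxtimes> runit W ?z)) \<cdot> ((K n a b c \<boxtimes> Idn W (?z \<otimes> ?I)) \<cdot> ?ai)
        = ?r \<cdot> (K n a b d \<cdot> (Idn W ?x \<boxtimes> (K n b c d \<cdot> (Idn W ?y \<boxtimes> runit W ?z))))" .
    have "Comp st (st_K n a c d) (tarr st (st_K n a b c) (Idn st [?z]))
        = Comp st (st_K n a b d) (tarr st (Idn st [?x]) (st_K n b c d))"
      unfolding st_K_left[OF \<open>a \<le> n\<close> \<open>b \<le> n\<close> \<open>c \<le> n\<close> A_Obj[OF \<open>c \<le> n\<close> \<open>d \<le> n\<close>]]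
        st_K_right[OF \<open>b \<le> n\<close> \<open>c \<le> n\<close> \<open>d \<le> n\<close> A_Obj[OF \<open>a \<le> n\<close> \<open>b \<le> n\<close>]]
      using eq by (simp add: st_K_def)
    moreover have arr: "tarr st (Idn st [?x]) (st_K n b c d) \<in> Arr st"
      and dom: "Dom st (tarr st (Idn st [?x]) (st_K n b c d)) = [?x] @ [?y] @ [?z]"
      unfolding st_K_right[OF \<open>b \<le> n\<close> \<open>c \<le> n\<close> \<open>d \<le> n\<close> A_Obj[OF \<open>a \<le> n\<close> \<open>b \<le> n\<close>]]
      by (auto simp: st_K_def intro!: homI)
    moreover have "assoc st [?x] [?y] [?z] = Idn st ([?x] @ [?y] @ [?z])"
      by (subst st.strict_assoc) simp_all
    ultimately show "Comp st (st_K n a c d) (tarr st (st_K n a b c) (Idn st (st_A n c d)))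
        = Comp st (st_K n a b d) (Comp st (tarr st (Idn st (st_A n a b)) (st_K n b c d))
            (assoc st (st_A n a b) (st_A n b c) (st_A n c d)))"
      by (simp only: st_A_def st.comp_Idn[OF arr dom])
  next
    fix a b n :: nat assume [simp]: "a \<le> n" "b \<le> n"
    let ?x = "A n a a" and ?y = "A n a b"
    let ?u = "inverse_arr W (runit W ?x) \<cdot> U n a"
    have l: "inverse_arr W (runit W ?y) \<cdot> (K n a a b \<cdot> (Idn W ?x \<boxtimes> runit W ?y)) \<cdot> ((U n a \<boxtimes> Idn W (?y \<otimes> ?I)) \<cdot> inverse_arr W (lunit W (?y \<otimes> ?I)))
       = Idn W (?y \<otimes> ?I)"
    proof -
      have "inverse_arr W (runit W ?y) \<cdot> (K n a a b \<cdot> (Idn W ?x \<boxtimes> runit W ?y)) \<cdot> ((U n a \<boxtimes> Idn W (?y \<otimes> ?I)) \<cdot> inverse_arr W (lunit W (?y \<otimes> ?I)))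
         = inverse_arr W (runit W ?y) \<cdot> ((K n a a b \<cdot> (U n a \<boxtimes> Idn W ?y)) \<cdot> ((Idn W ?I \<boxtimes> runit W ?y) \<cdot> inverse_arr W (lunit W (?y \<otimes> ?I))))"
        by simp
      also have "\<dots> = inverse_arr W (runit W ?y) \<cdot> ((lunit W ?y \<cdot> (Idn W ?I \<boxtimes> runit W ?y)) \<cdot> inverse_arr W (lunit W (?y \<otimes> ?I)))"
        by (simp add: K_U_left)
      also have "\<dots> = Idn W (?y \<otimes> ?I)"
        by (subst lunit_natural) simp_all
      finally show ?thesis .
    qed
    have "tarr st (st_U n a) (Idn st [?y])
        = ([?y], [?x, ?y], (U n a \<boxtimes> Idn W (?y \<otimes> ?I)) \<cdot> inverse_arr W (lunit W (?y \<otimes> ?I)))"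
      using tensor_append_single[of ?x "[?y]"] by (simp add: st_U_def del: tensor_append.simps(2))
    then show "Comp st (st_K n a a b) (tarr st (st_U n a) (Idn st (st_A n a b)))
        = lunit st (st_A n a b)"
      using l by (simp add: st_A_def st_K_def st.strict_lunit)
  next
    fix a b n :: nat assume [simp]: "a \<le> n" "b \<le> n"
    let ?x = "A n a b" and ?y = "A n b b"
    have "tarr st (Idn st [?x]) (st_U n b)
        = ([?x], [?x, ?y], Idn W ?x \<boxtimes> (inverse_arr W (runit W ?y) \<cdot> U n b))"
      using tensor_append_single[of ?x "[?y]"] tensor_append_single[of ?x "[]"]
      by (simp add: st_U_def runit_tensor_cancel del: tensor_append.simps(2))
    moreover have "inverse_arr W (runit W ?x) \<cdot> (K n a b b \<cdot> (Idn W ?x \<boxtimes> runit W ?y)) \<cdot> (Idn W ?x \<boxtimes> (inverse_arr W (runit W ?y) \<cdot> U n b))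
       = Idn W (?x \<otimes> ?I)"
      by (simp add: K_U_right)
    ultimately show "Comp st (st_K n a b b) (tarr st (Idn st (st_A n a b)) (st_U n b))
        = runit st (st_A n a b)"
      by (simp add: st_A_def st_K_def st.strict_runit)
  next
    fix m n a b c :: nat and f assume [simp]: "simplex_map m n f" "a \<le> m" "b \<le> m" "c \<le> m"
    have [simp]: "f a \<le> n" "f b \<le> n" "f c \<le> n" using simplex_map_le[of m n f] by simp_all
    let ?x = "A m a b" and ?y = "A m b c" and ?x' = "A n (f a) (f b)" and ?y' = "A n (f b) (f c)"
    let ?w = "A m a c" and ?w' = "A n (f a) (f c)"
    have t: "tarr st (st_M m n f a b) (st_M m n f b c)
      = ([?x, ?y], [?x', ?y'], M m n f a b \<boxtimes> (M m n f b c \<boxtimes> Idn W ?I))"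
    proof -
      have "(runit W ?x' \<boxtimes> Idn W (?y' \<otimes> ?I)) \<cdot> (((M m n f a b \<boxtimes> Idn W ?I) \<boxtimes> (M m n f b c \<boxtimes> Idn W ?I))
          \<cdot> inverse_arr W (runit W ?x \<boxtimes> Idn W (?y \<otimes> ?I)))
        = ((M m n f a b \<boxtimes> (M m n f b c \<boxtimes> Idn W ?I)) \<cdot> (runit W ?x \<boxtimes> Idn W (?y \<otimes> ?I)))
          \<cdot> inverse_arr W (runit W ?x \<boxtimes> Idn W (?y \<otimes> ?I))"
        by (simp add: runit_natural)
      also have "\<dots> = M m n f a b \<boxtimes> (M m n f b c \<boxtimes> Idn W ?I)"
        by (rule inverse_comp_cancel_right) simp_all
      finally show ?thesis by (simp add: st_M_def tensor_append_single del: tensor_append.simps(2))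
    qed
    have "(M m n f a c \<boxtimes> Idn W ?I) \<cdot> (inverse_arr W (runit W ?w) \<cdot> (K m a b c \<cdot> (Idn W ?x \<boxtimes> runit W ?y)))
       = inverse_arr W (runit W ?w') \<cdot> (K n (f a) (f b) (f c) \<cdot> (Idn W ?x' \<boxtimes> runit W ?y')) \<cdot> (M m n f a b \<boxtimes> (M m n f b c \<boxtimes> Idn W ?I))"
      (is "?l = ?r")
    proof (rule iso_cancel_left[of "runit W ?w'"])
      have "runit W ?w' \<cdot> ?l = (runit W ?w' \<cdot> (M m n f a c \<boxtimes> Idn W ?I)) \<cdot> (inverse_arr W (runit W ?w) \<cdot> (K m a b c \<cdot> (Idn W ?x \<boxtimes> runit W ?y)))"
        by simp
      also have "\<dots> = (M m n f a c \<cdot> K m a b c) \<cdot> (Idn W ?x \<boxtimes> runit W ?y)"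
        by (subst runit_natural) simp_all
      also have "\<dots> = K n (f a) (f b) (f c) \<cdot> (M m n f a b \<boxtimes> (M m n f b c \<cdot> runit W ?y))"
        by (subst M_K) simp_all
      also have "M m n f b c \<cdot> runit W ?y = runit W ?y' \<cdot> (M m n f b c \<boxtimes> Idn W ?I)"
        by (subst runit_natural) simp_all
      also have "K n (f a) (f b) (f c) \<cdot> (M m n f a b \<boxtimes> (runit W ?y' \<cdot> (M m n f b c \<boxtimes> Idn W ?I))) = runit W ?w' \<cdot> ?r"
        by simp
      finally show "runit W ?w' \<cdot> ?l = runit W ?w' \<cdot> ?r" .
    qed simp_all
    then show "Comp st (st_M m n f a c) (st_K m a b c)
      = Comp st (st_K n (f a) (f b) (f c)) (tarr st (st_M m n f a b) (st_M m n f b c))"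
      unfolding t by (simp add: st_M_def st_K_def)
  next
    fix m n a :: nat and f assume [simp]: "simplex_map m n f" "a \<le> m"
    have [simp]: "f a \<le> n" using simplex_map_le[of m n f] by simp
    let ?w = "A m a a" and ?w' = "A n (f a) (f a)"
    have "(M m n f a a \<boxtimes> Idn W ?I) \<cdot> (inverse_arr W (runit W ?w) \<cdot> U m a) = inverse_arr W (runit W ?w') \<cdot> U n (f a)"
      (is "?l = ?r")
    proof (rule iso_cancel_left[of "runit W ?w'"])
      have "runit W ?w' \<cdot> ?l = (runit W ?w' \<cdot> (M m n f a a \<boxtimes> Idn W ?I)) \<cdot> (inverse_arr W (runit W ?w) \<cdot> U m a)"
        by simp
      also have "\<dots> = runit W ?w' \<cdot> ?r" by (subst runit_natural) (simp_all add: M_U)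
      finally show "runit W ?w' \<cdot> ?l = runit W ?w' \<cdot> ?r" .
    qed simp_all
    then show "Comp st (st_M m n f a a) (st_U m a) = st_U n (f a)"
      by (simp add: st_M_def st_U_def)
  next
    show "is_iso st (st_U 0 0)"
      unfolding st_U_def using U_iso by (intro is_iso_strictification) (auto intro!: homI)
  next
    fix m n a b :: nat and f g :: "nat \<Rightarrow> nat" assume *: "\<And>i. i \<le> m \<Longrightarrow> f i = g i" "a \<le> m" "b \<le> m"
    from M_cong[OF this] have "M m n f a b = M m n g a b" .
    then show "st_M m n f a b = st_M m n g a b" by (simp add: st_M_def *)
  qed (auto simp: st_A_def st_K_def st_U_def st_M_def hom_strictification M_id M_comp intro!: homI)
qed

sublocale st: strict_simplicial_wcat st st_A st_K st_U st_M
  by (rule st_simplicial_wcat)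

abbreviation real_arr :: "'o list \<times> 'o list \<times> 'a \<Rightarrow> 'a" where
  "real_arr F \<equiv> snd (snd F)"

lemma real_arr_comp: "real_arr (Comp st G F) = real_arr G \<cdot> real_arr F"
  by (cases F; cases G) simp

lemma real_arr_tensor: "real_arr (tarr st F G)
    = tensor_append W (Cod st F) (Cod st G)
      \<cdot> ((real_arr F \<boxtimes> real_arr G) \<cdot> inverse_arr W (tensor_append W (Dom st F) (Dom st G)))"
  by (cases F; cases G) simp

lemma real_arr_simps:
  assumes "F \<in> Arr st"
  shows "real_arr F \<in> Arr W" "Dom W (real_arr F) = tensor_list W (Dom st F)"
    "Cod W (real_arr F) = tensor_list W (Cod st F)"
  using assms by (cases F; auto elim: homE)+

lemma set_beads [simp]: "set (st.beads ns) \<subseteq> Obj W"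
  using st.beads_Obj[of ns] by (auto simp del: st.beads_Obj)

text \<open>Realisation after the strict functor given by \<open>beads\<close> and
  \<open>nec_map\<close>; its monoidal structure is therefore that of realisation.
  \<open>eps\<close> is an identity because the 0-simplex has no beads and the empty list realises
  \<open>munit W\<close>.\<close>

definition nec_functor :: "(necklace, nec_arr, 'o, 'a) mfunc" where
  "nec_functor = \<lparr>fobj = (\<lambda>X. tensor_list W (st.beads (gaps X))),
     farr = (\<lambda>(X, Y, f). real_arr (st.nec_map (gaps X) (gaps Y) f)),
     mu = (\<lambda>X Y. tensor_append W (st.beads (gaps X)) (st.beads (gaps Y))),
     eps = Idn W (munit W)\<rparr>"

lemma nec_functor_simps [simp]:
  "fobj nec_functor X = tensor_list W (st.beads (gaps X))"
  "farr nec_functor (X, Y, f) = real_arr (st.nec_map (gaps X) (gaps Y) f)"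
  "mu nec_functor X Y = tensor_append W (st.beads (gaps X)) (st.beads (gaps Y))"
  "eps nec_functor = Idn W (munit W)"
  by (simp_all add: nec_functor_def)

lemma beads_append [simp]: "st.beads (ms @ ns) = st.beads ms @ st.beads ns"
  using st.beads_append[of ms ns] by simp

lemma st_munit: "munit st = []"
  by simp

lemma real_nec_map [simp]:
  assumes "joint_map ns ms f"
  shows "real_arr (st.nec_map ns ms f) \<in> Arr W"
    "Dom W (real_arr (st.nec_map ns ms f)) = tensor_list W (st.beads ns)"
    "Cod W (real_arr (st.nec_map ns ms f)) = tensor_list W (st.beads ms)"
  using real_arr_simps[OF st.nec_map_simps(1)[OF assms]] st.nec_map_simps(2,3)[OF assms] by simp_all

lemma real_nec_map_id:
  "\<lbrakk>0 \<notin> set ns; \<And>i. i \<le> sum_list ns \<Longrightarrow> f i = i\<rbrakk>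
    \<Longrightarrow> real_arr (st.nec_map ns ns f) = Idn W (tensor_list W (st.beads ns))"
  using st.nec_map_id[of ns] st.nec_map_cong[of ns f "\<lambda>i. i" ns] by simp

text \<open>Functoriality is \<open>nec_map_comp\<close>, naturality of \<open>mu\<close> is
  \<open>nec_map_append\<close>, and the coherence axioms are those of \<open>tensor_append\<close>,
  since the constraints of \<open>nec\<close> are identities.\<close>

lemma strong_monoidal_nec_functor: "strong_monoidal_functor nec W nec_functor"
proof -
  interpret nec: strict_monoidal nec by (rule strict_monoidal_nec)
  have farr_Idn: "farr nec_functor (Idn nec X) = Idn W (fobj nec_functor X)" if "X \<in> Obj nec" for X
    using that gaps[of X] by (simp add: real_nec_map_id)
  show ?thesis
  proof
    fix X assume "X \<in> Obj nec"
    then show "farr nec_functor (Idn nec X) = Idn W (fobj nec_functor X)" by (rule farr_Idn)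
  next
    fix f g X Y Z assume fg: "f \<in> hom nec X Y" "g \<in> hom nec Y Z"
    obtain a b where ab: "f = (X, Y, a)" "g = (Y, Z, b)" using fg by (auto simp: hom_nec)
    have *: "joint_map (gaps X) (gaps Y) a" "joint_map (gaps Y) (gaps Z) b" "X \<in> Obj nec" "Y \<in> Obj nec" "Z \<in> Obj nec"
      using fg by (auto simp: hom_nec ab)
    have "st.nec_map (gaps X) (gaps Z) (compose {0..snd X} b a) = st.nec_map (gaps X) (gaps Z) (\<lambda>i. b (a i))"
      using * by (intro st.nec_map_cong) (simp add: compose_def gaps(3))
    also have "\<dots> = Comp st (st.nec_map (gaps Y) (gaps Z) b) (st.nec_map (gaps X) (gaps Y) a)"
      using * gaps(1) by (intro st.nec_map_comp[symmetric]) auto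
    finally show "farr nec_functor (Comp nec g f) = farr nec_functor g \<cdot> farr nec_functor f"
      by (simp add: ab real_arr_comp)
  next
    fix f g X X' Y Y' assume fg: "f \<in> hom nec X X'" "g \<in> hom nec Y Y'"
    obtain a b where ab: "f = (X, X', a)" "g = (Y, Y', b)" using fg by (auto simp: hom_nec)
    have *: "joint_map (gaps X) (gaps X') a" "joint_map (gaps Y) (gaps Y') b" "X \<in> Obj nec" "Y \<in> Obj nec" "X' \<in> Obj nec" "Y' \<in> Obj nec"
      using fg by (auto simp: hom_nec ab)
    let ?h = "\<lambda>k \<in> {0..snd X + snd Y}. if k \<le> snd X then a k else snd X' + b (k - snd X)"
    note h = wedge_map[OF *(3,5,4,6) *(1,2)]
    have h1: "joint_map (gaps X) (gaps X') ?h"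
      using *(1) by (rule joint_map_cong) (use h(1) * in \<open>simp add: gaps(3)\<close>)
    have h2: "joint_map (gaps Y) (gaps Y') (\<lambda>i. ?h (sum_list (gaps X) + i) - sum_list (gaps X'))"
      using *(2) by (rule joint_map_cong) (use h(2) * in \<open>simp add: gaps(3)\<close>)
    have "st.nec_map (gaps X @ gaps Y) (gaps X' @ gaps Y') ?h
       = tarr st (st.nec_map (gaps X) (gaps X') ?h)
          (st.nec_map (gaps Y) (gaps Y') (\<lambda>i. ?h (sum_list (gaps X) + i) - sum_list (gaps X')))"
      using * gaps(1) h(2) by (intro st.nec_map_append h1 h2) (auto simp: gaps(3))
    also have "st.nec_map (gaps X) (gaps X') ?h = st.nec_map (gaps X) (gaps X') a"
      using * by (intro st.nec_map_cong) (simp add: gaps(3))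
    also have "st.nec_map (gaps Y) (gaps Y') (\<lambda>i. ?h (sum_list (gaps X) + i) - sum_list (gaps X'))
        = st.nec_map (gaps Y) (gaps Y') b"
    proof (rule st.nec_map_cong)
      fix i assume "i \<le> sum_list (gaps Y)"
      then have "i \<le> snd Y" using * by (simp add: gaps(3))
      then show "?h (sum_list (gaps X) + i) - sum_list (gaps X') = b i"
        using h(2)[of i] * by (simp add: gaps(3))
    qed
    finally have eq: "farr nec_functor (tarr nec f g) = real_arr (tarr st
        (st.nec_map (gaps X) (gaps X') a) (st.nec_map (gaps Y) (gaps Y') b))"
      using * by (simp only: ab nec_simps nec_functor_simps gaps_wedge)
    show "mu nec_functor X' Y' \<cdot> (farr nec_functor f \<boxtimes> farr nec_functor g)
        = farr nec_functor (tarr nec f g) \<cdot> mu nec_functor X Y"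
      unfolding eq real_arr_tensor using * by (simp add: ab)
  next
    fix X Y Z assume XYZ: "X \<in> Obj nec" "Y \<in> Obj nec" "Z \<in> Obj nec"
    have "farr nec_functor (assoc nec X Y Z) = Idn W (tensor_list W (st.beads (gaps X @ gaps Y @ gaps Z)))"
      using farr_Idn[of "wedge X (wedge Y Z)"] XYZ by (simp add: gaps_wedge del: nec_simps(3))
    then show "farr nec_functor (assoc nec X Y Z) \<cdot> (mu nec_functor (tobj nec X Y) Z
        \<cdot> (mu nec_functor X Y \<boxtimes> Idn W (fobj nec_functor Z)))
      = mu nec_functor X (tobj nec Y Z) \<cdot> ((Idn W (fobj nec_functor X) \<boxtimes> mu nec_functor Y Z)
        \<cdot> assoc W (fobj nec_functor X) (fobj nec_functor Y) (fobj nec_functor Z))"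
      using XYZ by (simp add: gaps_wedge tensor_append_assoc del: nec_simps(8))
  next
    fix X assume X: "X \<in> Obj nec"
    show "farr nec_functor (lunit nec X) \<cdot> (mu nec_functor (munit nec) X \<cdot> (eps nec_functor \<boxtimes> Idn W (fobj nec_functor X)))
        = lunit W (fobj nec_functor X)"
      using farr_Idn[OF X] by (simp add: gaps_simplex st_munit del: nec_simps(3))
    show "farr nec_functor (runit nec X) \<cdot> (mu nec_functor X (munit nec) \<cdot> (Idn W (fobj nec_functor X) \<boxtimes> eps nec_functor))
        = runit W (fobj nec_functor X)"
      using farr_Idn[OF X] by (simp add: gaps_simplex st_munit tensor_append_Nil del: nec_simps(3))
  next
    fix f X Y assume "f \<in> hom nec X Y"
    then show "farr nec_functor f \<in> hom W (fobj nec_functor X) (fobj nec_functor Y)"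
      by (auto simp: hom_nec intro!: homI)
  qed (auto simp: gaps_wedge gaps_simplex intro!: homI)
qed

section \<open>Comparison of the functor with the hom-objects of the diagram\<close>

lemma joint_map_simplex:
  "\<lbrakk>simplex_map (sum_list ns) m f; f 0 = 0; f (sum_list ns) = m\<rbrakk> \<Longrightarrow> joint_map ns (gaps (simplex m)) f"
proof (cases "m = 0")
  case True
  assume "simplex_map (sum_list ns) m f"
  then have "f i = 0" if "i \<le> sum_list ns" for i using simplex_map_le[of "sum_list ns" m f i] that True by simp
  then show ?thesis using True by (simp add: gaps_simplex joint_map_Nil)
qed (simp add: gaps_simplex joint_map_single)

lemma simplex_map_add: "i + d \<le> n \<Longrightarrow> simplex_map d n (\<lambda>k. i + k)"
  by (rule simplex_mapI) auto

text \<open>The chain of the inclusion of [j-i] as the interval from \<open>i\<close> to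
  \<open>j\<close>, with the trailing unit of its target removed. For \<open>i = j\<close> the list
  of gaps is empty and the chain is the unit.\<close>

definition psi :: "nat \<Rightarrow> nat \<Rightarrow> nat \<Rightarrow> 'a" where
  "psi n i j = runit W (A n i j) \<cdot> real_arr (st.chain (gaps (simplex (j - i))) n (\<lambda>k. i + k))"

lemma real_chain:
  assumes "i \<le> j" "j \<le> n" "sum_list ns = j - i"
  shows "real_arr (st.chain ns n (\<lambda>k. i + k)) \<in> Arr W"
    "Dom W (real_arr (st.chain ns n (\<lambda>k. i + k))) = tensor_list W (st.beads ns)"
    "Cod W (real_arr (st.chain ns n (\<lambda>k. i + k))) = A n i j \<otimes> munit W"
    "st.chain ns n (\<lambda>k. i + k) \<in> Arr st"
    "Dom st (st.chain ns n (\<lambda>k. i + k)) = st.beads ns"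
    "Cod st (st.chain ns n (\<lambda>k. i + k)) = [A n i j]"
proof -
  have f: "simplex_map (sum_list ns) n (\<lambda>k. i + k)"
    using assms by (intro simplex_map_add) simp
  note * = st.chain_simps[OF f]
  show "st.chain ns n (\<lambda>k. i + k) \<in> Arr st"
    "Dom st (st.chain ns n (\<lambda>k. i + k)) = st.beads ns"
    "Cod st (st.chain ns n (\<lambda>k. i + k)) = [A n i j]"
    using * assms by (simp_all add: st_A_def del: strictification_simps(2))
  with real_arr_simps[OF *(1)]
  show "real_arr (st.chain ns n (\<lambda>k. i + k)) \<in> Arr W"
    "Dom W (real_arr (st.chain ns n (\<lambda>k. i + k))) = tensor_list W (st.beads ns)"
    "Cod W (real_arr (st.chain ns n (\<lambda>k. i + k))) = A n i j \<otimes> munit W"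
    by simp_all
qed

lemma psi_simps [simp]:
  assumes "i \<le> j" "j \<le> n"
  shows "psi n i j \<in> Arr W" "Dom W (psi n i j) = fobj nec_functor (simplex (j - i))"
    "Cod W (psi n i j) = A n i j"
  using assms real_chain[of i j n "gaps (simplex (j - i))"] by (simp_all add: psi_def)

lemma psi_unit: "i \<le> n \<Longrightarrow> psi n i i \<cdot> eps nec_functor = U n i"
  by (simp add: psi_def gaps_simplex st_U_def)

text \<open>The refinement map from the wedge into the simplex, followed by the inclusion of the
  interval, is the chain over both gaps (\<open>chain_nec_map\<close>). Splitting it at
  \<open>k\<close> by \<open>chain_append\<close> produces the composition of the diagram.\<close>

lemma psi_comp:
  assumes "i \<le> k" "k \<le> j" "j \<le> n"
  shows "psi n i j \<cdot> (farr nec_functor (wedge (simplex (k - i)) (simplex (j - k)), simplex (j - i), \<lambda>l \<in> {0..j - i}. l)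
      \<cdot> mu nec_functor (simplex (k - i)) (simplex (j - k))) = K n i k j \<cdot> (psi n i k \<boxtimes> psi n k j)"
proof -
  let ?g = "gaps (simplex (k - i))" and ?g' = "gaps (simplex (j - k))" and ?h = "gaps (simplex (j - i))"
  let ?id = "\<lambda>l \<in> {0..j - i}. l"
  have sum: "(k - i) + (j - k) = j - i" using assms by simp
  have id: "joint_map (?g @ ?g') ?h ?id"
    using sum by (intro joint_map_simplex simplex_mapI) simp_all
  have "Comp st (st.chain ?h n (\<lambda>l. i + l)) (st.nec_map (?g @ ?g') ?h ?id)
      = st.chain (?g @ ?g') n (\<lambda>l. i + ?id l)"
    using assms by (intro st.chain_nec_map id) (auto intro: simplex_map_add simp: gaps_simplex)
  also have "\<dots> = st.chain (?g @ ?g') n (\<lambda>l. i + l)"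
    using sum by (intro st.chain_cong) simp
  also have "\<dots> = Comp st (st_K n i k j)
      (tarr st (st.chain ?g n (\<lambda>l. i + l)) (st.chain ?g' n (\<lambda>l. i + ((k - i) + l))))"
    using st.chain_append[of ?g ?g' n "\<lambda>l. i + l"] simplex_map_add[of i "j - i" n] sum assms by simp
  also have "(\<lambda>l. i + ((k - i) + l)) = (\<lambda>l. k + l)" using assms by auto
  finally have "real_arr (Comp st (st.chain ?h n (\<lambda>l. i + l)) (st.nec_map (?g @ ?g') ?h ?id))
     = real_arr (Comp st (st_K n i k j)
      (tarr st (st.chain ?g n (\<lambda>l. i + l)) (st.chain ?g' n (\<lambda>l. k + l))))"
    by (rule arg_cong)
  then have eq: "real_arr (st.chain ?h n (\<lambda>l. i + l)) \<cdot> real_arr (st.nec_map (?g @ ?g') ?h ?id)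
     = real_arr (st_K n i k j) \<cdot> (tensor_append W [A n i k] [A n k j] \<cdot>
      ((real_arr (st.chain ?g n (\<lambda>l. i + l)) \<boxtimes> real_arr (st.chain ?g' n (\<lambda>l. k + l)))
      \<cdot> inverse_arr W (tensor_append W (st.beads ?g) (st.beads ?g'))))"
    unfolding real_arr_comp real_arr_tensor
    using real_chain[of i k n ?g] real_chain[of k j n ?g'] assms by simp
  note [simp] = real_chain[of i k n ?g] real_chain[of k j n ?g'] real_chain[of i j n ?h]
  have [simp]: "i \<le> j" "i \<le> n" "k \<le> n" using assms by auto
  note [simp] = assms
  have "psi n i j \<cdot> (farr nec_functor (wedge (simplex (k - i)) (simplex (j - k)), simplex (j - i), ?id)
      \<cdot> mu nec_functor (simplex (k - i)) (simplex (j - k)))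
    = runit W (A n i j) \<cdot> ((real_arr (st.chain ?h n (\<lambda>l. i + l)) \<cdot> real_arr (st.nec_map (?g @ ?g') ?h ?id))
        \<cdot> tensor_append W (st.beads ?g) (st.beads ?g'))"
    using id by (simp add: psi_def gaps_wedge)
  also have "\<dots> = runit W (A n i j) \<cdot> (real_arr (st_K n i k j) \<cdot> ((runit W (A n i k) \<boxtimes> Idn W (A n k j \<otimes> munit W)) \<cdot>
      (real_arr (st.chain ?g n (\<lambda>l. i + l)) \<boxtimes> real_arr (st.chain ?g' n (\<lambda>l. k + l)))))"
    unfolding eq by (simp add: tensor_append_single st_K_def del: tensor_append.simps)
  also have "\<dots> = K n i k j \<cdot> (psi n i k \<boxtimes> psi n k j)"
    by (simp add: st_K_def psi_def)
  finally show ?thesis .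
qed

text \<open>Both sides come from the chain of \<open>k \<mapsto> f (i + k)\<close>: acting by
  \<open>f\<close> after the chain gives it by \<open>chain_natural\<close>, and factoring through
  the interval from \<open>f i\<close> to \<open>f j\<close> gives it by
  \<open>chain_nec_map\<close>.\<close>

lemma psi_natural:
  assumes "i \<le> j" "j \<le> m" "simplex_map m n f"
  shows "M m n f i j \<cdot> psi m i j
    = psi n (f i) (f j) \<cdot> farr nec_functor (simplex (j - i), simplex (f j - f i), \<lambda>k \<in> {0..j - i}. f (k + i) - f i)"
proof -
  let ?g = "gaps (simplex (j - i))" and ?g' = "gaps (simplex (f j - f i))"
  let ?f = "\<lambda>k \<in> {0..j - i}. f (k + i) - f i"
  have mono: "f a \<le> f b" if "a \<le> b" "b \<le> m" for a b using simplex_map_mono[OF assms(3)] that by blast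
  have [simp]: "f i \<le> f j" "f j \<le> n" "f i \<le> n" "i \<le> m" "i \<le> j" "j \<le> m" "simplex_map m n f"
    using mono assms simplex_map_le[OF assms(3)] by auto
  have le: "b + i \<le> m" if "b \<le> j - i" for b using that assms(1,2) by linarith
  have ge: "f i \<le> f (b + i)" if "b \<le> j - i" for b using le[OF that] by (intro mono) simp_all
  have f: "joint_map ?g ?g' ?f"
    using le by (intro joint_map_simplex simplex_mapI) (auto intro!: diff_le_mono mono)
  have "Comp st (st_M m n f (i + 0) (i + sum_list ?g)) (st.chain ?g m (\<lambda>k. i + k))
      = st.chain ?g n (\<lambda>k. f (i + k))"
    using assms by (intro st.chain_natural) (auto intro: simplex_map_add)
  also have "\<dots> = st.chain ?g n (\<lambda>k. f i + ?f k)"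
    using ge by (intro st.chain_cong) (simp add: add.commute)
  also have "\<dots> = Comp st (st.chain ?g' n (\<lambda>k. f i + k)) (st.nec_map ?g ?g' ?f)"
    by (rule st.chain_nec_map[symmetric, OF f]) (auto intro: simplex_map_add simp: gaps_simplex)
  finally have "real_arr (Comp st (st_M m n f i j) (st.chain ?g m (\<lambda>k. i + k)))
    = real_arr (Comp st (st.chain ?g' n (\<lambda>k. f i + k)) (st.nec_map ?g ?g' ?f))"
    by simp
  then have eq: "real_arr (st_M m n f i j) \<cdot> real_arr (st.chain ?g m (\<lambda>k. i + k))
    = real_arr (st.chain ?g' n (\<lambda>k. f i + k)) \<cdot> real_arr (st.nec_map ?g ?g' ?f)"
    unfolding real_arr_comp .
  note [simp] = real_chain[of i j m ?g] real_chain[of "f i" "f j" n ?g']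
  have "psi n (f i) (f j) \<cdot> farr nec_functor (simplex (j - i), simplex (f j - f i), ?f)
     = runit W (A n (f i) (f j)) \<cdot> (real_arr (st.chain ?g' n (\<lambda>k. f i + k)) \<cdot> real_arr (st.nec_map ?g ?g' ?f))"
    using f by (simp add: psi_def)
  also have "\<dots> = (runit W (A n (f i) (f j)) \<cdot> (M m n f i j \<boxtimes> Idn W (munit W))) \<cdot> real_arr (st.chain ?g m (\<lambda>k. i + k))"
    unfolding eq[symmetric] by (simp add: st_M_def)
  also have "\<dots> = M m n f i j \<cdot> psi m i j"
    by (subst runit_natural) (simp_all add: psi_def)
  finally show ?thesis by simp
qed

text \<open>For \<open>i < j\<close> there is one bead, and \<open>psi\<close> is the action of an
  inert map up to unitors. For \<open>i = j\<close> there is none, and \<open>psi\<close> is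
  \<open>U n i\<close>, the image of the invertible \<open>U 0 0\<close> under an inert map.\<close>

lemma psi_iso:
  assumes inert: "\<And>d n i. i + d \<le> n \<Longrightarrow> is_iso W (M d n (\<lambda>k. i + k) 0 d)"
    and "i \<le> j" "j \<le> n"
  shows "is_iso W (psi n i j)"
proof (cases "i = j")
  case True
  have f: "simplex_map 0 n (\<lambda>k. i + k)" using assms by (intro simplex_map_add) simp
  have "M 0 n (\<lambda>k. i + k) 0 0 \<cdot> U 0 0 = U n i"
    using M_U[OF f, of 0] by simp
  then have "is_iso W (U n i)"
    using is_iso_comp[OF U_iso inert[of i 0 n]] f assms by simp
  moreover have "psi n i i = U n i"
    using assms by (simp add: psi_def gaps_simplex st_U_def)
  ultimately show ?thesis using True by simp
next
  case False
  have f: "simplex_map (j - i) n (\<lambda>k. i + k)" using assms by (intro simplex_map_add) simp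
  have "gaps (simplex (j - i)) = [j - i]" using False assms by (simp add: gaps_simplex)
  then have "psi n i j = runit W (A n i j) \<cdot> (M (j - i) n (\<lambda>k. i + k) 0 (j - i) \<boxtimes> Idn W (munit W))"
    using st.chain_single[OF f] by (simp add: psi_def st_M_def del: st.chain.simps)
  moreover have "is_iso W (M (j - i) n (\<lambda>k. i + k) 0 (j - i))" using inert assms by simp
  ultimately show ?thesis using f assms by simp
qed

end

section \<open>Functor categories\<close>

lemma (in cat_functor) functor_simps [simp]:
  "f \<in> Arr C \<Longrightarrow> farr F f \<in> Arr D"
  "f \<in> Arr C \<Longrightarrow> Dom D (farr F f) = fobj F (Dom C f)"
  "f \<in> Arr C \<Longrightarrow> Cod D (farr F f) = fobj F (Cod C f)"
  "x \<in> Obj C \<Longrightarrow> fobj F x \<in> Obj D"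
  using farr_hom[of f "Dom C f" "Cod C f"] fobj_Obj by (auto simp: hom_def)

lemma nat_transD:
  assumes "nat_trans C D F G \<alpha>" "x \<in> Obj C"
  shows "\<alpha> x \<in> Arr D" "Dom D (\<alpha> x) = fobj F x" "Cod D (\<alpha> x) = fobj G x"
  using assms by (auto simp: nat_trans_def hom_def)

lemma nat_trans_natural:
  "\<lbrakk>nat_trans C D F G \<alpha>; f \<in> hom C x y\<rbrakk> \<Longrightarrow> farr G f \<cdot>\<^bsub>D\<^esub> \<alpha> x = \<alpha> y \<cdot>\<^bsub>D\<^esub> farr F f"
  by (auto simp: nat_trans_def)

lemma Obj_fun_cat: "F \<in> Obj (fun_cat C D) \<longleftrightarrow> cat_functor C D F"
  by (simp add: fun_cat_def)

lemma hom_fun_cat: "hom (fun_cat C D) F G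
    = {(F', G', \<alpha>). F' = F \<and> G' = G \<and> cat_functor C D F \<and> cat_functor C D G \<and> nat_trans C D F G \<alpha>}"
  by (auto simp: fun_cat_def hom_triple_cat)

lemma category_fun_cat:
  fixes C :: "('o, 'a) cat" and D :: "('p, 'b) cat"
  assumes "category C" "category D"
  shows "category (fun_cat C D)"
  unfolding fun_cat_def
proof (rule category_triple_cat)
  interpret C: category C by fact
  interpret D: category D by fact
  fix F :: "('o, 'a, 'p, 'b) func" assume "F \<in> {F. cat_functor C D F}"
  then interpret F: cat_functor C D F by simp
  show "(\<lambda>x \<in> Obj C. Idn D (fobj F x)) \<in> {\<alpha>. nat_trans C D F F \<alpha>}"
    by (auto simp: nat_trans_def hom_def)
  fix G :: "('o, 'a, 'p, 'b) func" assume "G \<in> {F. cat_functor C D F}"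
  then interpret G: cat_functor C D G by simp
  fix \<alpha> assume "\<alpha> \<in> {\<alpha>. nat_trans C D F G \<alpha>}"
  then have \<alpha>: "nat_trans C D F G \<alpha>" by simp
  note [simp] = nat_transD[OF \<alpha>]
  have \<alpha>_ext: "\<alpha> \<in> extensional (Obj C)" using \<alpha> by (simp add: nat_trans_def)
  then show "(\<lambda>x \<in> Obj C. \<alpha> x \<cdot>\<^bsub>D\<^esub> (\<lambda>x \<in> Obj C. Idn D (fobj F x)) x) = \<alpha>"
    "(\<lambda>x \<in> Obj C. (\<lambda>x \<in> Obj C. Idn D (fobj G x)) x \<cdot>\<^bsub>D\<^esub> \<alpha> x) = \<alpha>"
    by (auto simp: extensional_def intro!: ext)
  fix H :: "('o, 'a, 'p, 'b) func" assume "H \<in> {F. cat_functor C D F}"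
  then interpret H: cat_functor C D H by simp
  fix \<beta> assume "\<beta> \<in> {\<alpha>. nat_trans C D G H \<alpha>}"
  then have \<beta>: "nat_trans C D G H \<beta>" by simp
  note [simp] = nat_transD[OF \<beta>]
  have "farr H f \<cdot>\<^bsub>D\<^esub> (\<beta> x \<cdot>\<^bsub>D\<^esub> \<alpha> x) = \<beta> y \<cdot>\<^bsub>D\<^esub> \<alpha> y \<cdot>\<^bsub>D\<^esub> farr F f" if f: "f \<in> hom C x y" for f x y
  proof -
    have [simp]: "f \<in> Arr C" "Dom C f = x" "Cod C f = y" "x \<in> Obj C" "y \<in> Obj C"
      using f C.dom_cod by (auto simp: hom_def)
    have "farr H f \<cdot>\<^bsub>D\<^esub> (\<beta> x \<cdot>\<^bsub>D\<^esub> \<alpha> x) = (farr H f \<cdot>\<^bsub>D\<^esub> \<beta> x) \<cdot>\<^bsub>D\<^esub> \<alpha> x" by simp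
    also have "\<dots> = \<beta> y \<cdot>\<^bsub>D\<^esub> (farr G f \<cdot>\<^bsub>D\<^esub> \<alpha> x)" by (simp add: nat_trans_natural[OF \<beta> f])
    also have "\<dots> = \<beta> y \<cdot>\<^bsub>D\<^esub> \<alpha> y \<cdot>\<^bsub>D\<^esub> farr F f" by (simp add: nat_trans_natural[OF \<alpha> f])
    finally show ?thesis .
  qed
  then show "(\<lambda>x \<in> Obj C. \<beta> x \<cdot>\<^bsub>D\<^esub> \<alpha> x) \<in> {\<alpha>. nat_trans C D F H \<alpha>}"
    by (auto simp: nat_trans_def hom_def)
next
  interpret C: category C by fact
  interpret D: category D by fact
  fix F G H E :: "('o, 'a, 'p, 'b) func" and \<alpha> \<beta> \<gamma>
  assume "\<alpha> \<in> {\<alpha>. nat_trans C D F G \<alpha>}" "\<beta> \<in> {\<alpha>. nat_trans C D G H \<alpha>}" "\<gamma> \<in> {\<alpha>. nat_trans C D H E \<alpha>}"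
  then have n: "nat_trans C D F G \<alpha>" "nat_trans C D G H \<beta>" "nat_trans C D H E \<gamma>" by auto
  note [simp] = nat_transD[OF n(1)] nat_transD[OF n(2)] nat_transD[OF n(3)]
  show "(\<lambda>x \<in> Obj C. (\<lambda>x \<in> Obj C. \<gamma> x \<cdot>\<^bsub>D\<^esub> \<beta> x) x \<cdot>\<^bsub>D\<^esub> \<alpha> x)
    = (\<lambda>x \<in> Obj C. \<gamma> x \<cdot>\<^bsub>D\<^esub> (\<lambda>x \<in> Obj C. \<beta> x \<cdot>\<^bsub>D\<^esub> \<alpha> x) x)"
    by auto
qed

lemma nat_iso_fun_cat:
  fixes C :: "('o, 'a) cat" and D :: "('p, 'b) cat"
  assumes F: "cat_functor C D F" and G: "cat_functor C D G" and \<alpha>: "nat_trans C D F G \<alpha>"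
    and iso: "\<And>x. x \<in> Obj C \<Longrightarrow> is_iso D (\<alpha> x)"
  shows "is_iso (fun_cat C D) (F, G, \<alpha>)"
proof -
  interpret F: cat_functor C D F by fact
  interpret G: cat_functor C D G by fact
  interpret FC: category "fun_cat C D" by (rule category_fun_cat) unfold_locales
  let ?\<beta> = "\<lambda>x \<in> Obj C. inverse_arr D (\<alpha> x)"
  note [simp] = nat_transD[OF \<alpha>] iso
  have "farr F f \<cdot>\<^bsub>D\<^esub> inverse_arr D (\<alpha> x) = inverse_arr D (\<alpha> y) \<cdot>\<^bsub>D\<^esub> farr G f"
    if f: "f \<in> hom C x y" for f x y
  proof (rule F.D.iso_cancel_left[of "\<alpha> y"])
    have [simp]: "f \<in> Arr C" "Dom C f = x" "Cod C f = y" "x \<in> Obj C" "y \<in> Obj C"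
      using f F.C.dom_cod by (auto simp: hom_def)
    show "is_iso D (\<alpha> y)" "farr F f \<cdot>\<^bsub>D\<^esub> inverse_arr D (\<alpha> x) \<in> Arr D"
      "inverse_arr D (\<alpha> y) \<cdot>\<^bsub>D\<^esub> farr G f \<in> Arr D"
      "Cod D (farr F f \<cdot>\<^bsub>D\<^esub> inverse_arr D (\<alpha> x)) = Dom D (\<alpha> y)"
      "Cod D (inverse_arr D (\<alpha> y) \<cdot>\<^bsub>D\<^esub> farr G f) = Dom D (\<alpha> y)" by simp_all
    have "\<alpha> y \<cdot>\<^bsub>D\<^esub> (farr F f \<cdot>\<^bsub>D\<^esub> inverse_arr D (\<alpha> x)) = (\<alpha> y \<cdot>\<^bsub>D\<^esub> farr F f) \<cdot>\<^bsub>D\<^esub> inverse_arr D (\<alpha> x)"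
      by simp
    also have "\<dots> = farr G f" by (simp flip: nat_trans_natural[OF \<alpha> f])
    finally show "\<alpha> y \<cdot>\<^bsub>D\<^esub> (farr F f \<cdot>\<^bsub>D\<^esub> inverse_arr D (\<alpha> x)) = \<alpha> y \<cdot>\<^bsub>D\<^esub> (inverse_arr D (\<alpha> y) \<cdot>\<^bsub>D\<^esub> farr G f)"
      by simp
  qed
  then have "nat_trans C D G F ?\<beta>"
    using F.C.dom_cod by (auto simp: nat_trans_def hom_def)
  then have "(G, F, ?\<beta>) \<in> hom (fun_cat C D) G F" "(F, G, \<alpha>) \<in> hom (fun_cat C D) F G"
    using F G \<alpha> by (auto simp: hom_fun_cat)
  then show ?thesis
    by (intro FC.is_isoI[of _ F G "(G, F, ?\<beta>)"]) (auto simp: fun_cat_def)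
qed

lemma is_iso_component:
  fixes C :: "('o, 'a) cat" and D :: "('p, 'b) cat"
  assumes iso: "is_iso (fun_cat C D) (F, G, \<alpha>)" and x: "x \<in> Obj C"
  shows "is_iso D (\<alpha> x)"
proof -
  obtain \<beta> where \<alpha>: "nat_trans C D F G \<alpha>" and \<beta>: "nat_trans C D G F \<beta>"
    and eq: "(\<lambda>x \<in> Obj C. \<beta> x \<cdot>\<^bsub>D\<^esub> \<alpha> x) = (\<lambda>x \<in> Obj C. Idn D (fobj F x))"
      "(\<lambda>x \<in> Obj C. \<alpha> x \<cdot>\<^bsub>D\<^esub> \<beta> x) = (\<lambda>x \<in> Obj C. Idn D (fobj G x))"
    and F: "cat_functor C D F"
    using iso by (auto simp: is_iso_def fun_cat_def hom_triple_cat)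
  interpret F: cat_functor C D F by (rule F)
  have "\<beta> x \<cdot>\<^bsub>D\<^esub> \<alpha> x = Idn D (fobj F x)" "\<alpha> x \<cdot>\<^bsub>D\<^esub> \<beta> x = Idn D (fobj G x)"
    using fun_cong[OF eq(1), of x] fun_cong[OF eq(2), of x] x by simp_all
  then show ?thesis
    using nat_transD[OF \<alpha> x] nat_transD[OF \<beta> x]
    by (intro F.D.is_isoI[of "\<alpha> x" "fobj F x" "fobj G x" "\<beta> x"]) (auto simp: hom_def)
qed

text \<open>Functoriality of \<open>E\<close> is a conclusion: conjugates of the arrows of a functor
  compose correctly. This saves checking the functor axioms for the image under
  \<open>\<Phi>\<close> separately.\<close>

lemma conjugate_functor:
  fixes J :: "('o, 'a) cat" and C :: "('p, 'b) cat"
  assumes "cat_functor J C F"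
    and \<psi>: "\<And>x. x \<in> Obj J \<Longrightarrow> is_iso C (\<psi> x)" "\<And>x. x \<in> Obj J \<Longrightarrow> \<psi> x \<in> hom C (fobj E x) (fobj F x)"
    and E: "\<And>f x y. f \<in> hom J x y \<Longrightarrow> farr E f = inverse_arr C (\<psi> y) \<cdot>\<^bsub>C\<^esub> (farr F f \<cdot>\<^bsub>C\<^esub> \<psi> x)"
  shows "cat_functor J C E" and "isomorphic (fun_cat J C) F E"
proof -
  interpret F: cat_functor J C F by fact
  have [simp]: "\<psi> x \<in> Arr C" "Dom C (\<psi> x) = fobj E x" "Cod C (\<psi> x) = fobj F x" "fobj E x \<in> Obj C"
    if "x \<in> Obj J" for x
    using \<psi>(2)[OF that] F.D.Dom_Obj[of "\<psi> x"] by (auto simp: hom_def)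
  note [simp] = \<psi>(1)
  have arr: "f \<in> Arr J \<and> Dom J f = x \<and> Cod J f = y \<and> x \<in> Obj J \<and> y \<in> Obj J" if "f \<in> hom J x y" for f x y
    using that F.C.dom_cod by (auto simp: hom_def)
  show E_functor: "cat_functor J C E"
  proof
    fix f x y assume f: "f \<in> hom J x y"
    show "farr E f \<in> hom C (fobj E x) (fobj E y)"
      using arr[OF f] by (auto simp: E[OF f] hom_def)
  next
    fix x assume x: "x \<in> Obj J"
    then have "Idn J x \<in> hom J x x" by (auto simp: hom_def)
    then show "farr E (Idn J x) = Idn C (fobj E x)"
      using x by (simp add: E F.farr_id)
  next
    fix f g x y z assume fg: "f \<in> hom J x y" "g \<in> hom J y z"
    then have gf: "Comp J g f \<in> hom J x z" by (rule F.C.comp_hom)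
    show "farr E (Comp J g f) = farr E g \<cdot>\<^bsub>C\<^esub> farr E f"
      using arr[OF fg(1)] arr[OF fg(2)] by (simp add: E[OF gf] E[OF fg(1)] E[OF fg(2)] F.farr_comp[OF fg])
  qed simp
  let ?\<alpha> = "\<lambda>x \<in> Obj J. inverse_arr C (\<psi> x)"
  have "nat_trans J C F E ?\<alpha>"
    unfolding nat_trans_def
  proof (intro conjI ballI allI)
    fix f x y assume f: "f \<in> hom J x y"
    show "farr E f \<cdot>\<^bsub>C\<^esub> ?\<alpha> x = ?\<alpha> y \<cdot>\<^bsub>C\<^esub> farr F f"
      using arr[OF f] by (simp add: E[OF f])
  qed (auto simp: hom_def)
  then have "is_iso (fun_cat J C) (F, E, ?\<alpha>)" "(F, E, ?\<alpha>) \<in> hom (fun_cat J C) F E"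
    using E_functor assms(1) by (auto simp: hom_fun_cat intro: nat_iso_fun_cat)
  then show "isomorphic (fun_cat J C) F E" unfolding isomorphic_def by blast
qed

section \<open>The category of enriched categories\<close>

lemma wfun_ext:
  fixes F G :: "('s, 'a) wfun"
  assumes "wfobj F \<in> extensional S" "wfobj G \<in> extensional S"
    and "wfhom F \<in> extensional S" "wfhom G \<in> extensional S"
    and "\<And>a. a \<in> S \<Longrightarrow> wfhom F a \<in> extensional S" "\<And>a. a \<in> S \<Longrightarrow> wfhom G a \<in> extensional S"
    and "\<And>a. a \<in> S \<Longrightarrow> wfobj F a = wfobj G a"
    and "\<And>a b. \<lbrakk>a \<in> S; b \<in> S\<rbrakk> \<Longrightarrow> wfhom F a b = wfhom G a b"
  shows "F = G"
proof -
  have "wfobj F = wfobj G" using assms(1,2,7) by (rule extensionalityI)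
  moreover have "wfhom F = wfhom G"
    using assms(3,4)
  proof (rule extensionalityI)
    fix a assume "a \<in> S"
    with assms(5,6,8) show "wfhom F a = wfhom G a" by (blast intro: extensionalityI)
  qed
  ultimately show ?thesis by (intro wfun.equality) auto
qed

context monoidal_category
begin

lemma wfunctorD:
  assumes "wfunctor W A B F"
  shows "wcategory W A" "wcategory W B"
    "wfobj F \<in> extensional (wobj A)"
    "a \<in> wobj A \<Longrightarrow> wfobj F a \<in> wobj B"
    "\<lbrakk>a \<in> wobj A; b \<in> wobj A\<rbrakk> \<Longrightarrow> wfhom F a b \<in> Arr W"
    "\<lbrakk>a \<in> wobj A; b \<in> wobj A\<rbrakk> \<Longrightarrow> Dom W (wfhom F a b) = whom A a b"
    "\<lbrakk>a \<in> wobj A; b \<in> wobj A\<rbrakk> \<Longrightarrow> Cod W (wfhom F a b) = whom B (wfobj F a) (wfobj F b)"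
proof -
  interpret F: wfunctor W A B F by fact
  show "wcategory W A" "wcategory W B" by unfold_locales
  show "wfobj F \<in> extensional (wobj A)" using F.wfobj_ext by (auto simp: PiE_def)
  show "a \<in> wobj A \<Longrightarrow> wfobj F a \<in> wobj B" using F.wfobj_ext by auto
  assume "a \<in> wobj A" "b \<in> wobj A"
  from F.wfhom_hom[OF this] show "wfhom F a b \<in> Arr W" "Dom W (wfhom F a b) = whom A a b"
    "Cod W (wfhom F a b) = whom B (wfobj F a) (wfobj F b)" by (auto simp: hom_def)
qed

lemma wcategoryD:
  assumes "wcategory W A"
  shows "\<lbrakk>a \<in> wobj A; b \<in> wobj A\<rbrakk> \<Longrightarrow> whom A a b \<in> Obj W"
    "\<lbrakk>a \<in> wobj A; b \<in> wobj A; c \<in> wobj A\<rbrakk> \<Longrightarrow> wcomp A a b c \<in> Arr W"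
    "\<lbrakk>a \<in> wobj A; b \<in> wobj A; c \<in> wobj A\<rbrakk> \<Longrightarrow> Dom W (wcomp A a b c) = whom A a b \<otimes> whom A b c"
    "\<lbrakk>a \<in> wobj A; b \<in> wobj A; c \<in> wobj A\<rbrakk> \<Longrightarrow> Cod W (wcomp A a b c) = whom A a c"
    "a \<in> wobj A \<Longrightarrow> wid A a \<in> Arr W"
    "a \<in> wobj A \<Longrightarrow> Dom W (wid A a) = munit W"
    "a \<in> wobj A \<Longrightarrow> Cod W (wid A a) = whom A a a"
proof -
  interpret A: wcategory W A by fact
  show "\<lbrakk>a \<in> wobj A; b \<in> wobj A\<rbrakk> \<Longrightarrow> whom A a b \<in> Obj W" by (rule A.whom_Obj)
  show "\<lbrakk>a \<in> wobj A; b \<in> wobj A; c \<in> wobj A\<rbrakk> \<Longrightarrow> wcomp A a b c \<in> Arr W"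
    "\<lbrakk>a \<in> wobj A; b \<in> wobj A; c \<in> wobj A\<rbrakk> \<Longrightarrow> Dom W (wcomp A a b c) = whom A a b \<otimes> whom A b c"
    "\<lbrakk>a \<in> wobj A; b \<in> wobj A; c \<in> wobj A\<rbrakk> \<Longrightarrow> Cod W (wcomp A a b c) = whom A a c"
    using A.wcomp_hom[of a b c] by (auto simp: hom_def)
  show "a \<in> wobj A \<Longrightarrow> wid A a \<in> Arr W"
    "a \<in> wobj A \<Longrightarrow> Dom W (wid A a) = munit W"
    "a \<in> wobj A \<Longrightarrow> Cod W (wid A a) = whom A a a"
    using A.wid_hom[of a] by (auto simp: hom_def)
qed

lemma wfunctor_id:
  assumes "wcategory W A"
  shows "wfunctor W A A \<lparr>wfobj = (\<lambda>a \<in> wobj A. a), wfhom = (\<lambda>a \<in> wobj A. \<lambda>b \<in> wobj A. Idn W (whom A a b))\<rparr>"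
proof -
  interpret A: wcategory W A by fact
  note [simp] = wcategoryD[OF assms]
  show ?thesis by unfold_locales (auto simp: hom_def)
qed

lemma wfunctor_comp:
  assumes F: "wfunctor W A B F" and G: "wfunctor W B C G"
  shows "wfunctor W A C \<lparr>wfobj = compose (wobj A) (wfobj G) (wfobj F),
    wfhom = (\<lambda>a \<in> wobj A. \<lambda>b \<in> wobj A. wfhom G (wfobj F a) (wfobj F b) \<cdot> wfhom F a b)\<rparr>"
proof -
  interpret F: wfunctor W A B F by fact
  interpret G: wfunctor W B C G by fact
  note [simp] = wfunctorD(4-7)[OF F] wfunctorD(4-7)[OF G] wcategoryD[OF wfunctorD(1)[OF F]]
    wcategoryD[OF wfunctorD(1)[OF G]] wcategoryD[OF wfunctorD(2)[OF G]]
  have comp: "(wfhom G (wfobj F a) (wfobj F c) \<cdot> wfhom F a c) \<cdot> wcomp A a b c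
    = wcomp C (wfobj G (wfobj F a)) (wfobj G (wfobj F b)) (wfobj G (wfobj F c)) \<cdot>
      ((wfhom G (wfobj F a) (wfobj F b) \<cdot> wfhom F a b) \<boxtimes> (wfhom G (wfobj F b) (wfobj F c) \<cdot> wfhom F b c))"
    if [simp]: "a \<in> wobj A" "b \<in> wobj A" "c \<in> wobj A" for a b c
  proof -
    have "(wfhom G (wfobj F a) (wfobj F c) \<cdot> wfhom F a c) \<cdot> wcomp A a b c
      = (wfhom G (wfobj F a) (wfobj F c) \<cdot> wcomp B (wfobj F a) (wfobj F b) (wfobj F c)) \<cdot> (wfhom F a b \<boxtimes> wfhom F b c)"
      by (simp add: F.wfhom_comp)
    then show ?thesis by (simp add: G.wfhom_comp)
  qed
  have unit: "(wfhom G (wfobj F a) (wfobj F a) \<cdot> wfhom F a a) \<cdot> wid A a = wid C (wfobj G (wfobj F a))"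
    if [simp]: "a \<in> wobj A" for a
    by (simp add: F.wfhom_id G.wfhom_id)
  show ?thesis
    by unfold_locales (auto simp: hom_def compose_def comp unit simp del: comp_assoc_Arr)
qed

lemma wfun_eqI:
  fixes F G :: "('s, 'a) wfun"
  assumes "wfunctor W A B F" "wfunctor W A B' G"
    and "\<And>a. a \<in> wobj A \<Longrightarrow> wfobj F a = wfobj G a"
    and "\<And>a b. \<lbrakk>a \<in> wobj A; b \<in> wobj A\<rbrakk> \<Longrightarrow> wfhom F a b = wfhom G a b"
  shows "F = G"
proof -
  interpret F: wfunctor W A B F by fact
  interpret G: wfunctor W A B' G by fact
  show ?thesis
    using F.wfobj_ext G.wfobj_ext F.wfhom_ext G.wfhom_ext assms(3,4)
    by (intro wfun_ext[of F "wobj A"]) (simp_all add: PiE_def)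
qed

end

lemma category_wcat_cat:
  fixes W :: "('o, 'a) mcat"
  assumes "monoidal_category W"
  shows "category (wcat_cat W :: (('s, 'o, 'a) wcat, ('s, 'o, 'a) warr) cat)"
  unfolding wcat_cat_def
proof (rule category_triple_cat)
  interpret monoidal_category W by fact
  fix A :: "('s, 'o, 'a) wcat" assume "A \<in> {A. wcategory W A}"
  then have A: "wcategory W A" by simp
  let ?id = "\<lambda>A :: ('s, 'o, 'a) wcat. \<lparr>wfobj = (\<lambda>a \<in> wobj A. a), wfhom = (\<lambda>a \<in> wobj A. \<lambda>b \<in> wobj A. Idn W (whom A a b))\<rparr>"
  let ?c = "\<lambda>(A :: ('s, 'o, 'a) wcat) (G :: ('s, 'a) wfun) (F :: ('s, 'a) wfun). \<lparr>wfobj = compose (wobj A) (wfobj G) (wfobj F),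
    wfhom = (\<lambda>a \<in> wobj A. \<lambda>b \<in> wobj A. Comp W (wfhom G (wfobj F a) (wfobj F b)) (wfhom F a b))\<rparr>"
  show "?id A \<in> {F. wfunctor W A A F}" using wfunctor_id[OF A] by simp
  fix B :: "('s, 'o, 'a) wcat" and F assume B: "B \<in> {A. wcategory W A}" and "F \<in> {F. wfunctor W A B F}"
  then have F: "wfunctor W A B F" by simp
  note [simp] = wfunctorD(4-7)[OF F] wcategoryD[OF wfunctorD(1)[OF F]] wcategoryD[OF wfunctorD(2)[OF F]]
  show "?c A F (?id A) = F"
    using wfunctor_comp[OF wfunctor_id[OF A] F] F by (rule wfun_eqI) (simp_all add: compose_def)
  show "?c A (?id B) F = F"
    using wfunctor_comp[OF F wfunctor_id[OF wfunctorD(2)[OF F]]] F by (rule wfun_eqI) (simp_all add: compose_def)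
  fix C :: "('s, 'o, 'a) wcat" and G assume "G \<in> {F. wfunctor W B C F}"
  then have G: "wfunctor W B C G" by simp
  show "?c A G F \<in> {F. wfunctor W A C F}" using wfunctor_comp[OF F G] by simp
  note [simp] = wfunctorD(4-7)[OF G]
  fix D :: "('s, 'o, 'a) wcat" and H assume "H \<in> {F. wfunctor W C D F}"
  then have H: "wfunctor W C D H" by simp
  note [simp] = wfunctorD(4-7)[OF H]
  show "?c A (?c B H G) F = ?c A H (?c A G F)"
    by (rule wfun_eqI[OF wfunctor_comp[OF F wfunctor_comp[OF G H]] wfunctor_comp[OF wfunctor_comp[OF F G] H]])
      (simp_all add: compose_def)
qed

lemma hom_wcat_cat: "hom (wcat_cat W) A B
   = {(A', B', F). A' = A \<and> B' = B \<and> wcategory W A \<and> wcategory W B \<and> wfunctor W A B F}"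
  by (auto simp: wcat_cat_def hom_triple_cat)

lemma Obj_wcat_cat [simp]: "A \<in> Obj (wcat_cat W) \<longleftrightarrow> wcategory W A"
  by (simp add: wcat_cat_def)

lemma wcat_cat_simps [simp]:
  "Dom (wcat_cat W) (A, B, F) = A" "Cod (wcat_cat W) (A, B, F) = B"
  "Idn (wcat_cat W) A = (A, A, \<lparr>wfobj = (\<lambda>a \<in> wobj A. a), wfhom = (\<lambda>a \<in> wobj A. \<lambda>b \<in> wobj A. Idn W (whom A a b))\<rparr>)"
  "Comp (wcat_cat W) (B', C, G) (A, B, F) = (A, C, \<lparr>wfobj = compose (wobj A) (wfobj G) (wfobj F),
     wfhom = (\<lambda>a \<in> wobj A. \<lambda>b \<in> wobj A. wfhom G (wfobj F a) (wfobj F b) \<cdot>\<^bsub>W\<^esub> wfhom F a b)\<rparr>)"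
  by (simp_all add: wcat_cat_def)

text \<open>\<open>X\<close> is raw data at first. Its associativity and unit laws hold because they
  hold in \<open>B\<close> and the isomorphisms \<psi>, compatible with compositions and units, can
  be cancelled.\<close>

lemma wcategory_transport:
  fixes W :: "('o, 'a) mcat" (structure) and X B :: "('s, 'o, 'a) wcat"
  assumes B: "wcategory W B" and bij: "bij_betw h (wobj X) (wobj B)"
    and \<psi>: "\<And>a b. \<lbrakk>a \<in> wobj X; b \<in> wobj X\<rbrakk> \<Longrightarrow> is_iso W (\<psi> a b) \<and> \<psi> a b \<in> hom W (whom X a b) (whom B (h a) (h b))"
    and K: "\<And>a b c. \<lbrakk>a \<in> wobj X; b \<in> wobj X; c \<in> wobj X\<rbrakk>
      \<Longrightarrow> wcomp X a b c \<in> hom W (whom X a b \<otimes> whom X b c) (whom X a c)"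
    and U: "\<And>a. a \<in> wobj X \<Longrightarrow> wid X a \<in> hom W (munit W) (whom X a a)"
    and \<psi>K: "\<And>a b c. \<lbrakk>a \<in> wobj X; b \<in> wobj X; c \<in> wobj X\<rbrakk>
      \<Longrightarrow> \<psi> a c \<cdot> wcomp X a b c = wcomp B (h a) (h b) (h c) \<cdot> (\<psi> a b \<boxtimes> \<psi> b c)"
    and \<psi>U: "\<And>a. a \<in> wobj X \<Longrightarrow> \<psi> a a \<cdot> wid X a = wid B (h a)"
  defines "F \<equiv> \<lparr>wfobj = (\<lambda>a \<in> wobj X. h a), wfhom = (\<lambda>a \<in> wobj X. \<lambda>b \<in> wobj X. \<psi> a b)\<rparr>"
  shows "wcategory W X" and "(X, B, F) \<in> hom (wcat_cat W) X B" and "is_iso (wcat_cat W) (X, B, F)"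
proof -
  interpret B: wcategory W B by fact
  have h [simp]: "h a \<in> wobj B" if "a \<in> wobj X" for a using bij that by (auto simp: bij_betw_def)
  note [simp] = B.wcategoryD[OF B]
  have [simp]: "is_iso W (\<psi> a b)" "\<psi> a b \<in> Arr W" "Dom W (\<psi> a b) = whom X a b"
    "Cod W (\<psi> a b) = whom B (h a) (h b)" "whom X a b \<in> Obj W" if "a \<in> wobj X" "b \<in> wobj X" for a b
    using \<psi>[OF that] B.Dom_Obj[of "\<psi> a b"] by (auto simp: hom_def)
  have [simp]: "wcomp X a b c \<in> Arr W" "Dom W (wcomp X a b c) = whom X a b \<otimes> whom X b c"
    "Cod W (wcomp X a b c) = whom X a c" if "a \<in> wobj X" "b \<in> wobj X" "c \<in> wobj X" for a b c
    using K[OF that] by (auto simp: hom_def)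
  have [simp]: "wid X a \<in> Arr W" "Dom W (wid X a) = munit W" "Cod W (wid X a) = whom X a a"
    if "a \<in> wobj X" for a
    using U[OF that] by (auto simp: hom_def)
  show X: "wcategory W X"
  proof
    fix a b c d assume [simp]: "a \<in> wobj X" "b \<in> wobj X" "c \<in> wobj X" "d \<in> wobj X"
    let ?B = "\<lambda>a b c. wcomp B (h a) (h b) (h c)"
    have "\<psi> a d \<cdot> (wcomp X a c d \<cdot> (wcomp X a b c \<boxtimes> Idn W (whom X c d)))
      = (\<psi> a d \<cdot> wcomp X a c d) \<cdot> (wcomp X a b c \<boxtimes> Idn W (whom X c d))" by simp
    also have "\<dots> = ?B a c d \<cdot> ((\<psi> a c \<cdot> wcomp X a b c) \<boxtimes> \<psi> c d)"
      by (subst \<psi>K) simp_all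
    also have "\<dots> = (?B a c d \<cdot> (?B a b c \<boxtimes> Idn W (whom B (h c) (h d)))) \<cdot> ((\<psi> a b \<boxtimes> \<psi> b c) \<boxtimes> \<psi> c d)"
      by (subst \<psi>K) simp_all
    also have "\<dots> = ?B a b d \<cdot> ((Idn W (whom B (h a) (h b)) \<boxtimes> ?B b c d)
        \<cdot> (assoc W (whom B (h a) (h b)) (whom B (h b) (h c)) (whom B (h c) (h d)) \<cdot> ((\<psi> a b \<boxtimes> \<psi> b c) \<boxtimes> \<psi> c d)))"
      by (subst B.wcomp_assoc) simp_all
    also have "\<dots> = ?B a b d \<cdot> ((Idn W (whom B (h a) (h b)) \<boxtimes> ?B b c d)
        \<cdot> ((\<psi> a b \<boxtimes> (\<psi> b c \<boxtimes> \<psi> c d)) \<cdot> assoc W (whom X a b) (whom X b c) (whom X c d)))"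
      by (subst B.assoc_natural) simp_all
    also have "\<dots> = ?B a b d \<cdot> ((\<psi> a b \<boxtimes> (?B b c d \<cdot> (\<psi> b c \<boxtimes> \<psi> c d))) \<cdot> assoc W (whom X a b) (whom X b c) (whom X c d))"
      by simp
    also have "\<dots> = (?B a b d \<cdot> (\<psi> a b \<boxtimes> \<psi> b d)) \<cdot> ((Idn W (whom X a b) \<boxtimes> wcomp X b c d) \<cdot> assoc W (whom X a b) (whom X b c) (whom X c d))"
      by (subst \<psi>K[symmetric]) simp_all
    also have "\<dots> = \<psi> a d \<cdot> (wcomp X a b d \<cdot> ((Idn W (whom X a b) \<boxtimes> wcomp X b c d) \<cdot> assoc W (whom X a b) (whom X b c) (whom X c d)))"
      by (subst \<psi>K[symmetric]) simp_all
    finally show "wcomp X a c d \<cdot> (wcomp X a b c \<boxtimes> Idn W (whom X c d))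
        = wcomp X a b d \<cdot> ((Idn W (whom X a b) \<boxtimes> wcomp X b c d) \<cdot> assoc W (whom X a b) (whom X b c) (whom X c d))"
      by (rule B.iso_cancel_left[rotated -1]) simp_all
  next
    fix a b assume [simp]: "a \<in> wobj X" "b \<in> wobj X"
    have "\<psi> a b \<cdot> (wcomp X a a b \<cdot> (wid X a \<boxtimes> Idn W (whom X a b)))
      = (\<psi> a b \<cdot> wcomp X a a b) \<cdot> (wid X a \<boxtimes> Idn W (whom X a b))" by simp
    also have "\<dots> = wcomp B (h a) (h a) (h b) \<cdot> ((\<psi> a a \<cdot> wid X a) \<boxtimes> \<psi> a b)"
      by (subst \<psi>K) simp_all
    also have "\<dots> = (wcomp B (h a) (h a) (h b) \<cdot> (wid B (h a) \<boxtimes> Idn W (whom B (h a) (h b)))) \<cdot> (Idn W (munit W) \<boxtimes> \<psi> a b)"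
      by (subst \<psi>U) simp_all
    also have "\<dots> = \<psi> a b \<cdot> lunit W (whom X a b)"
      by (simp add: B.wid_left B.lunit_natural)
    finally show "wcomp X a a b \<cdot> (wid X a \<boxtimes> Idn W (whom X a b)) = lunit W (whom X a b)"
      by (rule B.iso_cancel_left[rotated -1]) simp_all
    have "\<psi> a b \<cdot> (wcomp X a b b \<cdot> (Idn W (whom X a b) \<boxtimes> wid X b))
      = (\<psi> a b \<cdot> wcomp X a b b) \<cdot> (Idn W (whom X a b) \<boxtimes> wid X b)" by simp
    also have "\<dots> = wcomp B (h a) (h b) (h b) \<cdot> (\<psi> a b \<boxtimes> (\<psi> b b \<cdot> wid X b))"
      by (subst \<psi>K) simp_all
    also have "\<dots> = (wcomp B (h a) (h b) (h b) \<cdot> (Idn W (whom B (h a) (h b)) \<boxtimes> wid B (h b))) \<cdot> (\<psi> a b \<boxtimes> Idn W (munit W))"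
      by (subst \<psi>U) simp_all
    also have "\<dots> = \<psi> a b \<cdot> runit W (whom X a b)"
      by (simp add: B.wid_right B.runit_natural)
    finally show "wcomp X a b b \<cdot> (Idn W (whom X a b) \<boxtimes> wid X b) = runit W (whom X a b)"
      by (rule B.iso_cancel_left[rotated -1]) simp_all
  qed (use K U in simp_all)
  interpret X: wcategory W X by (rule X)
  have F: "wfunctor W X B F"
    by unfold_locales (simp_all add: F_def \<psi>K \<psi>U hom_def)
  then show F_hom: "(X, B, F) \<in> hom (wcat_cat W) X B"
    using B X by (simp add: hom_wcat_cat)
  define k where "k = inv_into (wobj X) h"
  have hk [simp]: "h (k a) = a" "k a \<in> wobj X" if "a \<in> wobj B" for a
    using bij that unfolding k_def by (auto simp: bij_betw_def f_inv_into_f inv_into_into)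
  have kh [simp]: "k (h a) = a" if "a \<in> wobj X" for a
    using bij that unfolding k_def by (auto simp: bij_betw_def inv_into_f_f)
  define G where "G = \<lparr>wfobj = (\<lambda>a \<in> wobj B. k a), wfhom = (\<lambda>a \<in> wobj B. \<lambda>b \<in> wobj B. inverse_arr W (\<psi> (k a) (k b)))\<rparr>"
  have "inverse_arr W (\<psi> (k a) (k c)) \<cdot> wcomp B a b c
      = wcomp X (k a) (k b) (k c) \<cdot> (inverse_arr W (\<psi> (k a) (k b)) \<boxtimes> inverse_arr W (\<psi> (k b) (k c)))"
    if [simp]: "a \<in> wobj B" "b \<in> wobj B" "c \<in> wobj B" for a b c
  proof (rule B.iso_cancel_left[of "\<psi> (k a) (k c)"])
    have "\<psi> (k a) (k c) \<cdot> (wcomp X (k a) (k b) (k c) \<cdot> (inverse_arr W (\<psi> (k a) (k b)) \<boxtimes> inverse_arr W (\<psi> (k b) (k c))))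
       = (\<psi> (k a) (k c) \<cdot> wcomp X (k a) (k b) (k c)) \<cdot> (inverse_arr W (\<psi> (k a) (k b)) \<boxtimes> inverse_arr W (\<psi> (k b) (k c)))"
      by simp
    also have "\<dots> = wcomp B a b c" by (subst \<psi>K) simp_all
    finally show "\<psi> (k a) (k c) \<cdot> (inverse_arr W (\<psi> (k a) (k c)) \<cdot> wcomp B a b c) = \<psi> (k a) (k c)
      \<cdot> (wcomp X (k a) (k b) (k c) \<cdot> (inverse_arr W (\<psi> (k a) (k b)) \<boxtimes> inverse_arr W (\<psi> (k b) (k c))))" by simp
  qed simp_all
  moreover have "inverse_arr W (\<psi> (k a) (k a)) \<cdot> wid B a = wid X (k a)" if [simp]: "a \<in> wobj B" for a
    by (rule B.iso_cancel_left[of "\<psi> (k a) (k a)"]) (simp_all add: \<psi>U)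
  ultimately have G: "wfunctor W B X G"
    by unfold_locales (simp_all add: G_def hom_def)
  interpret WC: category "wcat_cat W :: (('s, 'o, 'a) wcat, ('s, 'o, 'a) warr) cat"
    by (rule category_wcat_cat) unfold_locales
  show "is_iso (wcat_cat W) (X, B, F)"
  proof (rule WC.is_isoI[OF F_hom, of "(B, X, G)"])
    show "(B, X, G) \<in> hom (wcat_cat W) B X" using B X G by (simp add: hom_wcat_cat)
    show "Comp (wcat_cat W) (B, X, G) (X, B, F) = Idn (wcat_cat W) X"
      by (auto simp: F_def G_def compose_def intro!: ext)
    show "Comp (wcat_cat W) (X, B, F) (B, X, G) = Idn (wcat_cat W) B"
      by (auto simp: F_def G_def compose_def intro!: ext)
  qed
qed

section \<open>Initial objects\<close>

text \<open>The diagram shape whose colimits are the initial objects; cocompleteness and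
  preservation of colimits are both applied to it.\<close>

definition empty_cat :: "('j, 'k) cat" where
  "empty_cat = \<lparr>Obj = {}, Arr = {}, Dom = undefined, Cod = undefined, Idn = undefined, Comp = undefined\<rparr>"

lemma empty_cat_simps [simp]: "Obj empty_cat = {}" "Arr empty_cat = {}" "hom empty_cat x y = {}"
  by (simp_all add: empty_cat_def hom_def)

lemma empty_cat_functor:
  fixes C :: "('o, 'a, 'z) cat_scheme"
  assumes "category C"
  shows "cat_functor (empty_cat :: ('j, 'k) cat) C F"
  using assms unfolding cat_functor_def cat_functor_axioms_def category_def by simp

lemma is_colimit_empty_cat:
  "is_colimit (empty_cat :: ('j, 'k) cat) C F c l \<longleftrightarrow> is_initial C c"
  by (auto simp: is_colimit_def is_cocone_def is_initial_def)

lemma initial_exists: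
  assumes "category C" "cocomplete TYPE('s) C"
  shows "\<exists>x. is_initial C x"
  using assms(2) empty_cat_functor[OF assms(1), where ?'j = 's and ?'k = 's]
  unfolding cocomplete_def by (metis is_colimit_empty_cat)

lemma initial_init_obj:
  assumes "category C" "cocomplete TYPE('s) C"
  shows "is_initial C (init_obj C)"
  unfolding init_obj_def using initial_exists[OF assms] by (rule someI_ex)

text \<open>An initial object is a colimit of the empty diagram, and tensoring on either side
  preserves that colimit.\<close>

lemma tensor_initial:
  fixes W :: "('o, 'a, 'z) mcat_scheme" (structure)
  assumes "category W" "tensor_preserves_colimits TYPE('s) W" "is_initial W x" "y \<in> Obj W"
  shows "is_initial W (x \<otimes> y)" "is_initial W (y \<otimes> x)"
proof -
  let ?F = "\<lparr>fobj = undefined, farr = undefined\<rparr> :: ('s, 's, 'o, 'a) func"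
  have "cat_functor (empty_cat :: ('s, 's) cat) W ?F \<and> is_colimit (empty_cat :: ('s, 's) cat) W ?F x undefined"
    using assms empty_cat_functor by (simp add: is_colimit_empty_cat)
  then show "is_initial W (x \<otimes> y)" "is_initial W (y \<otimes> x)"
    using assms(2,4) unfolding tensor_preserves_colimits_def
    by (metis is_colimit_empty_cat)+
qed

section \<open>Diagrams with the characterising properties\<close>

lemma hom_delta_cat: "hom delta_cat m n
   = {(m', n', f). m' = m \<and> n' = n \<and> simplex_map m n f \<and> f \<in> extensional {0..m}}"
  by (auto simp: delta_cat_def hom_triple_cat simplex_map_def PiE_def
      intro: simplex_map_le[unfolded simplex_map_def])

lemma Obj_delta_cat [simp]: "Obj delta_cat = UNIV"
  by (simp add: delta_cat_def)

lemma delta_cat_simps [simp]: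
  "Idn delta_cat n = (n, n, \<lambda>k \<in> {0..n}. k)"
  "Comp delta_cat (n', k, g) (m, n, f) = (m, k, compose {0..m} g f)"
  by (simp_all add: delta_cat_def)

lemma restrict_hom_delta: "simplex_map m n f \<Longrightarrow> (m, n, restrict f {0..m}) \<in> hom delta_cat m n"
  using simplex_map_cong[of m "restrict f {0..m}" f n] by (simp add: hom_delta_cat)

text \<open>Arrows of \<open>delta_cat\<close> are extensional, so the total functions of
  \<open>simplex_map\<close> are restricted before \<open>\<DD>\<close> is applied.\<close>

abbreviation diagram_map :: "('s, 'o, 'a) wdiagram \<Rightarrow> nat \<Rightarrow> nat \<Rightarrow> (nat \<Rightarrow> nat) \<Rightarrow> ('s, 'a) wfun" where
  "diagram_map \<DD> m n f \<equiv> snd (snd (farr \<DD> (m, n, restrict f {0..m})))"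

text \<open>Here \<open>v n i\<close> is the object of \<open>\<DD>\<^sup>n\<close> corresponding to the vertex \<open>i\<close> of \<open>[n]\<close>.\<close>

locale necklicial_diagram = monoidal_category W + \<DD>: cat_functor delta_cat "wcat_cat W" \<DD>
  for W :: "('o, 'a) mcat" (structure) and \<DD> :: "('s, 'o, 'a) wdiagram" +
  fixes v :: "nat \<Rightarrow> nat \<Rightarrow> 's"
  assumes v_bij: "bij_betw (v n) {0..n} (wobj (fobj \<DD> n))"
    and v_natural: "\<lbrakk>simplex_map m n f; i \<le> m\<rbrakk> \<Longrightarrow> wfobj (diagram_map \<DD> m n f) (v m i) = v n (f i)"
    and v_unit: "is_iso W (wid (fobj \<DD> 0) (v 0 0))"
begin

lemma v_wobj [simp]: "i \<le> n \<Longrightarrow> v n i \<in> wobj (fobj \<DD> n)"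
  using v_bij[of n] by (auto simp: bij_betw_def)

lemma wcategory_diagram: "wcategory W (fobj \<DD> n)"
  using \<DD>.fobj_Obj[of n] by simp

lemma farr_diagram:
  assumes "simplex_map m n f"
  shows "farr \<DD> (m, n, restrict f {0..m}) = (fobj \<DD> m, fobj \<DD> n, diagram_map \<DD> m n f)"
    and "wfunctor W (fobj \<DD> m) (fobj \<DD> n) (diagram_map \<DD> m n f)"
  using \<DD>.farr_hom[OF restrict_hom_delta[OF assms]] by (auto simp: hom_wcat_cat)

definition "hom_A n a b = whom (fobj \<DD> n) (v n a) (v n b)"
definition "hom_K n a b c = wcomp (fobj \<DD> n) (v n a) (v n b) (v n c)"
definition "hom_U n a = wid (fobj \<DD> n) (v n a)"
definition "hom_M m n f a b = wfhom (diagram_map \<DD> m n f) (v m a) (v m b)"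

text \<open>Indices \<open>a \<le> n\<close> replace the objects \<open>v n a\<close>. By
  \<open>v_natural\<close> the action of \<open>f\<close> ends in
  \<open>hom_A n (f a) (f b)\<close>, and \<open>v_unit\<close> becomes the invertibility of
  \<open>U 0 0\<close>.\<close>

sublocale necklicial_data W hom_A hom_K hom_U hom_M
proof
  fix a b n :: nat assume [simp]: "a \<le> n" "b \<le> n"
  interpret wcategory W "fobj \<DD> n" by (rule wcategory_diagram)
  show "hom_A n a b \<in> Obj W" by (simp add: hom_A_def whom_Obj)
  show "hom_K n a a b \<cdot> (hom_U n a \<boxtimes> Idn W (hom_A n a b)) = lunit W (hom_A n a b)"
    "hom_K n a b b \<cdot> (Idn W (hom_A n a b) \<boxtimes> hom_U n b) = runit W (hom_A n a b)"
    by (simp_all add: hom_A_def hom_K_def hom_U_def wid_left wid_right)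
  show "hom_M n n (\<lambda>i. i) a b = Idn W (hom_A n a b)"
    using \<DD>.farr_id[of n] by (simp add: hom_M_def hom_A_def)
  fix c assume [simp]: "c \<le> n"
  show "hom_K n a b c \<in> hom W (hom_A n a b \<otimes> hom_A n b c) (hom_A n a c)"
    by (simp add: hom_A_def hom_K_def wcomp_hom)
  fix d assume [simp]: "d \<le> n"
  show "hom_K n a c d \<cdot> (hom_K n a b c \<boxtimes> Idn W (hom_A n c d))
     = hom_K n a b d \<cdot> ((Idn W (hom_A n a b) \<boxtimes> hom_K n b c d) \<cdot> assoc W (hom_A n a b) (hom_A n b c) (hom_A n c d))"
    by (simp add: hom_A_def hom_K_def wcomp_assoc)
next
  fix a n :: nat assume "a \<le> n"
  then show "hom_U n a \<in> hom W (munit W) (hom_A n a a)"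
    using wcategory.wid_hom[OF wcategory_diagram, of "v n a" n] by (simp add: hom_A_def hom_U_def)
next
  fix m n :: nat and f assume f: "simplex_map m n f"
  interpret F: wfunctor W "fobj \<DD> m" "fobj \<DD> n" "diagram_map \<DD> m n f" by (rule farr_diagram(2)[OF f])
  fix a assume [simp]: "a \<le> m"
  show "hom_M m n f a a \<cdot> hom_U m a = hom_U n (f a)"
    using F.wfhom_id[of "v m a"] by (simp add: hom_M_def hom_U_def v_natural[OF f])
  fix b assume [simp]: "b \<le> m"
  show "hom_M m n f a b \<in> hom W (hom_A m a b) (hom_A n (f a) (f b))"
    using F.wfhom_hom[of "v m a" "v m b"] by (simp add: hom_M_def hom_A_def v_natural[OF f])
  { fix c assume [simp]: "c \<le> m"
    show "hom_M m n f a c \<cdot> hom_K m a b c = hom_K n (f a) (f b) (f c) \<cdot> (hom_M m n f a b \<boxtimes> hom_M m n f b c)"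
      using F.wfhom_comp[of "v m a" "v m b" "v m c"]
      by (simp add: hom_M_def hom_K_def v_natural[OF f]) }
  fix k g assume g: "simplex_map n k g"
  have "Comp delta_cat (n, k, restrict g {0..n}) (m, n, restrict f {0..m}) = (m, k, restrict (\<lambda>i. g (f i)) {0..m})"
    using f by (auto simp: compose_def)
  then have "farr \<DD> (m, k, restrict (\<lambda>i. g (f i)) {0..m})
      = Comp (wcat_cat W) (farr \<DD> (n, k, restrict g {0..n})) (farr \<DD> (m, n, restrict f {0..m}))"
    using \<DD>.farr_comp[OF restrict_hom_delta[OF f] restrict_hom_delta[OF g]] by simp
  then have "diagram_map \<DD> m k (\<lambda>i. g (f i)) = snd (snd (Comp (wcat_cat W)
      (fobj \<DD> n, fobj \<DD> k, diagram_map \<DD> n k g) (fobj \<DD> m, fobj \<DD> n, diagram_map \<DD> m n f)))"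
    using farr_diagram(1)[OF f] farr_diagram(1)[OF g] by simp
  then show "hom_M n k g (f a) (f b) \<cdot> hom_M m n f a b = hom_M m k (\<lambda>i. g (f i)) a b"
    by (simp add: hom_M_def v_natural[OF f])
next
  fix m n a b :: nat and f g :: "nat \<Rightarrow> nat" assume "\<And>i. i \<le> m \<Longrightarrow> f i = g i"
  then have "restrict f {0..m} = restrict g {0..m}" by (intro restrict_ext) simp
  then show "hom_M m n f a b = hom_M m n g a b" by (simp add: hom_M_def)
next
  show "is_iso W (hom_U 0 0)" using v_unit by (simp add: hom_U_def)
qed

end

lemma phi_wcat_simps [simp]:
  "wobj (phi_wcat \<iota> W D n) = \<iota> ` {0..n}"
  "inj \<iota> \<Longrightarrow> whom (phi_wcat \<iota> W D n) (\<iota> i) (\<iota> j) = phi_hom W D i j"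
  "inj \<iota> \<Longrightarrow> wcomp (phi_wcat \<iota> W D n) (\<iota> i) (\<iota> j) (\<iota> k) = phi_comp W D i j k"
  "wid (phi_wcat \<iota> W D n) a = eps D"
  by (simp_all add: phi_wcat_def)

text \<open>Adds properties 2 and 4 and the facts on initial objects drawn from the colimit
  hypotheses. An inert map is a translation \<open>k \<mapsto> i + k\<close>, whence the form of
  \<open>v_inert\<close>.\<close>

locale necklicial_diagram_initial = necklicial_diagram W \<DD> v
  for W :: "('o, 'a) mcat" (structure) and \<DD> :: "('s, 'o, 'a) wdiagram" and v +
  fixes \<iota> :: "nat \<Rightarrow> 's"
  assumes inj: "inj \<iota>"
    and init: "is_initial W (init_obj W)"
    and tensor_init: "\<lbrakk>is_initial W x; y \<in> Obj W\<rbrakk> \<Longrightarrow> is_initial W (x \<otimes> y) \<and> is_initial W (y \<otimes> x)"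
    and v_initial: "\<lbrakk>i < j; j \<le> n\<rbrakk> \<Longrightarrow> is_initial W (whom (fobj \<DD> n) (v n j) (v n i))"
    and v_inert: "i + d \<le> n \<Longrightarrow> is_iso W (wfhom (diagram_map \<DD> d n (\<lambda>k. i + k)) (v d 0) (v d d))"
begin

lemma inv_iota [simp]: "inv \<iota> (\<iota> i) = i"
  using inj by (rule inv_f_f)

interpretation F: strong_monoidal_functor nec W nec_functor
  by (rule strong_monoidal_nec_functor)

lemma A_initial: "\<lbrakk>i < j; j \<le> n\<rbrakk> \<Longrightarrow> is_initial W (hom_A n j i)"
  using v_initial by (simp add: hom_A_def)

text \<open>Below the diagonal both hom-objects are initial, one by the choice in
  \<open>phi_hom\<close> and the other by property 2, so the unique map between them is
  invertible.\<close>

definition phi_iso :: "nat \<Rightarrow> nat \<Rightarrow> nat \<Rightarrow> 'a" where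
  "phi_iso n i j = (if i \<le> j then psi n i j else the_hom W (init_obj W) (hom_A n i j))"

lemma phi_hom_Obj [simp]: "phi_hom W nec_functor i j \<in> Obj W"
  using init by (simp add: phi_hom_def initial_Obj del: nec_functor_simps)

lemma phi_hom_initial: "j < i \<Longrightarrow> is_initial W (phi_hom W nec_functor i j)"
  using init by (simp add: phi_hom_def)

lemma phi_iso:
  assumes "i \<le> n" "j \<le> n"
  shows "phi_iso n i j \<in> hom W (phi_hom W nec_functor i j) (hom_A n i j)" "is_iso W (phi_iso n i j)"
proof -
  show *: "phi_iso n i j \<in> hom W (phi_hom W nec_functor i j) (hom_A n i j)"
    using assms psi_simps[of i j n] the_hom_initial[OF init]
    by (auto simp: phi_iso_def phi_hom_def hom_def simp del: nec_functor_simps)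
  show "is_iso W (phi_iso n i j)"
  proof (cases "i \<le> j")
    case True
    then show ?thesis using psi_iso[of i j n] v_inert assms by (simp add: phi_iso_def hom_M_def)
  next
    case False
    then show ?thesis
      using initial_iso[OF phi_hom_initial A_initial *] assms by simp
  qed
qed

lemma phi_iso_simps [simp]:
  assumes "i \<le> n" "j \<le> n"
  shows "phi_iso n i j \<in> Arr W" "Dom W (phi_iso n i j) = phi_hom W nec_functor i j"
    "Cod W (phi_iso n i j) = hom_A n i j" "is_iso W (phi_iso n i j)"
  using phi_iso[OF assms] by (auto simp: hom_def)

lemma phi_comp_hom: "phi_comp W nec_functor i k j
    \<in> hom W (phi_hom W nec_functor i k \<otimes> phi_hom W nec_functor k j) (phi_hom W nec_functor i j)"
proof (cases "i \<le> k \<and> k \<le> j")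
  case True
  let ?g = "gaps (simplex (k - i))" and ?g' = "gaps (simplex (j - k))"
  have id: "joint_map (?g @ ?g') (gaps (simplex (j - i))) (\<lambda>l \<in> {0..j - i}. l)"
    using True by (intro joint_map_simplex simplex_mapI) simp_all
  have "(wedge (simplex (k - i)) (simplex (j - k)), simplex (j - i), \<lambda>l \<in> {0..j - i}. l)
      \<in> hom nec (wedge (simplex (k - i)) (simplex (j - k))) (simplex (j - i))"
    using True id by (simp add: hom_nec gaps_wedge)
  from F.farr_hom[OF this] F.mu_hom[of "simplex (k - i)" "simplex (j - k)"] show ?thesis
    using True by (auto simp: phi_comp_def phi_hom_def hom_def simp del: nec_functor_simps)
next
  case False
  then have "is_initial W (phi_hom W nec_functor i k \<otimes> phi_hom W nec_functor k j)"
    using tensor_init phi_hom_initial by (metis not_le phi_hom_Obj)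
  then show ?thesis
    unfolding phi_comp_def using False by (simp only: if_False) (intro the_hom_initial, simp_all)
qed

text \<open>Unless \<open>i \<le> k \<le> j\<close>, one tensor factor of the common source is
  initial, hence so is the source, and the two sides agree by uniqueness.\<close>

lemma phi_iso_comp:
  assumes [simp]: "i \<le> n" "k \<le> n" "j \<le> n"
  shows "phi_iso n i j \<cdot> phi_comp W nec_functor i k j = hom_K n i k j \<cdot> (phi_iso n i k \<boxtimes> phi_iso n k j)"
proof (cases "i \<le> k \<and> k \<le> j")
  case True
  then show ?thesis
    using psi_comp[of i k j n] by (simp add: phi_iso_def phi_comp_def del: nec_functor_simps)
next
  case False
  then have "is_initial W (phi_hom W nec_functor i k \<otimes> phi_hom W nec_functor k j)"
    using tensor_init phi_hom_initial by (metis not_le phi_hom_Obj)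
  then show ?thesis
    using phi_comp_hom[of i k j] by (rule_tac initial_unique) (auto simp: hom_def)
qed

definition psi_wfun :: "nat \<Rightarrow> ('s, 'o, 'a) warr" where
  "psi_wfun n = (phi_wcat \<iota> W nec_functor n, fobj \<DD> n,
     \<lparr>wfobj = (\<lambda>a \<in> \<iota> ` {0..n}. v n (inv \<iota> a)),
      wfhom = (\<lambda>a \<in> \<iota> ` {0..n}. \<lambda>b \<in> \<iota> ` {0..n}. phi_iso n (inv \<iota> a) (inv \<iota> b))\<rparr>)"

text \<open>Transport along \<open>phi_iso\<close> also supplies the enriched category axioms for
  \<open>phi_wcat\<close>, which are not checked directly.\<close>

lemma psi_wfun:
  shows "psi_wfun n \<in> hom (wcat_cat W) (phi_wcat \<iota> W nec_functor n) (fobj \<DD> n)"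
    and "is_iso (wcat_cat W) (psi_wfun n)"
proof -
  let ?X = "phi_wcat \<iota> W nec_functor n"
  have "bij_betw (v n \<circ> inv \<iota>) (\<iota> ` {0..n}) (wobj (fobj \<DD> n))"
    by (rule bij_betw_trans[OF _ v_bij])
      (simp add: bij_betw_def inj_on_def image_image)
  then have bij: "bij_betw (\<lambda>a. v n (inv \<iota> a)) (wobj ?X) (wobj (fobj \<DD> n))"
    by (simp add: comp_def)
  have eps: "Idn W (munit W) \<in> hom W (munit W) (phi_hom W nec_functor i i)" for i
    using F.eps_hom by (simp add: phi_hom_def)
  have unit: "phi_iso n i i \<cdot> Idn W (munit W) = hom_U n i" if "i \<le> n" for i
    using psi_unit[OF that] by (simp add: phi_iso_def)
  note * = wcategory_transport[OF wcategory_diagram bij, where \<psi> = "\<lambda>a b. phi_iso n (inv \<iota> a) (inv \<iota> b)"]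
  show "psi_wfun n \<in> hom (wcat_cat W) (phi_wcat \<iota> W nec_functor n) (fobj \<DD> n)"
    unfolding psi_wfun_def using inj phi_iso phi_comp_hom phi_iso_comp eps unit
    by (intro *(2)[simplified]) (auto simp flip: hom_A_def hom_K_def hom_U_def)
  show "is_iso (wcat_cat W) (psi_wfun n)"
    unfolding psi_wfun_def using inj phi_iso phi_comp_hom phi_iso_comp eps unit
    by (intro *(3)[simplified]) (auto simp flip: hom_A_def hom_K_def hom_U_def)
qed

text \<open>The action of \<open>phi_wfun\<close> on hom-objects, indexed by vertices instead of
  their images under \<open>\<iota>\<close>.\<close>

definition phi_map :: "(nat \<Rightarrow> nat) \<Rightarrow> nat \<Rightarrow> nat \<Rightarrow> 'a" where
  "phi_map f i j = (if i \<le> j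
     then farr nec_functor (simplex (j - i), simplex (f j - f i), \<lambda>k \<in> {0..j - i}. f (k + i) - f i)
     else the_hom W (phi_hom W nec_functor i j) (phi_hom W nec_functor (f i) (f j)))"

lemma phi_map_hom:
  assumes f: "simplex_map m n f" and "i \<le> m" "j \<le> m"
  shows "phi_map f i j \<in> hom W (phi_hom W nec_functor i j) (phi_hom W nec_functor (f i) (f j))"
proof (cases "i \<le> j")
  case True
  have le: "b + i \<le> m" if "b \<le> j - i" for b using that assms(2,3) True by linarith
  have "joint_map (gaps (simplex (j - i))) (gaps (simplex (f j - f i))) (\<lambda>k \<in> {0..j - i}. f (k + i) - f i)"
    using le True assms
    by (intro joint_map_simplex simplex_mapI) (auto intro!: diff_le_mono simplex_map_mono[OF f])
  then have "(simplex (j - i), simplex (f j - f i), \<lambda>k \<in> {0..j - i}. f (k + i) - f i)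
      \<in> hom nec (simplex (j - i)) (simplex (f j - f i))"
    by (simp add: hom_nec)
  from F.farr_hom[OF this] show ?thesis
    using True simplex_map_mono[OF f True assms(3)] by (simp add: phi_map_def phi_hom_def del: nec_functor_simps)
next
  case False
  then show ?thesis
    using the_hom_initial[OF phi_hom_initial[of j i] phi_hom_Obj] by (simp add: phi_map_def)
qed

lemma phi_iso_natural:
  assumes f: "simplex_map m n f" and "i \<le> m" "j \<le> m"
  shows "phi_iso n (f i) (f j) \<cdot> phi_map f i j = hom_M m n f i j \<cdot> phi_iso m i j"
proof (cases "i \<le> j")
  case True
  then show ?thesis
    using psi_natural[OF True assms(3) f] simplex_map_mono[OF f True assms(3)]
    by (simp add: phi_map_def phi_iso_def del: nec_functor_simps)
next
  case False
  have [simp]: "f i \<le> n" "f j \<le> n" using assms by auto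
  have "phi_map f i j \<in> Arr W" "Dom W (phi_map f i j) = phi_hom W nec_functor i j"
    "Cod W (phi_map f i j) = phi_hom W nec_functor (f i) (f j)"
    using phi_map_hom[OF assms] by (auto simp: hom_def)
  then show ?thesis
    using False assms by (intro initial_unique[OF phi_hom_initial[of j i]]) simp_all
qed

text \<open>The conjugate of \<open>farr \<DD> (m, n, f)\<close> is an enriched functor
  \<open>r\<close> for general reasons, so it suffices to identify its values: on objects by
  injectivity of \<open>v n\<close>, on hom-objects by cancelling \<open>phi_iso\<close> in
  \<open>phi_iso_natural\<close>.\<close>

lemma phi_wfun_eq:
  assumes f: "(m, n, f) \<in> hom delta_cat m n"
  shows "phi_wfun \<iota> W nec_functor (m, n, f) = Comp (wcat_cat W) (inverse_arr (wcat_cat W) (psi_wfun n))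
    (Comp (wcat_cat W) (farr \<DD> (m, n, f)) (psi_wfun m))"
proof -
  have sm: "simplex_map m n f" and res: "restrict f {0..m} = f"
    using f by (simp_all add: hom_delta_cat extensional_restrict)
  have Df: "farr \<DD> (m, n, f) = (fobj \<DD> m, fobj \<DD> n, diagram_map \<DD> m n f)"
    "wfunctor W (fobj \<DD> m) (fobj \<DD> n) (diagram_map \<DD> m n f)"
    using farr_diagram[OF sm] by (simp_all add: res)
  let ?X = "\<lambda>n. phi_wcat \<iota> W nec_functor n"
  have [simp]: "psi_wfun k \<in> Arr (wcat_cat W)" "Dom (wcat_cat W) (psi_wfun k) = ?X k"
    "Cod (wcat_cat W) (psi_wfun k) = fobj \<DD> k" "is_iso (wcat_cat W) (psi_wfun k)" for k
    using psi_wfun[of k] by (auto simp: hom_def)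
  have D_hom: "farr \<DD> (m, n, f) \<in> hom (wcat_cat W) (fobj \<DD> m) (fobj \<DD> n)"
    by (rule \<DD>.farr_hom[OF f])
  then have [simp]: "farr \<DD> (m, n, f) \<in> Arr (wcat_cat W)" "Dom (wcat_cat W) (farr \<DD> (m, n, f)) = fobj \<DD> m"
    "Cod (wcat_cat W) (farr \<DD> (m, n, f)) = fobj \<DD> n" by (auto simp: hom_def)
  let ?R = "Comp (wcat_cat W) (inverse_arr (wcat_cat W) (psi_wfun n)) (Comp (wcat_cat W) (farr \<DD> (m, n, f)) (psi_wfun m))"
  have R: "?R \<in> hom (wcat_cat W) (?X m) (?X n)" by (intro \<DD>.D.homI) simp_all
  then obtain r where r: "?R = (?X m, ?X n, r)" and wr: "wfunctor W (?X m) (?X n) r"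
    by (auto simp: hom_wcat_cat)
  interpret r: wfunctor W "?X m" "?X n" r by (rule wr)
  have "Comp (wcat_cat W) (psi_wfun n) ?R = Comp (wcat_cat W) (farr \<DD> (m, n, f)) (psi_wfun m)" by simp
  then have eq: "Comp (wcat_cat W) (psi_wfun n) (?X m, ?X n, r)
      = Comp (wcat_cat W) (fobj \<DD> m, fobj \<DD> n, diagram_map \<DD> m n f) (psi_wfun m)"
    by (simp only: r[symmetric] Df(1)[symmetric])
  have r_obj: "wfobj r (\<iota> i) = \<iota> (f i)" if i: "i \<le> m" for i
  proof -
    have "wfobj r (\<iota> i) \<in> \<iota> ` {0..n}" using wfunctorD(4)[OF wr, of "\<iota> i"] i by simp
    then obtain i' where i': "wfobj r (\<iota> i) = \<iota> i'" "i' \<le> n" by auto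
    have "wfobj (snd (snd (Comp (wcat_cat W) (psi_wfun n) (?X m, ?X n, r)))) (\<iota> i) = v n i'"
      using i i' by (simp add: psi_wfun_def compose_def)
    moreover have "wfobj (snd (snd (Comp (wcat_cat W) (psi_wfun n) (?X m, ?X n, r)))) (\<iota> i) = v n (f i)"
      unfolding eq using i by (simp add: psi_wfun_def compose_def v_natural[OF sm])
    ultimately have "v n i' = v n (f i)" by simp
    then have "i' = f i"
      using v_bij[of n] i' simplex_map_le[OF sm i] by (auto simp: bij_betw_def dest: inj_onD)
    then show ?thesis using i' by simp
  qed
  have r_hom: "wfhom r (\<iota> i) (\<iota> j) = phi_map f i j" if ij: "i \<le> m" "j \<le> m" for i j
  proof (rule iso_cancel_left[of "phi_iso n (f i) (f j)"])
    have [simp]: "f i \<le> n" "f j \<le> n" using sm ij by auto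
    show "is_iso W (phi_iso n (f i) (f j))" by simp
    show "wfhom r (\<iota> i) (\<iota> j) \<in> Arr W" "Cod W (wfhom r (\<iota> i) (\<iota> j)) = Dom W (phi_iso n (f i) (f j))"
      using wfunctorD(5,7)[OF wr, of "\<iota> i" "\<iota> j"] ij inj by (simp_all add: r_obj)
    show "phi_map f i j \<in> Arr W" "Cod W (phi_map f i j) = Dom W (phi_iso n (f i) (f j))"
      using phi_map_hom[OF sm ij] by (auto simp: hom_def)
    have "wfhom (snd (snd (Comp (wcat_cat W) (psi_wfun n) (?X m, ?X n, r)))) (\<iota> i) (\<iota> j)
        = phi_iso n (f i) (f j) \<cdot> wfhom r (\<iota> i) (\<iota> j)"
      using ij by (simp add: psi_wfun_def r_obj)
    moreover have "wfhom (snd (snd (Comp (wcat_cat W) (psi_wfun n) (?X m, ?X n, r)))) (\<iota> i) (\<iota> j)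
        = hom_M m n f i j \<cdot> phi_iso m i j"
      unfolding eq using ij by (simp add: psi_wfun_def hom_M_def)
    ultimately show "phi_iso n (f i) (f j) \<cdot> wfhom r (\<iota> i) (\<iota> j) = phi_iso n (f i) (f j) \<cdot> phi_map f i j"
      using phi_iso_natural[OF sm ij] by simp
  qed
  have "snd (snd (phi_wfun \<iota> W nec_functor (m, n, f))) = r"
  proof (rule wfun_ext[of _ "\<iota> ` {0..m}"])
    show "wfobj r \<in> extensional (\<iota> ` {0..m})" using wfunctorD(3)[OF wr] by simp
    show "wfhom r \<in> extensional (\<iota> ` {0..m})" using r.wfhom_ext(1) by simp
    show "wfhom r a \<in> extensional (\<iota> ` {0..m})" if "a \<in> \<iota> ` {0..m}" for a
      using r.wfhom_ext(2)[of a] that by simp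
  qed (auto simp: phi_wfun_def r_obj r_hom Let_def phi_map_def)
  then have "phi_wfun \<iota> W nec_functor (m, n, f) = (?X m, ?X n, r)" by (simp add: phi_wfun_def)
  then show ?thesis using r by simp
qed

lemma isomorphic_phi: "isomorphic (fun_cat delta_cat (wcat_cat W)) \<DD> (phi_obj \<iota> W nec_functor)"
proof (rule conjugate_functor(2)[where \<psi> = psi_wfun])
  show "cat_functor delta_cat (wcat_cat W) \<DD>" by unfold_locales
  fix F :: delta_arr and m n assume F: "F \<in> hom delta_cat m n"
  then obtain f where eq: "F = (m, n, f)" by (auto simp: hom_delta_cat)
  show "farr (phi_obj \<iota> W nec_functor) F = Comp (wcat_cat W) (inverse_arr (wcat_cat W) (psi_wfun n))
    (Comp (wcat_cat W) (farr \<DD> F) (psi_wfun m))"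
    using F phi_wfun_eq unfolding eq by (simp add: phi_obj_def)
qed (use psi_wfun in \<open>simp_all add: phi_obj_def\<close>)

end

section \<open>Isomorphisms of sets and of enriched categories\<close>

lemma hom_set_cat: "hom set_cat A B = {(A', B', f). A' = A \<and> B' = B \<and> f \<in> A \<rightarrow>\<^sub>E B}"
  by (auto simp: set_cat_def hom_triple_cat)

lemma set_cat_simps [simp]:
  "Obj set_cat = UNIV"
  "Dom set_cat (A, B, f) = A" "Cod set_cat (A, B, f) = B"
  "Idn set_cat A = (A, A, \<lambda>x \<in> A. x)"
  "Comp set_cat (B', C, g) (A, B, f) = (A, C, compose A g f)"
  by (simp_all add: set_cat_def)

lemma category_set_cat: "category set_cat"
  unfolding set_cat_def
  by (rule category_triple_cat)
    (auto simp: compose_def PiE_def extensional_def intro!: ext)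

lemma is_iso_set_cat_iff:
  assumes "f \<in> A \<rightarrow>\<^sub>E B"
  shows "is_iso set_cat (A, B, f) \<longleftrightarrow> bij_betw f A B"
proof
  assume "is_iso set_cat (A, B, f)"
  then obtain g where "g \<in> B \<rightarrow>\<^sub>E A" and gf: "compose A g f = (\<lambda>x \<in> A. x)" "compose B f g = (\<lambda>x \<in> B. x)"
    by (auto simp: is_iso_def hom_set_cat)
  moreover have "g (f x) = x" if "x \<in> A" for x using fun_cong[OF gf(1), of x] that by (simp add: compose_def)
  moreover have "f (g x) = x" if "x \<in> B" for x using fun_cong[OF gf(2), of x] that by (simp add: compose_def)
  ultimately show "bij_betw f A B"
    using assms by (intro bij_betw_byWitness[where f' = g]) auto
next
  assume bij: "bij_betw f A B"
  interpret category set_cat by (rule category_set_cat)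
  let ?g = "\<lambda>y \<in> B. inv_into A f y"
  have f: "(A, B, f) \<in> hom set_cat A B" using assms by (simp add: hom_set_cat)
  have g: "(B, A, ?g) \<in> hom set_cat B A"
    using bij_betwE[OF bij_betw_inv_into[OF bij]] by (auto simp: hom_set_cat)
  have "Comp set_cat (B, A, ?g) (A, B, f) = Idn set_cat A" "Comp set_cat (A, B, f) (B, A, ?g) = Idn set_cat B"
    using bij_betwE[OF bij] bij_betwE[OF bij_betw_inv_into[OF bij]]
      bij_betw_inv_into_left[OF bij] bij_betw_inv_into_right[OF bij]
    by (simp_all add: compose_def cong: restrict_cong)
  then show "is_iso set_cat (A, B, f)" by (rule is_isoI[OF f g])
qed

text \<open>If \<open>G\<close> inverts \<open>F\<close>, then
  \<open>wfhom G (wfobj F a) (wfobj F b)\<close> inverts \<open>wfhom F a b\<close>: one composite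
  is read off at \<open>a\<close> and \<open>b\<close>, the other at their images under
  \<open>F\<close>.\<close>

lemma wcat_iso:
  fixes W :: "('o, 'a) mcat" and A B :: "('s, 'o, 'a) wcat"
  assumes "is_iso (wcat_cat W) (A, B, F)"
  shows "wfunctor W A B F" "bij_betw (wfobj F) (wobj A) (wobj B)"
    "\<And>a b. \<lbrakk>a \<in> wobj A; b \<in> wobj A\<rbrakk> \<Longrightarrow> is_iso W (wfhom F a b)"
proof -
  obtain G where F: "wfunctor W A B F" and G: "wfunctor W B A G"
    and GF: "Comp (wcat_cat W) (B, A, G) (A, B, F) = Idn (wcat_cat W) A"
    and FG: "Comp (wcat_cat W) (A, B, F) (B, A, G) = Idn (wcat_cat W) B"
    using assms by (auto simp: is_iso_def hom_wcat_cat) (auto simp: wcat_cat_def)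
  show "wfunctor W A B F" by (rule F)
  interpret F: wfunctor W A B F by (rule F)
  note F_simps [simp] = F.A.wfunctorD(4-7)[OF F] F.A.wfunctorD(4-7)[OF G]
  have gf: "wfobj G (wfobj F a) = a" if "a \<in> wobj A" for a
    using GF that by (auto simp: compose_def dest: fun_cong[of _ _ a])
  have fg: "wfobj F (wfobj G a) = a" if "a \<in> wobj B" for a
    using FG that by (auto simp: compose_def dest: fun_cong[of _ _ a])
  show "bij_betw (wfobj F) (wobj A) (wobj B)"
    using gf fg by (intro bij_betw_byWitness[where f' = "wfobj G"]) auto
  have gf': "Comp W (wfhom G (wfobj F a) (wfobj F b)) (wfhom F a b) = Idn W (whom A a b)"
    if "a \<in> wobj A" "b \<in> wobj A" for a b
  proof -
    have "(\<lambda>a \<in> wobj A. \<lambda>b \<in> wobj A. Comp W (wfhom G (wfobj F a) (wfobj F b)) (wfhom F a b))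
        = (\<lambda>a \<in> wobj A. \<lambda>b \<in> wobj A. Idn W (whom A a b))"
      using GF by simp
    from fun_cong[OF fun_cong[OF this, of a], of b] show ?thesis using that by simp
  qed
  have fg': "Comp W (wfhom F (wfobj G a) (wfobj G b)) (wfhom G a b) = Idn W (whom B a b)"
    if "a \<in> wobj B" "b \<in> wobj B" for a b
  proof -
    have "(\<lambda>a \<in> wobj B. \<lambda>b \<in> wobj B. Comp W (wfhom F (wfobj G a) (wfobj G b)) (wfhom G a b))
        = (\<lambda>a \<in> wobj B. \<lambda>b \<in> wobj B. Idn W (whom B a b))"
      using FG by simp
    from fun_cong[OF fun_cong[OF this, of a], of b] show ?thesis using that by simp
  qed
  fix a b assume ab: "a \<in> wobj A" "b \<in> wobj A"
  show "is_iso W (wfhom F a b)"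
    using ab gf'[OF ab] fg'[of "wfobj F a" "wfobj F b"] gf
    by (intro F.A.is_isoI[of _ "whom A a b" "whom B (wfobj F a) (wfobj F b)" "wfhom G (wfobj F a) (wfobj F b)"])
      (auto simp: hom_def)
qed

lemma cat_functor_func_comp:
  assumes "cat_functor C D F" "cat_functor D E G"
  shows "cat_functor C E (func_comp G F)"
proof -
  interpret F: cat_functor C D F by fact
  interpret G: cat_functor D E G by fact
  show ?thesis
  proof
    fix f g x y z assume fg: "f \<in> hom C x y" "g \<in> hom C y z"
    show "farr (func_comp G F) (Comp C g f) = Comp E (farr (func_comp G F) g) (farr (func_comp G F) f)"
      using G.farr_comp[OF F.farr_hom[OF fg(1)] F.farr_hom[OF fg(2)]] F.farr_comp[OF fg]
      by (simp add: func_comp_def)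
  qed (auto simp: func_comp_def F.farr_id G.farr_id intro: G.farr_hom F.farr_hom)
qed

lemma cat_functor_ob_functor:
  fixes W :: "('o, 'a) mcat"
  assumes "monoidal_category W"
  shows "cat_functor (wcat_cat W :: (('s, 'o, 'a) wcat, ('s, 'o, 'a) warr) cat) set_cat ob_functor"
proof -
  interpret W: monoidal_category W by fact
  interpret A: category "wcat_cat W :: (('s, 'o, 'a) wcat, ('s, 'o, 'a) warr) cat"
    by (rule category_wcat_cat) fact
  interpret S: category "set_cat :: ('s set, 's set \<times> 's set \<times> ('s \<Rightarrow> 's)) cat"
    by (rule category_set_cat)
  have "wfobj F \<in> wobj A \<rightarrow>\<^sub>E wobj B" if "wfunctor W A B F" for A B :: "('s, 'o, 'a) wcat" and F
    using that by (rule wfunctor.wfobj_ext)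
  then show ?thesis
    by unfold_locales (auto simp: ob_functor_def hom_wcat_cat hom_set_cat)
qed

section \<open>Diagrams with the properties are in the essential image\<close>

text \<open>The components of \<theta> are bijections and provide the vertices \<open>v n\<close>;
  naturality of \<theta> at \<open>f\<close>, evaluated at \<open>\<iota> i\<close>, is
  \<open>v_natural\<close>.\<close>

lemma properties_imp_isomorphic_phi:
  fixes W :: "('o, 'a) mcat" and \<iota> :: "nat \<Rightarrow> 's" and \<DD> :: "('s, 'o, 'a) wdiagram"
  assumes \<iota>: "inj \<iota>" and "monoidal_category W" and "cocomplete TYPE('s) W" "tensor_preserves_colimits TYPE('s) W"
    and "cat_functor delta_cat (wcat_cat W) \<DD>" and "necklicial_properties \<iota> W \<DD>"
  shows "\<exists>D \<in> Obj (strmon_cat nec W). isomorphic (fun_cat delta_cat (wcat_cat W)) \<DD> (phi_obj \<iota> W D)"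
proof -
  interpret W: monoidal_category W by fact
  interpret \<DD>: cat_functor delta_cat "wcat_cat W" \<DD> by fact
  obtain \<theta> where \<theta>: "\<theta> \<in> hom (fun_cat delta_cat set_cat) (ob_delta \<iota>) (func_comp ob_functor \<DD>)"
    and props: "is_iso (fun_cat delta_cat set_cat) \<theta> \<and>
        (\<forall>n i j. i < j \<and> j \<le> n \<longrightarrow> is_initial W (whom (fobj \<DD> n) (vertex \<iota> \<theta> n j) (vertex \<iota> \<theta> n i))) \<and>
        is_iso W (wid (fobj \<DD> 0) (vertex \<iota> \<theta> 0 0)) \<and>
        (\<forall>m n \<delta>. (m, n, \<delta>) \<in> Arr delta_cat \<and> inert (m, n, \<delta>) \<longrightarrow>
           is_iso W (wfhom (snd (snd (farr \<DD> (m, n, \<delta>)))) (vertex \<iota> \<theta> m 0) (vertex \<iota> \<theta> m m)))"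
    using assms(6) unfolding necklicial_properties_def by (rule bexE)
  note iso = props[THEN conjunct1]
    and init = props[THEN conjunct2, THEN conjunct1, rule_format, OF conjI]
    and unit = props[THEN conjunct2, THEN conjunct2, THEN conjunct1]
    and inert = props[THEN conjunct2, THEN conjunct2, THEN conjunct2, rule_format, OF conjI]
  obtain t where t: "\<theta> = (ob_delta \<iota>, func_comp ob_functor \<DD>, t)"
    and nat: "nat_trans delta_cat set_cat (ob_delta \<iota>) (func_comp ob_functor \<DD>) t"
    using \<theta> by (auto simp: hom_fun_cat)
  let ?v = "vertex \<iota> \<theta>" and ?s = "\<lambda>n. snd (snd (t n))"
  have v: "?v n i = ?s n (\<iota> i)" for n i by (simp add: vertex_def t)
  have tn: "t n = (\<iota> ` {0..n}, wobj (fobj \<DD> n), ?s n)" "?s n \<in> \<iota> ` {0..n} \<rightarrow>\<^sub>E wobj (fobj \<DD> n)" for n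
    using nat by (auto simp: nat_trans_def hom_set_cat ob_delta_def func_comp_def ob_functor_def
        dest!: spec[of _ n])
  have "bij_betw (?s n) (\<iota> ` {0..n}) (wobj (fobj \<DD> n))" for n
  proof -
    have "is_iso set_cat (t n)" using is_iso_component[OF iso[unfolded t], of n] by simp
    then have "is_iso set_cat (\<iota> ` {0..n}, wobj (fobj \<DD> n), ?s n)" by (metis tn(1))
    then show ?thesis using is_iso_set_cat_iff[OF tn(2)] by simp
  qed
  moreover have "bij_betw \<iota> {0..n} (\<iota> ` {0..n})" for n
    using \<iota> by (auto intro: inj_on_imp_bij_betw inj_on_subset)
  ultimately have "bij_betw (?s n \<circ> \<iota>) {0..n} (wobj (fobj \<DD> n))" for n
    using bij_betw_trans by blast
  then have bij: "bij_betw (?v n) {0..n} (wobj (fobj \<DD> n))" for n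
    by (simp add: comp_def v[abs_def])
  have natural: "wfobj (diagram_map \<DD> m n f) (?v m i) = ?v n (f i)" if f: "simplex_map m n f" and i: "i \<le> m" for m n f i
  proof -
    obtain F where F: "farr \<DD> (m, n, restrict f {0..m}) = (fobj \<DD> m, fobj \<DD> n, F)"
      using \<DD>.farr_hom[OF restrict_hom_delta[OF f]] by (auto simp: hom_wcat_cat)
    have "Comp set_cat (wobj (fobj \<DD> m), wobj (fobj \<DD> n), wfobj F) (\<iota> ` {0..m}, wobj (fobj \<DD> m), ?s m)
      = Comp set_cat (\<iota> ` {0..n}, wobj (fobj \<DD> n), ?s n) (farr (ob_delta \<iota>) (m, n, restrict f {0..m}))"
      using nat_trans_natural[OF nat restrict_hom_delta[OF f]] F tn(1)[of m] tn(1)[of n]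
      by (simp add: func_comp_def ob_functor_def)
    then have "compose (\<iota> ` {0..m}) (wfobj F) (?s m)
      = compose (\<iota> ` {0..m}) (?s n) (\<lambda>a \<in> \<iota> ` {0..m}. \<iota> (restrict f {0..m} (inv \<iota> a)))"
      by (simp add: ob_delta_def)
    from fun_cong[OF this, of "\<iota> i"] show ?thesis
      using i \<iota> by (simp add: compose_def F v inv_f_f)
  qed
  have "necklicial_diagram_initial W \<DD> ?v \<iota>"
  proof
    show "is_initial W (init_obj W)" using assms(3) by (intro initial_init_obj) unfold_locales
    show "is_initial W (tobj W x y) \<and> is_initial W (tobj W y x)" if "is_initial W x" "y \<in> Obj W" for x y
      using tensor_initial[OF _ assms(4) that] W.category_axioms by blast
    show "is_iso W (wfhom (diagram_map \<DD> d n (\<lambda>k. i + k)) (?v d 0) (?v d d))" if "i + d \<le> n" for i d n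
    proof (rule inert)
      have "(d, n, restrict (\<lambda>k. i + k) {0..d}) \<in> hom delta_cat d n"
        using that by (intro restrict_hom_delta simplex_mapI) auto
      then show "(d, n, restrict (\<lambda>k. i + k) {0..d}) \<in> Arr delta_cat" by (simp add: hom_def)
      show "inert (d, n, restrict (\<lambda>k. i + k) {0..d})" by (simp add: inert_def)
    qed
  qed (use \<iota> bij natural unit init in auto)
  then interpret N: necklicial_diagram_initial W \<DD> ?v \<iota> .
  have "N.nec_functor \<in> Obj (strmon_cat nec W)"
    using N.strong_monoidal_nec_functor by (simp add: strmon_cat_def)
  then show ?thesis using N.isomorphic_phi by blast
qed

section \<open>Diagrams in the essential image have the properties\<close>

lemma cat_functor_ob_delta:
  assumes \<iota>: "inj \<iota>" and "category delta_cat"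
  shows "cat_functor delta_cat set_cat (ob_delta \<iota>)"
proof -
  interpret J: category delta_cat by fact
  interpret S: category set_cat by (rule category_set_cat)
  show ?thesis
  proof
    fix F m n assume F: "F \<in> hom delta_cat m n"
    then obtain f where f: "F = (m, n, f)" "simplex_map m n f" by (auto simp: hom_delta_cat)
    then show "farr (ob_delta \<iota>) F \<in> hom set_cat (fobj (ob_delta \<iota>) m) (fobj (ob_delta \<iota>) n)"
      using \<iota> by (auto simp: ob_delta_def hom_set_cat inv_f_f)
    fix G k assume "G \<in> hom delta_cat n k"
    then obtain g where g: "G = (n, k, g)" "simplex_map n k g" by (auto simp: hom_delta_cat)
    show "farr (ob_delta \<iota>) (Comp delta_cat G F) = Comp set_cat (farr (ob_delta \<iota>) G) (farr (ob_delta \<iota>) F)"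
      using \<iota> simplex_map_le[OF f(2)]
      by (auto simp: f(1) g(1) ob_delta_def compose_def inv_f_f intro!: ext)
  qed (use \<iota> in \<open>auto simp: ob_delta_def inv_f_f intro!: ext\<close>)
qed

text \<open>An isomorphism from the image of \<open>D\<close> to \<open>\<DD>\<close> provides
  \<theta> through its object parts, and its hom parts transport the properties. In the image itself
  they hold by the choice of an initial object, by invertibility of \<open>eps D\<close>, and
  because an inert map acts as an identity at the pair of end vertices.\<close>

lemma isomorphic_phi_imp_properties:
  fixes W :: "('o, 'a) mcat" and \<iota> :: "nat \<Rightarrow> 's" and \<DD> :: "('s, 'o, 'a) wdiagram"
  assumes \<iota>: "inj \<iota>" and "monoidal_category W" and "cocomplete TYPE('s) W"
    and D: "strong_monoidal_functor nec W D"
    and "isomorphic (fun_cat delta_cat (wcat_cat W)) \<DD> (phi_obj \<iota> W D)"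
  shows "necklicial_properties \<iota> W \<DD>"
proof -
  let ?FC = "fun_cat delta_cat (wcat_cat W :: (('s, 'o, 'a) wcat, ('s, 'o, 'a) warr) cat)"
  let ?E = "phi_obj \<iota> W D"
  interpret W: monoidal_category W by fact
  interpret D: strong_monoidal_functor nec W D by fact
  obtain A where A: "A \<in> hom ?FC \<DD> ?E" "is_iso ?FC A"
    using assms(5) by (auto simp: isomorphic_def)
  then have \<DD>: "cat_functor delta_cat (wcat_cat W) \<DD>" and E: "cat_functor delta_cat (wcat_cat W) ?E"
    by (auto simp: hom_fun_cat)
  interpret \<DD>: cat_functor delta_cat "wcat_cat W" \<DD> by fact
  interpret E: cat_functor delta_cat "wcat_cat W" ?E by fact
  interpret FC: category ?FC by (rule category_fun_cat) unfold_locales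
  \<comment> \<open>The isomorphism is turned around because \<theta> has to start at the standard
    vertices, which are the objects of \<open>phi_wcat\<close>.\<close>
  have "inverse_arr ?FC A \<in> hom ?FC ?E \<DD>" "is_iso ?FC (inverse_arr ?FC A)"
    using A by (auto simp: hom_def)
  then obtain \<beta> where \<beta>: "nat_trans delta_cat (wcat_cat W) ?E \<DD> \<beta>" and iso: "is_iso ?FC (?E, \<DD>, \<beta>)"
    by (auto simp: hom_fun_cat)
  define G where "G n = snd (snd (\<beta> n))" for n
  have \<beta>n: "\<beta> n = (phi_wcat \<iota> W D n, fobj \<DD> n, G n)" for n
    using \<beta> by (auto simp: nat_trans_def hom_wcat_cat G_def phi_obj_def dest!: spec[of _ n])
  have "is_iso (wcat_cat W) (phi_wcat \<iota> W D n, fobj \<DD> n, G n)" for n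
    using is_iso_component[OF iso, of n] by (simp add: \<beta>n)
  note G = wcat_iso[OF this]
  note [simp] = inv_f_f[OF \<iota>]
  define t where "t n = (\<iota> ` {0..n}, wobj (fobj \<DD> n), wfobj (G n))" for n
  define \<theta> where "\<theta> = (ob_delta \<iota>, func_comp ob_functor \<DD>, t)"
  have G_obj: "wfobj (G n) \<in> \<iota> ` {0..n} \<rightarrow>\<^sub>E wobj (fobj \<DD> n)" for n
    using wfunctor.wfobj_ext[OF G(1)[of n]] by simp
  have natural: "Comp (wcat_cat W) (farr \<DD> (m, n, f)) (\<beta> m) = Comp (wcat_cat W) (\<beta> n) (phi_wfun \<iota> W D (m, n, f))"
    if "(m, n, f) \<in> hom delta_cat m n" for m n f
    using nat_trans_natural[OF \<beta> that] by (simp add: phi_obj_def)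
  have ob: "cat_functor delta_cat set_cat (func_comp ob_functor \<DD>)"
    by (rule cat_functor_func_comp[OF \<DD> cat_functor_ob_functor]) unfold_locales
  have ob': "cat_functor delta_cat set_cat (ob_delta \<iota>)"
    using \<iota> by (rule cat_functor_ob_delta) unfold_locales
  have "nat_trans delta_cat set_cat (ob_delta \<iota>) (func_comp ob_functor \<DD>) t"
    unfolding nat_trans_def
  proof (intro conjI ballI allI)
    show "t \<in> extensional (Obj delta_cat)" by (simp add: extensional_def)
    fix n
    show "t n \<in> hom set_cat (fobj (ob_delta \<iota>) n) (fobj (func_comp ob_functor \<DD>) n)"
      using G_obj[of n] by (simp add: t_def hom_set_cat ob_delta_def func_comp_def ob_functor_def)
  next
    fix m n F assume F: "F \<in> hom delta_cat m n"
    then obtain f where f: "F = (m, n, f)" by (auto simp: hom_delta_cat)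
    obtain H where H: "farr \<DD> (m, n, f) = (fobj \<DD> m, fobj \<DD> n, H)"
      using \<DD>.farr_hom[OF F] f by (auto simp: hom_wcat_cat)
    show "Comp set_cat (farr (func_comp ob_functor \<DD>) F) (t m) = Comp set_cat (t n) (farr (ob_delta \<iota>) F)"
      using natural[of m n f] F
      by (simp add: f t_def func_comp_def ob_functor_def ob_delta_def H \<beta>n phi_wfun_def)
  qed
  then have \<theta>: "\<theta> \<in> hom (fun_cat delta_cat set_cat) (ob_delta \<iota>) (func_comp ob_functor \<DD>)"
    and \<theta>_iso: "is_iso (fun_cat delta_cat set_cat) \<theta>"
    unfolding \<theta>_def using ob ob' G(2) G_obj
    by (auto simp: hom_fun_cat t_def is_iso_set_cat_iff intro!: nat_iso_fun_cat)
  have v: "vertex \<iota> \<theta> n k = wfobj (G n) (\<iota> k)" for n k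
    by (simp add: vertex_def \<theta>_def t_def)
  have G_hom: "wfhom (G n) (\<iota> i) (\<iota> j) \<in> hom W (phi_hom W D i j) (whom (fobj \<DD> n) (wfobj (G n) (\<iota> i)) (wfobj (G n) (\<iota> j)))"
    "is_iso W (wfhom (G n) (\<iota> i) (\<iota> j))" if "i \<le> n" "j \<le> n" for n i j
    using wfunctor.wfhom_hom[OF G(1)[of n], of "\<iota> i" "\<iota> j"] G(3)[of "\<iota> i" n "\<iota> j"] that \<iota> by auto
  have "is_initial W (whom (fobj \<DD> n) (vertex \<iota> \<theta> n j) (vertex \<iota> \<theta> n i))" if "i < j" "j \<le> n" for n i j
  proof (rule W.initial_transport)
    show "is_initial W (phi_hom W D j i)"
      using that assms(3) by (simp add: phi_hom_def initial_init_obj W.category_axioms)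
  qed (use G_hom[of j n i] that in \<open>auto simp: v hom_def\<close>)
  moreover have "is_iso W (wid (fobj \<DD> 0) (vertex \<iota> \<theta> 0 0))"
  proof -
    \<comment> \<open>Enriched functors preserve units, and the unit of \<open>phi_wcat\<close> is
      the invertible \<open>eps D\<close>.\<close>
    have "Comp W (wfhom (G 0) (\<iota> 0) (\<iota> 0)) (eps D) = wid (fobj \<DD> 0) (vertex \<iota> \<theta> 0 0)"
      using wfunctor.wfhom_id[OF G(1)[of 0], of "\<iota> 0"] by (simp add: v)
    moreover have "is_iso W (Comp W (wfhom (G 0) (\<iota> 0) (\<iota> 0)) (eps D))"
      using D.eps_iso D.eps_hom G_hom[of 0 0 0] by (intro W.is_iso_comp) (auto simp: hom_def phi_hom_def)
    ultimately show ?thesis by simp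
  qed
  moreover have "is_iso W (wfhom (snd (snd (farr \<DD> (m, n, \<delta>)))) (vertex \<iota> \<theta> m 0) (vertex \<iota> \<theta> m m))"
    if \<delta>: "(m, n, \<delta>) \<in> Arr delta_cat" "inert (m, n, \<delta>)" for m n \<delta>
  proof -
    have \<delta>': "(m, n, \<delta>) \<in> hom delta_cat m n" using \<delta>(1) by (simp add: hom_def delta_cat_def)
    have add: "\<delta> k = \<delta> 0 + k" if "k \<le> m" for k using \<delta>(2) that unfolding inert_def prod.case by (metis atLeastAtMost_iff le0)
    have sm: "simplex_map m n \<delta>" using \<delta>' by (simp add: hom_delta_cat)
    have le: "\<delta> 0 \<le> n" "\<delta> m \<le> n" "\<delta> 0 \<le> \<delta> m"
      using simplex_map_le[OF sm] simplex_map_mono[OF sm] by simp_all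
    obtain H where H: "farr \<DD> (m, n, \<delta>) = (fobj \<DD> m, fobj \<DD> n, H)" and wH: "wfunctor W (fobj \<DD> m) (fobj \<DD> n) H"
      using \<DD>.farr_hom[OF \<delta>'] by (auto simp: hom_wcat_cat)
    let ?P = "snd (snd (phi_wfun \<iota> W D (m, n, \<delta>)))"
    let ?h = "wfhom H (wfobj (G m) (\<iota> 0)) (wfobj (G m) (\<iota> m))"
    \<comment> \<open>By inertness the necklace map attached to \<delta> at the pair of end vertices
      is the identity of \<open>simplex m\<close>.\<close>
    have "(\<lambda>k \<in> {0..m}. \<delta> k - \<delta> 0) = (\<lambda>k \<in> {0..m}. k)"
      by (intro restrict_ext) (metis add add_diff_cancel_left' atLeastAtMost_iff)
    moreover have "\<delta> m - \<delta> 0 = m" using add[of m] by simp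
    ultimately have P: "wfhom ?P (\<iota> 0) (\<iota> m) = Idn W (fobj D (simplex m))"
      using D.farr_id[of "simplex m"] by (simp add: phi_wfun_def)
    have "wfhom (snd (snd (Comp (wcat_cat W) (farr \<DD> (m, n, \<delta>)) (\<beta> m)))) (\<iota> 0) (\<iota> m)
        = Comp W ?h (wfhom (G m) (\<iota> 0) (\<iota> m))"
      by (simp add: H \<beta>n)
    moreover have "wfhom (snd (snd (Comp (wcat_cat W) (\<beta> n) (phi_wfun \<iota> W D (m, n, \<delta>))))) (\<iota> 0) (\<iota> m)
        = Comp W (wfhom (G n) (\<iota> (\<delta> 0)) (\<iota> (\<delta> m))) (wfhom ?P (\<iota> 0) (\<iota> m))"
      by (simp add: \<beta>n phi_wfun_def)
    \<comment> \<open>Naturality of \<beta> with an identity on one side leaves three maps, of which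
      the two components of \<beta> are known to be invertible.\<close>
    ultimately have eq: "Comp W ?h (wfhom (G m) (\<iota> 0) (\<iota> m)) = wfhom (G n) (\<iota> (\<delta> 0)) (\<iota> (\<delta> m))"
      using natural[OF \<delta>'] P G_hom(1)[of "\<delta> 0" n "\<delta> m"] le add[of m] by (auto simp: phi_hom_def hom_def)
    have "is_iso W ?h"
    proof (rule W.is_iso_of_comp_left)
      show "is_iso W (Comp W ?h (wfhom (G m) (\<iota> 0) (\<iota> m)))"
        unfolding eq using le by (intro G_hom)
      show "is_iso W (wfhom (G m) (\<iota> 0) (\<iota> m))" by (intro G_hom) auto
      have "wfobj (G m) (\<iota> 0) \<in> wobj (fobj \<DD> m)" "wfobj (G m) (\<iota> m) \<in> wobj (fobj \<DD> m)"
        using G_obj[of m] by auto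
      then show "?h \<in> Arr W" "Dom W ?h = Cod W (wfhom (G m) (\<iota> 0) (\<iota> m))"
        using W.wfunctorD(5,6)[OF wH] G_hom(1)[of 0 m m] by (auto simp: hom_def)
    qed
    then show ?thesis by (simp add: H v)
  qed
  ultimately show ?thesis
    unfolding necklicial_properties_def using \<theta> \<theta>_iso by blast
qed

section \<open>Nerves\<close>

lemma op_cat_simps [simp]:
  "Obj (op_cat C) = Obj C" "Arr (op_cat C) = Arr C" "Dom (op_cat C) = Cod C" "Cod (op_cat C) = Dom C"
  "Idn (op_cat C) = Idn C" "Comp (op_cat C) g f = Comp C f g" "hom (op_cat C) x y = hom C y x"
  by (auto simp: op_cat_def hom_def)

lemma category_op_cat:
  assumes "category C"
  shows "category (op_cat C)"
proof -
  interpret category C by fact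
  show ?thesis by unfold_locales (auto intro: comp_hom simp: comp_assoc)
qed

lemma isomorphic_trans:
  assumes "category C" "isomorphic C x y" "isomorphic C y z"
  shows "isomorphic C x z"
proof -
  interpret category C by fact
  obtain f g where f: "f \<in> hom C x y" "is_iso C f" and g: "g \<in> hom C y z" "is_iso C g"
    using assms by (auto simp: isomorphic_def)
  then have "is_iso C (Comp C g f)" by (intro is_iso_comp) (auto simp: hom_def)
  then show ?thesis using comp_hom[OF f(1) g(1)] unfolding isomorphic_def by blast
qed

text \<open>Values of a functor off its source category are unconstrained, so agreement on objects
  and arrows gives an isomorphism with identity components, not equality of records.\<close>

lemma functor_eq_imp_isomorphic:
  fixes J :: "('o, 'a) cat" and C :: "('p, 'b) cat"
  assumes F: "cat_functor J C F" and obj: "\<And>x. x \<in> Obj J \<Longrightarrow> fobj E x = fobj F x"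
    and arr: "\<And>f x y. f \<in> hom J x y \<Longrightarrow> farr E f = farr F f"
  shows "isomorphic (fun_cat J C) F E"
proof (rule conjugate_functor(2)[OF F])
  interpret F: cat_functor J C F by fact
  fix x assume "x \<in> Obj J"
  then show "is_iso C (Idn C (fobj F x))" "Idn C (fobj F x) \<in> hom C (fobj E x) (fobj F x)"
    by (simp_all add: obj F.D.id_hom)
next
  interpret F: cat_functor J C F by fact
  fix f x y assume f: "f \<in> hom J x y"
  have [simp]: "x \<in> Obj J" "y \<in> Obj J" using f F.C.dom_cod by (auto simp: hom_def)
  have [simp]: "farr F f \<in> Arr C" "Dom C (farr F f) = fobj F x" "Cod C (farr F f) = fobj F y"
    using F.farr_hom[OF f] by (auto simp: hom_def)
  have "inverse_arr C (Idn C (fobj F y)) = Idn C (fobj F y)"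
    by (rule F.D.iso_cancel_left[of "Idn C (fobj F y)"]) simp_all
  then show "farr E f = Comp C (inverse_arr C (Idn C (fobj F y))) (Comp C (farr F f) (Idn C (fobj F x)))"
    by (simp add: arr[OF f])
qed

lemma nerve_obj_functor:
  fixes W :: "('o, 'a) mcat" and \<DD> :: "('s, 'o, 'a) wdiagram"
  assumes "cat_functor delta_cat (wcat_cat W) \<DD>" "C \<in> Obj (wcat_cat W)"
  shows "cat_functor (op_cat delta_cat) set_cat (nerve_obj W \<DD> C)"
proof -
  interpret \<DD>: cat_functor delta_cat "wcat_cat W" \<DD> by fact
  interpret J: category "op_cat delta_cat" by (rule category_op_cat) unfold_locales
  interpret S: category "set_cat :: (('s, 'o, 'a) warr set, _) cat" by (rule category_set_cat)
  show ?thesis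
  proof
    fix F n m assume "F \<in> hom (op_cat delta_cat) n m"
    then have F: "F \<in> hom delta_cat m n" by simp
    then obtain f where f: "F = (m, n, f)" by (auto simp: hom_delta_cat)
    note DF = \<DD>.farr_hom[OF F]
    show "farr (nerve_obj W \<DD> C) F \<in> hom set_cat (fobj (nerve_obj W \<DD> C) n) (fobj (nerve_obj W \<DD> C) m)"
      using \<DD>.D.comp_hom[OF DF] by (auto simp: nerve_obj_def hom_set_cat f)
    fix G k assume "G \<in> hom (op_cat delta_cat) m k"
    then have G: "G \<in> hom delta_cat k m" by simp
    then obtain g where g: "G = (k, m, g)" by (auto simp: hom_delta_cat)
    have "farr \<DD> (k, n, compose {0..k} f g) = Comp (wcat_cat W) (farr \<DD> F) (farr \<DD> G)"
      using \<DD>.farr_comp[OF G F] by (simp add: f g)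
    moreover have "Comp (wcat_cat W) H (Comp (wcat_cat W) (farr \<DD> F) (farr \<DD> G))
        = Comp (wcat_cat W) (Comp (wcat_cat W) H (farr \<DD> F)) (farr \<DD> G)"
      if "H \<in> hom (wcat_cat W) (fobj \<DD> n) C" for H
      using \<DD>.D.comp_assoc[OF \<DD>.farr_hom[OF G] DF that] by simp
    ultimately show "farr (nerve_obj W \<DD> C) (Comp (op_cat delta_cat) G F)
        = Comp set_cat (farr (nerve_obj W \<DD> C) G) (farr (nerve_obj W \<DD> C) F)"
      using \<DD>.D.comp_hom[OF DF] by (auto simp: nerve_obj_def f g compose_def intro!: ext)
  next
    fix n
    have "farr \<DD> (n, n, \<lambda>k \<in> {0..n}. k) = Idn (wcat_cat W) (fobj \<DD> n)"
      using \<DD>.farr_id[of n] by simp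
    then have "Comp (wcat_cat W) H (farr \<DD> (n, n, \<lambda>k \<in> {0..n}. k)) = H"
      if "H \<in> hom (wcat_cat W) (fobj \<DD> n) C" for H
      using \<DD>.D.comp_id[OF that] by simp
    then show "farr (nerve_obj W \<DD> C) (Idn (op_cat delta_cat) n) = Idn set_cat (fobj (nerve_obj W \<DD> C) n)"
      by (auto simp: nerve_obj_def intro!: ext)
  qed simp
qed

text \<open>\<open>necklicial_nerve\<close> demands membership in the functor category. Naturality
  holds since composing on the left commutes with composing on the right.\<close>

lemma nerve_functor:
  fixes W :: "('o, 'a) mcat" and \<DD> :: "('s, 'o, 'a) wdiagram"
  assumes \<DD>: "cat_functor delta_cat (wcat_cat W) \<DD>"
  shows "cat_functor (wcat_cat W) sset_cat (nerve W \<DD>)"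
proof -
  interpret \<DD>: cat_functor delta_cat "wcat_cat W" \<DD> by fact
  interpret SS: category "sset_cat :: (('s, 'o, 'a) warr sset, _) cat"
    unfolding sset_cat_def by (intro category_fun_cat category_op_cat category_set_cat) unfold_locales
  let ?C = "wcat_cat W :: (('s, 'o, 'a) wcat, ('s, 'o, 'a) warr) cat"
  show ?thesis
  proof
    fix A assume "A \<in> Obj ?C"
    then show "fobj (nerve W \<DD>) A \<in> Obj sset_cat"
      using nerve_obj_functor[OF \<DD>] by (simp add: sset_cat_def Obj_fun_cat nerve_def)
  next
    fix H A B assume H: "H \<in> hom ?C A B"
    then have AB: "A \<in> Obj ?C" "B \<in> Obj ?C" "Dom ?C H = A" "Cod ?C H = B"
      by (auto simp: hom_wcat_cat)
    let ?t = "\<lambda>n. (hom ?C (fobj \<DD> n) A, hom ?C (fobj \<DD> n) B, \<lambda>G \<in> hom ?C (fobj \<DD> n) A. Comp ?C H G)"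
    have "nat_trans (op_cat delta_cat) set_cat (nerve_obj W \<DD> A) (nerve_obj W \<DD> B) ?t"
      unfolding nat_trans_def
    proof (intro conjI ballI allI)
      fix n show "?t n \<in> hom set_cat (fobj (nerve_obj W \<DD> A) n) (fobj (nerve_obj W \<DD> B) n)"
        using \<DD>.D.comp_hom[OF _ H] by (auto simp: hom_set_cat nerve_obj_def)
    next
      fix n m F assume "F \<in> hom (op_cat delta_cat) n m"
      then have F: "F \<in> hom delta_cat m n" by simp
      then obtain f where f: "F = (m, n, f)" by (auto simp: hom_delta_cat)
      note DF = \<DD>.farr_hom[OF F]
      have "Comp ?C (Comp ?C H G) (farr \<DD> F) = Comp ?C H (Comp ?C G (farr \<DD> F))"
        if "G \<in> hom ?C (fobj \<DD> n) A" for G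
        by (rule \<DD>.D.comp_assoc[OF DF that H])
      then show "Comp set_cat (farr (nerve_obj W \<DD> B) F) (?t n) = Comp set_cat (?t m) (farr (nerve_obj W \<DD> A) F)"
        using \<DD>.D.comp_hom[OF DF] \<DD>.D.comp_hom[OF _ H]
        by (auto simp: nerve_obj_def f compose_def intro!: ext)
    qed (simp add: extensional_def)
    then show "farr (nerve W \<DD>) H \<in> hom sset_cat (fobj (nerve W \<DD>) A) (fobj (nerve W \<DD>) B)"
      using nerve_obj_functor[OF \<DD>] AB by (simp add: sset_cat_def hom_fun_cat nerve_def)
    fix K D assume K: "K \<in> hom ?C B D"
    then have D: "Dom ?C K = B" "Cod ?C K = D" by (auto simp: hom_def)
    have KH: "Dom ?C (Comp ?C K H) = A" "Cod ?C (Comp ?C K H) = D"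
      using \<DD>.D.comp_hom[OF H K] by (auto simp: hom_def)
    have "Comp ?C (Comp ?C K H) G = Comp ?C K (Comp ?C H G)" if "G \<in> hom ?C (fobj \<DD> n) A" for G n
      by (rule \<DD>.D.comp_assoc[OF that H K])
    then show "farr (nerve W \<DD>) (Comp ?C K H) = Comp sset_cat (farr (nerve W \<DD>) K) (farr (nerve W \<DD>) H)"
      using \<DD>.D.comp_hom[OF _ H]
      by (auto simp: nerve_def Let_def AB D KH sset_cat_def fun_cat_def compose_def intro!: ext)
  next
    fix A assume A: "A \<in> Obj ?C"
    have "Comp ?C (Idn ?C A) G = G" if "G \<in> hom ?C (fobj \<DD> n) A" for G n
      using that by (rule \<DD>.D.id_comp)
    moreover have "Dom ?C (Idn ?C A) = A" "Cod ?C (Idn ?C A) = A"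
      using A by (simp_all only: \<DD>.D.Dom_Idn \<DD>.D.Cod_Idn)
    ultimately show "farr (nerve W \<DD>) (Idn ?C A) = Idn sset_cat (fobj (nerve W \<DD>) A)"
      by (auto simp: nerve_def Let_def sset_cat_def fun_cat_def nerve_obj_def intro!: ext)
  qed
qed

text \<open>Yoneda: the diagram is recovered from its nerve by evaluating at the identities of the \<open>\<DD>\<^sup>n\<close>.\<close>

lemma nerve_inject:
  fixes W :: "('o, 'a) mcat" and \<DD> \<EE> :: "('s, 'o, 'a) wdiagram"
  assumes \<DD>: "cat_functor delta_cat (wcat_cat W) \<DD>" and \<EE>: "cat_functor delta_cat (wcat_cat W) \<EE>"
    and eq: "nerve W \<DD> = nerve W \<EE>"
  shows "fobj \<DD> n = fobj \<EE> n" and "f \<in> hom delta_cat m n \<Longrightarrow> farr \<DD> f = farr \<EE> f"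
proof -
  interpret \<DD>: cat_functor delta_cat "wcat_cat W" \<DD> by fact
  interpret \<EE>: cat_functor delta_cat "wcat_cat W" \<EE> by fact
  let ?C = "wcat_cat W :: (('s, 'o, 'a) wcat, ('s, 'o, 'a) warr) cat"
  have obj_eq: "nerve_obj W \<DD> c = nerve_obj W \<EE> c" for c
    using eq by (simp add: nerve_def fun_eq_iff)
  have id: "Idn ?C (fobj \<DD> n) \<in> hom ?C (fobj \<DD> n) (fobj \<DD> n)" for n
    by (rule \<DD>.D.id_hom) (rule \<DD>.fobj_Obj, simp)
  have homs: "hom ?C (fobj \<DD> n) c = hom ?C (fobj \<EE> n) c" for n c
    using obj_eq[of c] by (simp add: nerve_obj_def fun_eq_iff)
  \<comment> \<open>The identity of \<open>fobj \<DD> n\<close> lies in a hom-set out of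
    \<open>fobj \<EE> n\<close>, and an arrow of \<open>wcat_cat W\<close> records its
    source.\<close>
  have objs: "fobj \<DD> n = fobj \<EE> n" for n
    using id[of n] unfolding homs[of n "fobj \<DD> n"] by (simp add: hom_wcat_cat)
  then show "fobj \<DD> n = fobj \<EE> n" .
  assume f: "f \<in> hom delta_cat m n"
  then obtain f' where f': "f = (m, n, f')" by (auto simp: hom_delta_cat)
  let ?I = "Idn ?C (fobj \<DD> n)"
  have "farr (nerve_obj W \<DD> (fobj \<DD> n)) f = farr (nerve_obj W \<EE> (fobj \<DD> n)) f"
    by (simp only: obj_eq)
  then have "(\<lambda>G \<in> hom ?C (fobj \<DD> n) (fobj \<DD> n). Comp ?C G (farr \<DD> f))
    = (\<lambda>G \<in> hom ?C (fobj \<DD> n) (fobj \<DD> n). Comp ?C G (farr \<EE> f))"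
    by (simp add: nerve_obj_def f' flip: objs)
  from fun_cong[OF this, of ?I] have "Comp ?C ?I (farr \<DD> f) = Comp ?C ?I (farr \<EE> f)"
    using id[of n] by (simp only: restrict_apply' if_True)
  then show "farr \<DD> f = farr \<EE> f"
    using \<DD>.D.id_comp[OF \<DD>.farr_hom[OF f]] \<DD>.D.id_comp[OF \<EE>.farr_hom[OF f]]
    by (simp only: objs)
qed

theorem proposition3p5:
  fixes W :: "('o, 'a) mcat" and \<iota> :: "nat \<Rightarrow> 's"
  assumes "inj \<iota>"
    and "monoidal_category W"
    and "cocomplete TYPE('s) W"
    and "tensor_preserves_colimits TYPE('s) W"
  shows "essential_image (strmon_cat nec W) (fun_cat delta_cat (wcat_cat W)) (Phi \<iota> W)
           = {\<DD> \<in> Obj (fun_cat delta_cat (wcat_cat W)). necklicial_properties \<iota> W \<DD>}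
           \<and> (\<forall>\<DD> \<in> Obj (fun_cat delta_cat (wcat_cat W) :: (('s, 'o, 'a) wdiagram, _) cat).
              necklicial_nerve \<iota> W (nerve W \<DD>) \<longleftrightarrow> necklicial_properties \<iota> W \<DD>)"
proof -
  let ?FC = "fun_cat delta_cat (wcat_cat W :: (('s, 'o, 'a) wcat, ('s, 'o, 'a) warr) cat)"
  have Phi: "fobj (Phi \<iota> W) D = phi_obj \<iota> W D" for D by (simp add: Phi_def)
  have iff: "(\<exists>D \<in> Obj (strmon_cat nec W). isomorphic ?FC \<DD> (phi_obj \<iota> W D)) \<longleftrightarrow> necklicial_properties \<iota> W \<DD>"
    if "\<DD> \<in> Obj ?FC" for \<DD>
  proof
    assume "\<exists>D \<in> Obj (strmon_cat nec W). isomorphic ?FC \<DD> (phi_obj \<iota> W D)"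
    then obtain D where "strong_monoidal_functor nec W D" "isomorphic ?FC \<DD> (phi_obj \<iota> W D)"
      by (auto simp: strmon_cat_def)
    then show "necklicial_properties \<iota> W \<DD>"
      using isomorphic_phi_imp_properties assms(1-3) by blast
  next
    assume "necklicial_properties \<iota> W \<DD>"
    then show "\<exists>D \<in> Obj (strmon_cat nec W). isomorphic ?FC \<DD> (phi_obj \<iota> W D)"
      using properties_imp_isomorphic_phi[OF assms] that by (simp add: Obj_fun_cat)
  qed
  have "necklicial_nerve \<iota> W (nerve W \<DD>) \<longleftrightarrow> necklicial_properties \<iota> W \<DD>" if \<DD>: "\<DD> \<in> Obj ?FC" for \<DD>
  proof
    assume "necklicial_nerve \<iota> W (nerve W \<DD>)"
    \<comment> \<open>The definition provides some diagram with the given nerve, which need not be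
      \<open>\<DD>\<close>; by Yoneda it agrees with \<open>\<DD>\<close> on objects and arrows and
      is therefore isomorphic to it.\<close>
    then obtain \<EE> D where \<EE>: "\<EE> \<in> Obj ?FC" "nerve W \<DD> = nerve W \<EE>"
      and D: "D \<in> Obj (strmon_cat nec W)" "isomorphic ?FC \<EE> (phi_obj \<iota> W D)"
      unfolding necklicial_nerve_def Phi by blast
    have functors: "cat_functor delta_cat (wcat_cat W) \<DD>" "cat_functor delta_cat (wcat_cat W) \<EE>"
      using \<DD> \<EE>(1) by (simp_all add: Obj_fun_cat)
    have "isomorphic ?FC \<DD> \<EE>"
      by (rule functor_eq_imp_isomorphic[OF functors(1)])
        (simp_all only: nerve_inject[OF functors \<EE>(2)])
    moreover have "category ?FC"
      by (rule category_fun_cat) (rule cat_functor.axioms[OF functors(1)])+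
    ultimately have "isomorphic ?FC \<DD> (phi_obj \<iota> W D)"
      by (rule_tac isomorphic_trans[OF _ _ D(2)])
    then show "necklicial_properties \<iota> W \<DD>" using iff[OF \<DD>] D(1) by blast
  next
    assume "necklicial_properties \<iota> W \<DD>"
    then obtain D where "D \<in> Obj (strmon_cat nec W)" "isomorphic ?FC \<DD> (phi_obj \<iota> W D)"
      using iff[OF \<DD>] by blast
    then show "necklicial_nerve \<iota> W (nerve W \<DD>)"
      using nerve_functor \<DD> unfolding necklicial_nerve_def Phi by (auto simp: Obj_fun_cat)
  qed
  then show ?thesis
    using iff unfolding essential_image_def Phi by blast
qed

end
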